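(* Suppose $\ell$ is classification-calibrated, let $\mathring\phi_\ell$ be any admissible complexity bound, and fix any function $\hat{\mathfrak s}:\mathbb N\to[1,\infty)$. Let $j_\ell=-\lceil\log_2(\bar\ell)\rceil$, $u_{j_\ell-2}=u_{j_\ell-1}=1$, and for each integer $j\ge j_\ell$ let $$\mathcal F_j=\mathcal F(\mathscr E_\ell(2^{2-j});01)_{\mathrm{DIS}(\mathcal F(\mathscr E_\ell(2^{2-j});01))},\qquad \mathcal U_j=\mathrm{DIS}(\mathcal F_j),$$ and suppose $u_j\in\mathbb N$ satisfies $\log_2(u_j)\in\mathbb N$ and $$u_j\ge\max\big\{2\,\mathring{\mathrm M}_\ell(2^{-j-1},2^{2-j};\mathcal F_j,\mathcal P_{XY},\hat{\mathfrak s}(u_j)),\ u_{j-1},\ 2u_{j-2}\big\}.$$ Suppose $f^\star\in\mathcal F$. For any $\varepsilon\in(0,1)$ and $s\in[1,\infty)$, letting $j_\varepsilon=\lceil\log_2(1/\Gamma_\ell(\varepsilon))\rceil$, if $u,n\in\mathbb N$ satisfy $$u\ge u_{j_\varepsilon}\qquad\text{and}\qquad n\ge s+2e\sum_{j=j_\ell}^{j_\varepsilon}\mathcal P(\mathcal U_j)\,u_j,$$ then Algorithm 1, run with arguments $\ell,u,n$ (and the function $\hat{\mathfrak s}$), uses at most $u$ unlabeled samples, requests at most $n$ labels, and with probability at least $$1-2^{-s}-\sum_{i=1}^{\log_2(u_{j_\varepsilon})}6e^{-\hat{\mathfrak s}(2^i)}$$ returns a function $\hat h$ with $\mathrm{er}(\hat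 h)-\mathrm{er}(f^\star)\le\varepsilon$.
   Context: **Setting.** $(\mathcal X,\mathcal B_{\mathcal X})$ is a measurable space, $\mathcal Y=\{-1,+1\}$, $\bar{\mathbb R}=\mathbb R\cup\{\pm\infty\}$; $\mathcal F^*$ is the set of measurable $g:\mathcal X\to\bar{\mathbb R}$; $\mathcal F\subseteq\mathcal F^*$ is the function class; $\mathcal P_{XY}$ is a probability distribution on $\mathcal X\times\mathcal Y$ with marginal $\mathcal P$ on $\mathcal X$. $\mathbb N=\{1,2,\dots\}$, $x\vee y=\max\{x,y\}$. All sets and functions appearing are assumed measurable. $\mathrm{sign}$ takes values in $\{-1,+1\}$ ($\mathrm{sign}(0)$ being a fixed element). The data $(X_1,Y_1),(X_2,Y_2),\dots$ are i.i.d. $\mathcal P_{XY}$. For a distribution $P$ on $\mathcal X\times\mathcal Y$ and $(X,Y)\sim P$: $\mathrm{er}(h;P)=P(\mathrm{sign}(h(X))\ne Y)$, and $\eta(\cdot;P)$ is a version of $\mathbb P(Y=1|X=\cdot)$. Whenever the argument $P$ is omitted from a notation, $P=\mathcal P_{XY}$. **Loss.** $\ell:\bar{\mathbb R}\to[0,\infty]$ is a loss, finite on $\mathbb R$; $\bar\ell=1\vee\sup_{(x,y)}\sup_{h\in\mathcal F}\ell(yh(x))$ is assumed finite. $\mathrm R_\ell(g;P)=\mathbb E[\ell(g(X)Y)]$, $(X,Y)\sim P$; for a finite sample $S=\{(x_1,y_1),\dots,(x_m,y_m)\}$, $\mathrm R_\ell(g;S)=\frac1m\sum_i\ell(g(x_i)y_i)$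 (and $0$ if $S$ is empty). For $\eta_0\in[0,1]$, $\ell^\star(\eta_0)=\inf_{z\in\bar{\mathbb R}}(\eta_0\ell(z)+(1-\eta_0)\ell(-z))$ and $\ell^\star_-(\eta_0)$ is the same infimum restricted to $z$ with $z(2\eta_0-1)\le0$. $\ell$ is classification-calibrated if $\ell^\star_-(\eta_0)>\ell^\star(\eta_0)$ for all $\eta_0\in[0,1]\setminus\{1/2\}$. It is assumed that $\ell^\star(\eta_0)$ is attained at some $z^\star(\eta_0)$; $f^\star_P(x)=z^\star(\eta(x;P))$ and $f^\star=f^\star_{\mathcal P_{XY}}$. **Sets.** $[\mathcal H]=\{f\in\mathcal F^*:\forall x,\ \inf_{h\in\mathcal H}h(x)\le f(x)\le\sup_{h\in\mathcal H}h(x)\}$; $\mathrm{DIS}(\mathcal H)=\{x:\exists h,g\in\mathcal H,\ \mathrm{sign}(h(x))\ne\mathrm{sign}(g(x))\}$; $\mathcal H(\gamma;\ell,P)=\{h\in\mathcal H:\mathrm R_\ell(h;P)-\inf_{g\in\mathcal H}\mathrm R_\ell(g;P)\le\gamma\}$; $\mathcal H(\varepsilon;01)=\{h\in\mathcal H:\mathrm{er}(h)-\inf_{g\in\mathcal H}\mathrm{er}(g)\le\varepsilon\}$. For measurable $\mathcal U\subseteq\mathcal X$, $h_{\mathcal U,g}$ equals $h$ on $\mathcal U$ and $g$ on $\mathcal X\setminus\mathcal U$; $\mathcal H_{\mathcal U,g}=\{h_{\mathcal U,g}:h\in\mathcal H\}$, and $\mathcal H_{\mathcal U}=\mathcal H_{\mathcal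 U,f^\star}$. $\mathrm D_\ell(h,g;P)=\sqrt{\mathbb E[(\ell(h(X)Y)-\ell(g(X)Y))^2]}$ with $(X,Y)\sim P$, and $\mathrm D_\ell(\mathcal H;P)=\sup_{h,g\in\mathcal H}\mathrm D_\ell(h,g;P)$. **Risk transforms.** For $\varepsilon\in[0,1]$, $\Gamma_\ell(\varepsilon)=\sup(\{\gamma>0:\mathcal F^*(\gamma;\ell)\subseteq\mathcal F^*(\varepsilon;01)\}\cup\{0\})$; for $\gamma\ge0$, $\mathscr E_\ell(\gamma)=\inf\{\varepsilon>0:\gamma\le\Gamma_\ell(\varepsilon)\}$. If $j_\varepsilon<j_\ell$ (including $\Gamma_\ell(\varepsilon)=\infty$, $j_\varepsilon=-\infty$), $u_{j_\varepsilon}$ is read as $1$; empty sums are $0$. **Complexities.** With $S\sim P^m$, $\phi_\ell(\mathcal H;m,P)=\mathbb E\big[\sup_{h,g\in\mathcal H}(\mathrm R_\ell(h;P)-\mathrm R_\ell(g;P))-(\mathrm R_\ell(h;S)-\mathrm R_\ell(g;S))\big]$. An *admissible complexity bound* is a quantity $\mathring\phi_\ell(\sigma,\mathcal H;m,P)$, defined for every distribution $P$ on $\mathcal X\times\mathcal Y$, $\sigma\in[0,\infty]$, $\mathcal H\subseteq[\mathcal F]$, $m\in\mathbb N$, such that whenever $f^\star_P\in\mathcal H$: (i) if $0\le\sigma\le\sigma'$, $\mathcal H\subseteq\mathcal H'\subseteq[\mathcal F]$, $\mathcal U\subseteq\mathcal X$, $m'\le m$, then $\mathring\phi_\ell(\sigma,\mathcal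 H_{\mathcal U,f^\star_P};m,P)\le\mathring\phi_\ell(\sigma',\mathcal H';m',P)$; (ii) for all $\sigma\ge\mathrm D_\ell(\mathcal H;P)$, $\phi_\ell(\mathcal H;m,P)\le\mathring\phi_\ell(\sigma,\mathcal H;m,P)$. Define $$\mathring U_\ell(\mathcal H,\zeta;P,m,s)=\tilde K\Big(\mathring\phi_\ell(D,\mathcal H;m,P)+D\sqrt{s/m}+\bar\ell s/m\Big),\quad D=\mathrm D_\ell([\mathcal H](\zeta;\ell,P);P),$$ $$\mathring{\mathrm M}_\ell(\gamma_1,\gamma_2;\mathcal H,P,s)=\min\{m\in\mathbb N:\mathring U_\ell(\mathcal H,\gamma_2;P,m,s)\le\gamma_1\}\quad(\infty\text{ if no such }m).$$ **Empirical quantities and the constant $\tilde K$.** For $S=\{(x_k,y_k)\}_{k=1}^q$, $\Xi=\{\xi_k\}_{k=1}^q\in\{-1,+1\}^q$: $\hat U_\ell(\mathcal H;S,\Xi,s)=12\hat\phi+34\hat{\mathrm D}\sqrt{s/q}+752\bar\ell s/q$, with $\hat\phi=\sup_{h,g\in\mathcal H}\frac1q\sum_k\xi_k(\ell(h(x_k)y_k)-\ell(g(x_k)y_k))$ and $\hat{\mathrm D}^2=\sup_{h,g\in\mathcal H}\frac1q\sum_k(\ell(h(x_k)y_k)-\ell(g(x_k)y_k))^2$; for $q=0$, $\hat U_\ell=752\bar\ell s$. Universal constants $\bar K_1,\bar K_2,\bar K_3,\tilde K$ are fixed such that the following (a known result of Koltchinskii) holds, where $\bar U_\ell(\mathcal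 H;P,m,s)=\bar K_1\phi_\ell(\mathcal H;m,P)+\bar K_2\mathrm D_\ell(\mathcal H;P)\sqrt{s/m}+\bar K_3\bar\ell s/m$ and $\tilde U_\ell(\mathcal H;P,m,s)=\tilde K(\phi_\ell(\mathcal H;m,P)+\mathrm D_\ell(\mathcal H;P)\sqrt{s/m}+\bar\ell s/m)$: for any $\mathcal H\subseteq[\mathcal F]$, $s\ge1$, $P$, $m$, if $S\sim P^m$ and $\Xi$ uniform on $\{-1,+1\}^m$ are independent and $h^*\in\mathcal H$ minimizes $\mathrm R_\ell(\cdot;P)$ over $\mathcal H$, then with probability at least $1-6e^{-s}$: for all $h\in\mathcal H$, $\mathrm R_\ell(h;P)-\mathrm R_\ell(h^*;P)\le\mathrm R_\ell(h;S)-\mathrm R_\ell(h^*;S)+\bar U_\ell(\mathcal H;P,m,s)$ and $\mathrm R_\ell(h;S)-\inf_{g\in\mathcal H}\mathrm R_\ell(g;S)\le\mathrm R_\ell(h;P)-\mathrm R_\ell(h^*;P)+\bar U_\ell(\mathcal H;P,m,s)$, and $\bar U_\ell(\mathcal H;P,m,s)<\hat U_\ell(\mathcal H;S,\Xi,s)<\tilde U_\ell(\mathcal H;P,m,s)$. **Algorithm 1** (inputs $\ell$, unlabeled budget $u$, label budget $n$; parameter $\hat{\mathfrak s}$). It sees $X_1,X_2,\dots$ and may request individual labels $Y_m$. 0. $V\leftarrow\mathcal F$, $Q\leftarrow\{\}$, $m\leftarrow1$, $t\leftarrow0$. 1. While $m<u$ and $t<n$: 2. $m\leftarrow m+1$;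 3–4. if $X_m\in\mathrm{DIS}(V)$, request $Y_m$, let $Q\leftarrow Q\cup\{(m,Y_m)\}$, $t\leftarrow t+1$; 5–7. if $\log_2(m)\in\mathbb N$, let $V\leftarrow\{h\in V:\mathrm R_\ell(h;Q)-\inf_{g\in V}\mathrm R_\ell(g;Q)\le\hat T_\ell(V;Q,m)\}$ and then $Q\leftarrow\{\}$. 8. Return $\hat h=\operatorname{argmin}_{h\in V}\mathrm R_\ell(h;Q)$ (any minimizer, assumed to exist). Here, for $Q=\{(i_1,y_1),\dots,(i_q,y_q)\}$, let $S[Q]=\{(X_{i_k},y_k)\}_{k=1}^q$, $\mathrm R_\ell(g;Q)=\mathrm R_\ell(g;S[Q])$, and $\hat T_\ell(V;Q,m)=\hat U_\ell(V;S[Q],\{\xi'_{i_k}\}_{k=1}^q,\hat{\mathfrak s}(m))$, where $\xi'_1,\xi'_2,\dots$ are i.i.d. uniform on $\{-1,+1\}$, independent of the data. *)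

theory Defs
  imports "HOL-Probability.Probability" "HOL-Library.While_Combinator"
begin

section \<open>Functions, labels, distributions\<close>

text \<open>Labels are the reals -1 and 1. Functions on the instance space are represented by
  extensional functions, so that equality of functions is equality on the carrier.\<close>

definition labels :: "real measure" where
  "labels = count_space {-1, 1}"

definition rademacher :: "real measure" where
  "rademacher = uniform_count_measure {-1, 1}"

definition is_distribution :: "'a measure \<Rightarrow> ('a \<times> real) measure \<Rightarrow> bool" where
  "is_distribution MX P \<longleftrightarrow> prob_space P \<and> sets P = sets (MX \<Otimes>\<^sub>M labels)"

definition marginal :: "'a measure \<Rightarrow> ('a \<times> real) measure \<Rightarrow> 'a measure" where
  "marginal MX P = distr P MX fst"

definition Fstar :: "'a measure \<Rightarrow> ('a \<Rightarrow> ereal) set" where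
  "Fstar MX = borel_measurable MX \<inter> extensional (space MX)"

text \<open>The parameter \<open>c\<close> is the fixed value of the sign at 0.\<close>

definition sign :: "real \<Rightarrow> ereal \<Rightarrow> real" where
  "sign c v = (if v > 0 then 1 else if v < 0 then -1 else c)"

definition er :: "real \<Rightarrow> ('a \<times> real) measure \<Rightarrow> ('a \<Rightarrow> ereal) \<Rightarrow> real" where
  "er c P h = measure P {z \<in> space P. sign c (h (fst z)) \<noteq> snd z}"

text \<open>\<open>e\<close> is a version of the conditional probability of label 1 given the instance.\<close>

definition is_regression :: "'a measure \<Rightarrow> ('a \<times> real) measure \<Rightarrow> ('a \<Rightarrow> real) \<Rightarrow> bool" where
  "is_regression MX P e \<longleftrightarrow>
     e \<in> borel_measurable MX \<and> (\<forall>x\<in>space MX. 0 \<le> e x \<and> e x \<le> 1) \<and>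
     (\<forall>A\<in>sets MX. measure P (A \<times> {1}) = (LINT x:A|marginal MX P. e x))"


section \<open>Surrogate loss\<close>

definition loss :: "(ereal \<Rightarrow> ennreal) \<Rightarrow> ('a \<Rightarrow> ereal) \<Rightarrow> 'a \<times> real \<Rightarrow> ereal" where
  "loss l h z = enn2ereal (l (ereal (snd z) * h (fst z)))"

definition loss_sup :: "'a measure \<Rightarrow> ('a \<Rightarrow> ereal) set \<Rightarrow> (ereal \<Rightarrow> ennreal) \<Rightarrow> ereal" where
  "loss_sup MX F l = (SUP x\<in>space MX. SUP y\<in>{-1, 1}. SUP h\<in>F. loss l h (x, y))"

text \<open>Meaningful when \<open>loss_sup MX F l < \<infinity>\<close>, which is a standing assumption.\<close>

definition lbar :: "'a measure \<Rightarrow> ('a \<Rightarrow> ereal) set \<Rightarrow> (ereal \<Rightarrow> ennreal) \<Rightarrow> real" where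
  "lbar MX F l = real_of_ereal (max 1 (loss_sup MX F l))"

definition risk :: "(ereal \<Rightarrow> ennreal) \<Rightarrow> ('a \<times> real) measure \<Rightarrow> ('a \<Rightarrow> ereal) \<Rightarrow> ereal" where
  "risk l P h = enn2ereal (\<integral>\<^sup>+ z. l (ereal (snd z) * h (fst z)) \<partial>P)"

text \<open>A finite sample is a family \<open>S\<close> indexed by a finite set \<open>I\<close>.\<close>

definition emp_risk ::
  "(ereal \<Rightarrow> ennreal) \<Rightarrow> 'i set \<Rightarrow> ('i \<Rightarrow> 'a \<times> real) \<Rightarrow> ('a \<Rightarrow> ereal) \<Rightarrow> ereal" where
  "emp_risk l I S h = (if I = {} then 0 else (\<Sum>i\<in>I. loss l h (S i)) / ereal (real (card I)))"

definition cond_risk :: "(ereal \<Rightarrow> ennreal) \<Rightarrow> real \<Rightarrow> ereal \<Rightarrow> ennreal" where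
  "cond_risk l e z = ennreal e * l z + ennreal (1 - e) * l (- z)"

definition lstar :: "(ereal \<Rightarrow> ennreal) \<Rightarrow> real \<Rightarrow> ennreal" where
  "lstar l e = (INF z. cond_risk l e z)"

definition lstar_minus :: "(ereal \<Rightarrow> ennreal) \<Rightarrow> real \<Rightarrow> ennreal" where
  "lstar_minus l e = (INF z\<in>{z. z * ereal (2 * e - 1) \<le> 0}. cond_risk l e z)"

definition classification_calibrated :: "(ereal \<Rightarrow> ennreal) \<Rightarrow> bool" where
  "classification_calibrated l \<longleftrightarrow> (\<forall>e\<in>{0..1} - {1/2}. lstar_minus l e > lstar l e)"

definition fopt :: "'a measure \<Rightarrow> (real \<Rightarrow> ereal) \<Rightarrow> ('a \<Rightarrow> real) \<Rightarrow> ('a \<Rightarrow> ereal)" where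
  "fopt MX zs e = restrict (\<lambda>x. zs (e x)) (space MX)"


section \<open>Sets of functions\<close>

definition fhull :: "'a measure \<Rightarrow> ('a \<Rightarrow> ereal) set \<Rightarrow> ('a \<Rightarrow> ereal) set" where
  "fhull MX H =
     {f \<in> Fstar MX. \<forall>x\<in>space MX. (INF h\<in>H. h x) \<le> f x \<and> f x \<le> (SUP h\<in>H. h x)}"

definition DIS :: "'a measure \<Rightarrow> real \<Rightarrow> ('a \<Rightarrow> ereal) set \<Rightarrow> 'a set" where
  "DIS MX c H = {x \<in> space MX. \<exists>h\<in>H. \<exists>g\<in>H. sign c (h x) \<noteq> sign c (g x)}"

definition surr_set ::
  "(ereal \<Rightarrow> ennreal) \<Rightarrow> ('a \<times> real) measure \<Rightarrow> ('a \<Rightarrow> ereal) set \<Rightarrow> real \<Rightarrow> ('a \<Rightarrow> ereal) set" where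
  "surr_set l P H \<gamma> = {h \<in> H. risk l P h - (INF g\<in>H. risk l P g) \<le> ereal \<gamma>}"

definition err_set ::
  "real \<Rightarrow> ('a \<times> real) measure \<Rightarrow> ('a \<Rightarrow> ereal) set \<Rightarrow> real \<Rightarrow> ('a \<Rightarrow> ereal) set" where
  "err_set c P H \<epsilon> = {h \<in> H. er c P h - (INF g\<in>H. er c P g) \<le> \<epsilon>}"

definition patch :: "'a set \<Rightarrow> ('a \<Rightarrow> ereal) \<Rightarrow> ('a \<Rightarrow> ereal) \<Rightarrow> ('a \<Rightarrow> ereal)" where
  "patch U g h = (\<lambda>x. if x \<in> U then h x else g x)"

definition patch_set ::
  "('a \<Rightarrow> ereal) set \<Rightarrow> 'a set \<Rightarrow> ('a \<Rightarrow> ereal) \<Rightarrow> ('a \<Rightarrow> ereal) set" where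
  "patch_set H U g = patch U g ` H"

definition esqrt :: "ereal \<Rightarrow> ereal" where
  "esqrt x = (if x = \<infinity> then \<infinity> else ereal (sqrt (real_of_ereal x)))"

text \<open>Where two losses are both infinite, their difference is \<open>\<infinity>\<close> in \<open>ereal\<close>; this cannot
  happen for functions in the given class, whose losses are bounded.\<close>

definition Dfun ::
  "(ereal \<Rightarrow> ennreal) \<Rightarrow> ('a \<times> real) measure \<Rightarrow> ('a \<Rightarrow> ereal) \<Rightarrow> ('a \<Rightarrow> ereal) \<Rightarrow> ereal" where
  "Dfun l P h g = esqrt (enn2ereal (\<integral>\<^sup>+ z. e2ennreal ((loss l h z - loss l g z)\<^sup>2) \<partial>P))"

definition Dset ::
  "(ereal \<Rightarrow> ennreal) \<Rightarrow> ('a \<times> real) measure \<Rightarrow> ('a \<Rightarrow> ereal) set \<Rightarrow> ereal" where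
  "Dset l P H = (SUP h\<in>H. SUP g\<in>H. Dfun l P h g)"


section \<open>Risk transforms\<close>

definition Gamma_l ::
  "'a measure \<Rightarrow> real \<Rightarrow> (ereal \<Rightarrow> ennreal) \<Rightarrow> ('a \<times> real) measure \<Rightarrow> real \<Rightarrow> ereal" where
  "Gamma_l MX c l P \<epsilon> =
     Sup ({ereal \<gamma> | \<gamma>. \<gamma> > 0 \<and> surr_set l P (Fstar MX) \<gamma> \<subseteq> err_set c P (Fstar MX) \<epsilon>} \<union> {0})"

text \<open>\<open>Gamma_l\<close> is a function on the unit interval, hence the bound \<open>\<epsilon> \<le> 1\<close>.\<close>

definition Eps_l ::
  "'a measure \<Rightarrow> real \<Rightarrow> (ereal \<Rightarrow> ennreal) \<Rightarrow> ('a \<times> real) measure \<Rightarrow> real \<Rightarrow> real" where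
  "Eps_l MX c l P \<gamma> = Inf {\<epsilon>. 0 < \<epsilon> \<and> \<epsilon> \<le> 1 \<and> ereal \<gamma> \<le> Gamma_l MX c l P \<epsilon>}"

definition j_ell :: "real \<Rightarrow> int" where
  "j_ell lb = - \<lceil>log 2 lb\<rceil>"

text \<open>The value \<open>-\<infinity>\<close>, which occurs for \<open>G = \<infinity>\<close>, is represented by \<open>j_ell lb - 1\<close>: the index is
  used only through \<open>u_at\<close> and as the upper limit of a sum from \<open>j_ell lb\<close>, and all indices below
  \<open>j_ell lb\<close> are equivalent there.\<close>

definition j_eps :: "real \<Rightarrow> ereal \<Rightarrow> int" where
  "j_eps lb G = (if G = \<infinity> then j_ell lb - 1 else \<lceil>log 2 (1 / real_of_ereal G)\<rceil>)"

definition u_at :: "real \<Rightarrow> (int \<Rightarrow> nat) \<Rightarrow> int \<Rightarrow> nat" where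
  "u_at lb u j = (if j < j_ell lb then 1 else u j)"


section \<open>Complexities\<close>

definition sup_dev ::
  "(ereal \<Rightarrow> ennreal) \<Rightarrow> ('a \<times> real) measure \<Rightarrow> ('a \<Rightarrow> ereal) set \<Rightarrow> nat \<Rightarrow> (nat \<Rightarrow> 'a \<times> real) \<Rightarrow> ereal" where
  "sup_dev l P H m S = (SUP h\<in>H. SUP g\<in>H.
     (risk l P h - risk l P g) - (emp_risk l {1..m} S h - emp_risk l {1..m} S g))"

text \<open>Taking \<open>h = g\<close> shows that \<open>sup_dev\<close> is nonnegative for nonempty classes, so the
  truncation by \<open>e2ennreal\<close> has no effect.\<close>

definition phi ::
  "(ereal \<Rightarrow> ennreal) \<Rightarrow> ('a \<Rightarrow> ereal) set \<Rightarrow> nat \<Rightarrow> ('a \<times> real) measure \<Rightarrow> ereal" where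
  "phi l H m P = enn2ereal (\<integral>\<^sup>+ S. e2ennreal (sup_dev l P H m S) \<partial>(\<Pi>\<^sub>M i\<in>{1..m}. P))"

definition admissible ::
  "'a measure \<Rightarrow> ('a \<Rightarrow> ereal) set \<Rightarrow> (ereal \<Rightarrow> ennreal) \<Rightarrow> (real \<Rightarrow> ereal)
   \<Rightarrow> (('a \<times> real) measure \<Rightarrow> 'a \<Rightarrow> real)
   \<Rightarrow> (ereal \<Rightarrow> ('a \<Rightarrow> ereal) set \<Rightarrow> nat \<Rightarrow> ('a \<times> real) measure \<Rightarrow> ereal) \<Rightarrow> bool" where
  "admissible MX F l zs \<eta> \<phi>0 \<longleftrightarrow>
     (\<forall>P H m. is_distribution MX P \<and> H \<subseteq> fhull MX F \<and> 1 \<le> m \<and> fopt MX zs (\<eta> P) \<in> H \<longrightarrow>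
        (\<forall>\<sigma> \<sigma>' H' U m'. 0 \<le> \<sigma> \<and> \<sigma> \<le> \<sigma>' \<and> H \<subseteq> H' \<and> H' \<subseteq> fhull MX F \<and> U \<in> sets MX \<and>
            1 \<le> m' \<and> m' \<le> m \<longrightarrow>
            \<phi>0 \<sigma> (patch_set H U (fopt MX zs (\<eta> P))) m P \<le> \<phi>0 \<sigma>' H' m' P) \<and>
        (\<forall>\<sigma>. 0 \<le> \<sigma> \<and> Dset l P H \<le> \<sigma> \<longrightarrow> phi l H m P \<le> \<phi>0 \<sigma> H m P))"

definition Uring ::
  "'a measure \<Rightarrow> (ereal \<Rightarrow> ennreal) \<Rightarrow> real \<Rightarrow> real
   \<Rightarrow> (ereal \<Rightarrow> ('a \<Rightarrow> ereal) set \<Rightarrow> nat \<Rightarrow> ('a \<times> real) measure \<Rightarrow> ereal)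
   \<Rightarrow> ('a \<Rightarrow> ereal) set \<Rightarrow> real \<Rightarrow> ('a \<times> real) measure \<Rightarrow> nat \<Rightarrow> real \<Rightarrow> ereal" where
  "Uring MX l lb K \<phi>0 H \<zeta> P m s =
     (let D = Dset l P (surr_set l P (fhull MX H) \<zeta>)
      in ereal K * (\<phi>0 D H m P + D * ereal (sqrt (s / real m)) + ereal (lb * s / real m)))"

definition Mring ::
  "'a measure \<Rightarrow> (ereal \<Rightarrow> ennreal) \<Rightarrow> real \<Rightarrow> real
   \<Rightarrow> (ereal \<Rightarrow> ('a \<Rightarrow> ereal) set \<Rightarrow> nat \<Rightarrow> ('a \<times> real) measure \<Rightarrow> ereal)
   \<Rightarrow> real \<Rightarrow> real \<Rightarrow> ('a \<Rightarrow> ereal) set \<Rightarrow> ('a \<times> real) measure \<Rightarrow> real \<Rightarrow> enat" where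
  "Mring MX l lb K \<phi>0 \<gamma>1 \<gamma>2 H P s =
     Inf {enat m | m. 1 \<le> m \<and> Uring MX l lb K \<phi>0 H \<gamma>2 P m s \<le> ereal \<gamma>1}"

definition Ubar ::
  "(ereal \<Rightarrow> ennreal) \<Rightarrow> real \<Rightarrow> real \<Rightarrow> real \<Rightarrow> real
   \<Rightarrow> ('a \<Rightarrow> ereal) set \<Rightarrow> ('a \<times> real) measure \<Rightarrow> nat \<Rightarrow> real \<Rightarrow> ereal" where
  "Ubar l lb K1 K2 K3 H P m s =
     ereal K1 * phi l H m P + ereal K2 * Dset l P H * ereal (sqrt (s / real m))
       + ereal (K3 * lb * s / real m)"

definition Utilde ::
  "(ereal \<Rightarrow> ennreal) \<Rightarrow> real \<Rightarrow> real
   \<Rightarrow> ('a \<Rightarrow> ereal) set \<Rightarrow> ('a \<times> real) measure \<Rightarrow> nat \<Rightarrow> real \<Rightarrow> ereal" where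
  "Utilde l lb K H P m s =
     ereal K * (phi l H m P + Dset l P H * ereal (sqrt (s / real m)) + ereal (lb * s / real m))"

definition emp_phi ::
  "(ereal \<Rightarrow> ennreal) \<Rightarrow> ('a \<Rightarrow> ereal) set \<Rightarrow> 'i set \<Rightarrow> ('i \<Rightarrow> 'a \<times> real) \<Rightarrow> ('i \<Rightarrow> real) \<Rightarrow> ereal" where
  "emp_phi l H I S \<xi> = (SUP h\<in>H. SUP g\<in>H.
     (\<Sum>k\<in>I. ereal (\<xi> k) * (loss l h (S k) - loss l g (S k))) / ereal (real (card I)))"

definition emp_D ::
  "(ereal \<Rightarrow> ennreal) \<Rightarrow> ('a \<Rightarrow> ereal) set \<Rightarrow> 'i set \<Rightarrow> ('i \<Rightarrow> 'a \<times> real) \<Rightarrow> ereal" where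
  "emp_D l H I S = esqrt (SUP h\<in>H. SUP g\<in>H.
     (\<Sum>k\<in>I. (loss l h (S k) - loss l g (S k))\<^sup>2) / ereal (real (card I)))"

definition Uhat ::
  "(ereal \<Rightarrow> ennreal) \<Rightarrow> real
   \<Rightarrow> ('a \<Rightarrow> ereal) set \<Rightarrow> 'i set \<Rightarrow> ('i \<Rightarrow> 'a \<times> real) \<Rightarrow> ('i \<Rightarrow> real) \<Rightarrow> real \<Rightarrow> ereal" where
  "Uhat l lb H I S \<xi> s =
     (if I = {} then ereal (752 * lb * s)
      else 12 * emp_phi l H I S \<xi> + 34 * emp_D l H I S * ereal (sqrt (s / real (card I)))
             + ereal (752 * lb * s / real (card I)))"


section \<open>The concentration property that fixes the constants\<close>

definition conc_event ::
  "(ereal \<Rightarrow> ennreal) \<Rightarrow> real \<Rightarrow> real \<Rightarrow> real \<Rightarrow> real \<Rightarrow> real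
   \<Rightarrow> ('a \<Rightarrow> ereal) set \<Rightarrow> ('a \<Rightarrow> ereal) \<Rightarrow> ('a \<times> real) measure \<Rightarrow> real
   \<Rightarrow> 'i set \<Rightarrow> ('i \<Rightarrow> 'a \<times> real) \<Rightarrow> ('i \<Rightarrow> real) \<Rightarrow> bool" where
  "conc_event l lb K1 K2 K3 K H hs P s I S \<xi> \<longleftrightarrow>
     (\<forall>h\<in>H. risk l P h - risk l P hs
        \<le> emp_risk l I S h - emp_risk l I S hs + Ubar l lb K1 K2 K3 H P (card I) s) \<and>
     (\<forall>h\<in>H. emp_risk l I S h - (INF g\<in>H. emp_risk l I S g)
        \<le> risk l P h - risk l P hs + Ubar l lb K1 K2 K3 H P (card I) s) \<and>
     Ubar l lb K1 K2 K3 H P (card I) s < Uhat l lb H I S \<xi> s \<and>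
     Uhat l lb H I S \<xi> s < Utilde l lb K H P (card I) s"

definition conc_space :: "('a \<times> real) measure \<Rightarrow> nat
   \<Rightarrow> ((nat \<Rightarrow> 'a \<times> real) \<times> (nat \<Rightarrow> real)) measure" where
  "conc_space P m = (\<Pi>\<^sub>M i\<in>{1..m}. P) \<Otimes>\<^sub>M (\<Pi>\<^sub>M i\<in>{1..m}. rademacher)"

definition conc_set ::
  "(ereal \<Rightarrow> ennreal) \<Rightarrow> real \<Rightarrow> real \<Rightarrow> real \<Rightarrow> real \<Rightarrow> real
   \<Rightarrow> ('a \<Rightarrow> ereal) set \<Rightarrow> ('a \<Rightarrow> ereal) \<Rightarrow> ('a \<times> real) measure \<Rightarrow> real \<Rightarrow> nat
   \<Rightarrow> ((nat \<Rightarrow> 'a \<times> real) \<times> (nat \<Rightarrow> real)) set" where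
  "conc_set l lb K1 K2 K3 K H hs P s m =
     {w \<in> space (conc_space P m). conc_event l lb K1 K2 K3 K H hs P s {1..m} (fst w) (snd w)}"

text \<open>Measurability of the suprema and of the event in the concentration inequality; it is not
  automatic for uncountable classes.\<close>

definition conc_measurable ::
  "(ereal \<Rightarrow> ennreal) \<Rightarrow> real \<Rightarrow> real \<Rightarrow> real \<Rightarrow> real \<Rightarrow> real
   \<Rightarrow> ('a \<Rightarrow> ereal) set \<Rightarrow> ('a \<Rightarrow> ereal) \<Rightarrow> ('a \<times> real) measure \<Rightarrow> real \<Rightarrow> nat \<Rightarrow> bool" where
  "conc_measurable l lb K1 K2 K3 K H hs P s m \<longleftrightarrow>
     sup_dev l P H m \<in> borel_measurable (\<Pi>\<^sub>M i\<in>{1..m}. P) \<and>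
     (\<lambda>w. emp_phi l H {1..m} (fst w) (snd w)) \<in> borel_measurable (conc_space P m) \<and>
     (\<lambda>w. emp_D l H {1..m} (fst w)) \<in> borel_measurable (conc_space P m) \<and>
     conc_set l lb K1 K2 K3 K H hs P s m \<in> sets (conc_space P m)"

text \<open>The inequality is required only for classes with measurable suprema and losses bounded
  by \<open>lb\<close>. The second restriction matters because functions in \<open>fhull MX F\<close> may have larger
  losses than those in \<open>F\<close> when the loss is not quasi-convex, and the inequality fails in
  general for classes that contain such functions.\<close>

definition concentration ::
  "'a measure \<Rightarrow> ('a \<Rightarrow> ereal) set \<Rightarrow> (ereal \<Rightarrow> ennreal) \<Rightarrow> real
   \<Rightarrow> real \<Rightarrow> real \<Rightarrow> real \<Rightarrow> real \<Rightarrow> bool" where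
  "concentration MX F l lb K1 K2 K3 K \<longleftrightarrow>
     (\<forall>H hs P m s. H \<subseteq> fhull MX F \<and>
        (\<forall>h\<in>H. \<forall>x\<in>space MX. \<forall>y\<in>{-1, 1}. loss l h (x, y) \<le> ereal lb) \<and>
        is_distribution MX P \<and> 1 \<le> m \<and> 1 \<le> s \<and>
        hs \<in> H \<and> (\<forall>h\<in>H. risk l P hs \<le> risk l P h) \<and>
        conc_measurable l lb K1 K2 K3 K H hs P s m \<longrightarrow>
        measure (conc_space P m) (conc_set l lb K1 K2 K3 K H hs P s m) \<ge> 1 - 6 * exp (- s))"


section \<open>The active learning algorithm\<close>

text \<open>A state consists of the version space, the set of labeled indices, the number of the
  current data point and the number of label requests. The data and the random signs are given
  as sequences \<open>d\<close> and \<open>\<xi>\<close>, of which only the entries with positive index are used.\<close>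

type_synonym 'a state = "('a \<Rightarrow> ereal) set \<times> (nat \<times> real) set \<times> nat \<times> nat"

definition sample_of :: "(nat \<Rightarrow> 'a \<times> real) \<Rightarrow> nat \<times> real \<Rightarrow> 'a \<times> real" where
  "sample_of d p = (fst (d (fst p)), snd p)"

definition That ::
  "(ereal \<Rightarrow> ennreal) \<Rightarrow> real \<Rightarrow> (nat \<Rightarrow> real) \<Rightarrow> (nat \<Rightarrow> 'a \<times> real) \<Rightarrow> (nat \<Rightarrow> real)
   \<Rightarrow> ('a \<Rightarrow> ereal) set \<Rightarrow> (nat \<times> real) set \<Rightarrow> nat \<Rightarrow> ereal" where
  "That l lb sh d \<xi> V Q m = Uhat l lb V Q (sample_of d) (\<lambda>p. \<xi> (fst p)) (sh m)"

definition log2_pos_int :: "nat \<Rightarrow> bool" where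
  "log2_pos_int m \<longleftrightarrow> (\<exists>k\<ge>1. m = 2 ^ k)"

definition alg_step ::
  "'a measure \<Rightarrow> real \<Rightarrow> (ereal \<Rightarrow> ennreal) \<Rightarrow> real \<Rightarrow> (nat \<Rightarrow> real)
   \<Rightarrow> (nat \<Rightarrow> 'a \<times> real) \<Rightarrow> (nat \<Rightarrow> real) \<Rightarrow> 'a state \<Rightarrow> 'a state" where
  "alg_step MX c l lb sh d \<xi> = (\<lambda>(V, Q, m, t).
     let m' = m + 1;
         (Q', t') = (if fst (d m') \<in> DIS MX c V then (insert (m', snd (d m')) Q, t + 1) else (Q, t))
     in if log2_pos_int m'
        then ({h \<in> V. emp_risk l Q' (sample_of d) h - (INF g\<in>V. emp_risk l Q' (sample_of d) g)
                       \<le> That l lb sh d \<xi> V Q' m'}, {}, m', t')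
        else (V, Q', m', t'))"

definition alg_run ::
  "'a measure \<Rightarrow> real \<Rightarrow> ('a \<Rightarrow> ereal) set \<Rightarrow> (ereal \<Rightarrow> ennreal) \<Rightarrow> (nat \<Rightarrow> real)
   \<Rightarrow> nat \<Rightarrow> nat \<Rightarrow> (nat \<Rightarrow> 'a \<times> real) \<Rightarrow> (nat \<Rightarrow> real) \<Rightarrow> 'a state" where
  "alg_run MX c F l sh u n d \<xi> =
     while (\<lambda>(V, Q, m, t). m < u \<and> t < n) (alg_step MX c l (lbar MX F l) sh d \<xi>) (F, {}, 1, 0)"

definition alg_V ::
  "'a measure \<Rightarrow> real \<Rightarrow> ('a \<Rightarrow> ereal) set \<Rightarrow> (ereal \<Rightarrow> ennreal) \<Rightarrow> (nat \<Rightarrow> real)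
   \<Rightarrow> nat \<Rightarrow> nat \<Rightarrow> (nat \<Rightarrow> 'a \<times> real) \<Rightarrow> (nat \<Rightarrow> real) \<Rightarrow> ('a \<Rightarrow> ereal) set" where
  "alg_V MX c F l sh u n d \<xi> = fst (alg_run MX c F l sh u n d \<xi>)"

definition alg_Q ::
  "'a measure \<Rightarrow> real \<Rightarrow> ('a \<Rightarrow> ereal) set \<Rightarrow> (ereal \<Rightarrow> ennreal) \<Rightarrow> (nat \<Rightarrow> real)
   \<Rightarrow> nat \<Rightarrow> nat \<Rightarrow> (nat \<Rightarrow> 'a \<times> real) \<Rightarrow> (nat \<Rightarrow> real) \<Rightarrow> (nat \<times> real) set" where
  "alg_Q MX c F l sh u n d \<xi> = fst (snd (alg_run MX c F l sh u n d \<xi>))"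

definition alg_unlabeled ::
  "'a measure \<Rightarrow> real \<Rightarrow> ('a \<Rightarrow> ereal) set \<Rightarrow> (ereal \<Rightarrow> ennreal) \<Rightarrow> (nat \<Rightarrow> real)
   \<Rightarrow> nat \<Rightarrow> nat \<Rightarrow> (nat \<Rightarrow> 'a \<times> real) \<Rightarrow> (nat \<Rightarrow> real) \<Rightarrow> nat" where
  "alg_unlabeled MX c F l sh u n d \<xi> = fst (snd (snd (alg_run MX c F l sh u n d \<xi>)))"

definition alg_requests ::
  "'a measure \<Rightarrow> real \<Rightarrow> ('a \<Rightarrow> ereal) set \<Rightarrow> (ereal \<Rightarrow> ennreal) \<Rightarrow> (nat \<Rightarrow> real)
   \<Rightarrow> nat \<Rightarrow> nat \<Rightarrow> (nat \<Rightarrow> 'a \<times> real) \<Rightarrow> (nat \<Rightarrow> real) \<Rightarrow> nat" where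
  "alg_requests MX c F l sh u n d \<xi> = snd (snd (snd (alg_run MX c F l sh u n d \<xi>)))"

definition alg_output ::
  "'a measure \<Rightarrow> real \<Rightarrow> ('a \<Rightarrow> ereal) set \<Rightarrow> (ereal \<Rightarrow> ennreal) \<Rightarrow> (nat \<Rightarrow> real)
   \<Rightarrow> nat \<Rightarrow> nat \<Rightarrow> (nat \<Rightarrow> 'a \<times> real) \<Rightarrow> (nat \<Rightarrow> real) \<Rightarrow> ('a \<Rightarrow> ereal) \<Rightarrow> bool" where
  "alg_output MX c F l sh u n d \<xi> h \<longleftrightarrow>
     (let V = alg_V MX c F l sh u n d \<xi>; R = emp_risk l (alg_Q MX c F l sh u n d \<xi>) (sample_of d)
      in h \<in> V \<and> (\<forall>g\<in>V. R h \<le> R g))"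

definition seq_space :: "'a measure \<Rightarrow> ((nat \<Rightarrow> 'a \<times> real) \<times> (nat \<Rightarrow> real)) measure" where
  "seq_space MX = (\<Pi>\<^sub>M i\<in>{1..}. MX \<Otimes>\<^sub>M labels) \<Otimes>\<^sub>M (\<Pi>\<^sub>M i\<in>{1..}. labels)"

text \<open>Measurability of the sets and functions attached to the version spaces of the algorithm.
  The version space used on the block of data points \<open>2^(i-1) < m \<le> 2^i\<close> is the final
  one of the run with unlabeled budget \<open>2^(i-1)\<close>. The last clause is joint measurability, in the
  whole data sequence, of the event that the concentration inequality holds on this block.\<close>

definition alg_measurable ::
  "'a measure \<Rightarrow> real \<Rightarrow> ('a \<Rightarrow> ereal) set \<Rightarrow> (ereal \<Rightarrow> ennreal) \<Rightarrow> (nat \<Rightarrow> real)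
   \<Rightarrow> real \<Rightarrow> real \<Rightarrow> real \<Rightarrow> real \<Rightarrow> ('a \<Rightarrow> ereal) \<Rightarrow> ('a \<times> real) measure \<Rightarrow> nat \<Rightarrow> nat \<Rightarrow> bool" where
  "alg_measurable MX c F l sh K1 K2 K3 K f P u n \<longleftrightarrow>
     (\<forall>i. 1 \<le> i \<and> 2 ^ i \<le> u \<longrightarrow>
       (let lb = lbar MX F l;
            V = (\<lambda>w. alg_V MX c F l sh (2 ^ (i - 1)) n (fst w) (snd w));
            H = (\<lambda>w. patch_set (V w) (DIS MX c (V w)) f)
        in (\<forall>w\<in>space (seq_space MX). DIS MX c (V w) \<in> sets MX) \<and>
           (\<forall>w\<in>space (seq_space MX). f \<in> V w \<longrightarrow>
              conc_measurable l lb K1 K2 K3 K (H w) f P (sh (2 ^ i)) (2 ^ (i - 1))) \<and>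
           {w \<in> space (seq_space MX). f \<in> V w \<longrightarrow>
              conc_event l lb K1 K2 K3 K (H w) f P (sh (2 ^ i)) {2 ^ (i - 1) + 1..2 ^ i} (fst w) (snd w)}
             \<in> sets (seq_space MX)))"


section \<open>The classes that determine the label complexity\<close>

definition Gset ::
  "'a measure \<Rightarrow> real \<Rightarrow> ('a \<Rightarrow> ereal) set \<Rightarrow> (ereal \<Rightarrow> ennreal) \<Rightarrow> ('a \<times> real) measure
   \<Rightarrow> int \<Rightarrow> ('a \<Rightarrow> ereal) set" where
  "Gset MX c F l P j = err_set c P F (Eps_l MX c l P (2 powi (2 - j)))"

definition Fj ::
  "'a measure \<Rightarrow> real \<Rightarrow> ('a \<Rightarrow> ereal) set \<Rightarrow> (ereal \<Rightarrow> ennreal) \<Rightarrow> ('a \<times> real) measure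
   \<Rightarrow> ('a \<Rightarrow> ereal) \<Rightarrow> int \<Rightarrow> ('a \<Rightarrow> ereal) set" where
  "Fj MX c F l P f j = patch_set (Gset MX c F l P j) (DIS MX c (Gset MX c F l P j)) f"

definition Uj ::
  "'a measure \<Rightarrow> real \<Rightarrow> ('a \<Rightarrow> ereal) set \<Rightarrow> (ereal \<Rightarrow> ennreal) \<Rightarrow> ('a \<times> real) measure
   \<Rightarrow> ('a \<Rightarrow> ereal) \<Rightarrow> int \<Rightarrow> 'a set" where
  "Uj MX c F l P f j = DIS MX c (Fj MX c F l P f j)"

end

theory Submission
  imports Defs
begin

text \<open>On the block of data \<open>2^(i-1) < m \<le> 2^i\<close> the filter applied to the version space \<open>V\<close> and the
  requested labels is the same as the filter applied to the whole block and the class obtained from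
  \<open>V\<close> by replacing every function by the optimal \<open>f\<close> outside \<open>DIS V\<close>: both sides are rescaled by the
  same factor. Conditionally on the earlier data the concentration inequality applies to this
  class, so with high probability \<open>f\<close> survives every filter and the patched survivors have small
  excess risk. By induction on the level \<open>j\<close>, after \<open>uu j\<close> data points the excess risk is below
  \<open>2^(-j)\<close>: two levels earlier it was below \<open>2^(2-j)\<close>, hence \<open>V\<close> consists of functions in \<open>Gset\<close>
  at level \<open>j\<close>, the complexity of the patched class is bounded by that of \<open>Fj\<close>, and \<open>uu j\<close>
  is large enough by choice. Patching does not change error rates, so the surrogate bound transfers to
  them through \<open>Gamma_l\<close>, which is positive by calibration. While the concentration
  events hold, requests at level \<open>j\<close> fall into \<open>Uj\<close>, and Chernoff's bound keeps their
  number below \<open>n\<close>.\<close>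

section \<open>Disintegration of the distribution\<close>

text \<open>The factor 2 before \<open>Mring\<close> arises since the filter at \<open>uu j\<close>
  data points sees only the last block, of length \<open>uu j / 2\<close>. Survivors have excess
  below twice \<open>Utilde\<close>, hence the target \<open>2 powi (- j - 1)\<close>. The class
  entering this block has already seen \<open>uu (j - 2)\<close> points, as
  \<open>2 * uu (j - 2) \<le> uu j\<close>; so its radius is \<open>2 powi (2 - j)\<close>, the one
  in \<open>Gset\<close> and \<open>Mring\<close>.

  No label is seen outside the disagreement region, so a filter controls surrogate risks only after
  patching, not those of the survivors themselves. Closeness is therefore stated for patched
  functions, and only error rates are carried back.

  The class in the concentration event of a block is the final version space of a run that may have
  stopped for lack of labels. Survival of \<open>f\<close>, closeness and a request count below the
  budget thus depend on each other and are proved in one induction along fixed data; probability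
  enters only through the failure events of the blocks and the number of hits in the regions
  \<open>Uj\<close>, which do not depend on the data.\<close>

lemma space_labels [simp]: "space labels = {-1, 1}"
  by (simp add: labels_def)

lemma space_distribution:
  assumes "is_distribution MX P"
  shows "space P = space MX \<times> {-1, 1}"
  using assms sets_eq_imp_space_eq[of P "MX \<Otimes>\<^sub>M labels"]
  by (auto simp: is_distribution_def space_pair_measure)

lemma measurable_fst_distribution:
  assumes "is_distribution MX P"
  shows "fst \<in> P \<rightarrow>\<^sub>M MX"
proof -
  have "fst \<in> (MX \<Otimes>\<^sub>M labels) \<rightarrow>\<^sub>M MX" by simp
  then show ?thesis
    using assms measurable_cong_sets[of P "MX \<Otimes>\<^sub>M labels" MX MX] by (auto simp: is_distribution_def)
qed

lemma measurable_snd_distribution: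
  assumes "is_distribution MX P"
  shows "snd \<in> borel_measurable P"
proof -
  have "snd \<in> (MX \<Otimes>\<^sub>M labels) \<rightarrow>\<^sub>M labels" by simp
  moreover have "(\<lambda>x. x) \<in> labels \<rightarrow>\<^sub>M borel" by (simp add: labels_def)
  ultimately have "snd \<in> borel_measurable (MX \<Otimes>\<^sub>M labels)"
    using measurable_compose by blast
  then show ?thesis
    using assms measurable_cong_sets[of P "MX \<Otimes>\<^sub>M labels" borel borel] by (auto simp: is_distribution_def)
qed

lemma measurable_Pair_distribution:
  assumes "is_distribution MX P" "y \<in> {-1, 1}"
  shows "(\<lambda>x. (x, y)) \<in> MX \<rightarrow>\<^sub>M P"
proof -
  have "(\<lambda>x. (x, y)) \<in> MX \<rightarrow>\<^sub>M (MX \<Otimes>\<^sub>M labels)"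
    using assms(2) by (intro measurable_Pair) auto
  then show ?thesis
    using assms measurable_cong_sets[of MX MX P "MX \<Otimes>\<^sub>M labels"] by (auto simp: is_distribution_def)
qed

lemma sets_Times_distribution:
  assumes "is_distribution MX P" "A \<in> sets MX" "B \<subseteq> {-1, 1}"
  shows "A \<times> B \<in> sets P"
proof -
  have "B \<in> sets labels" using assms(3) by (auto simp: labels_def)
  then have "A \<times> B \<in> sets (MX \<Otimes>\<^sub>M labels)" using assms(2) by (rule pair_measureI[rotated])
  then show ?thesis using assms(1) by (simp add: is_distribution_def)
qed

lemma space_marginal [simp]: "space (marginal MX P) = space MX"
  and sets_marginal [simp, measurable_cong]: "sets (marginal MX P) = sets MX"
  by (auto simp: marginal_def)

lemma prob_space_marginal:
  assumes "is_distribution MX P"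
  shows "prob_space (marginal MX P)"
  unfolding marginal_def
  using assms measurable_fst_distribution[OF assms]
  by (auto simp: is_distribution_def intro!: prob_space.prob_space_distr)

lemma measure_marginal:
  assumes "is_distribution MX P" "A \<in> sets MX"
  shows "measure (marginal MX P) A = measure P (A \<times> {-1, 1})"
proof -
  have "fst -` A \<inter> space P = A \<times> {-1, 1}"
    using sets.sets_into_space[OF assms(2)] by (auto simp: space_distribution[OF assms(1)])
  then show ?thesis
    unfolding marginal_def
    using measure_distr[OF measurable_fst_distribution[OF assms(1)] assms(2)] by simp
qed

text \<open>The part of \<open>P\<close> carrying label \<open>y\<close>, projected to the
  instances, has a density against the marginal: \<open>e\<close> for \<open>y = 1\<close> by the
  definition of \<open>is_regression\<close>, and \<open>1 - e\<close> for \<open>y = -1\<close> by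
  subtraction from the marginal. The integral then splits over the two labels.\<close>

lemma nn_integral_distribution:
  assumes dist: "is_distribution MX P" and reg: "is_regression MX P e"
    and g: "g \<in> borel_measurable P"
  shows "(\<integral>\<^sup>+ z. g z \<partial>P)
    = (\<integral>\<^sup>+ x. ennreal (e x) * g (x, 1) + ennreal (1 - e x) * g (x, -1) \<partial>marginal MX P)"
proof -
  interpret P: prob_space P using dist by (simp add: is_distribution_def)
  interpret PX: prob_space "marginal MX P" by (rule prob_space_marginal[OF dist])
  note [measurable] = measurable_fst_distribution[OF dist] measurable_snd_distribution[OF dist] g
  have e [measurable]: "e \<in> borel_measurable MX" using reg by (simp add: is_regression_def)
  have e01: "0 \<le> e x" "e x \<le> 1" if "x \<in> space MX" for x
    using reg that by (auto simp: is_regression_def)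
  have [measurable]: "(\<lambda>x. g (x, y)) \<in> borel_measurable MX" if "y \<in> {-1, 1}" for y
    using measurable_compose[OF measurable_Pair_distribution[OF dist that] g] .
  define d where "d y = (\<lambda>x. if y = 1 then e x else 1 - e x)" for y :: real
  have [measurable]: "d y \<in> borel_measurable MX" for y unfolding d_def by simp
  have d01: "0 \<le> d y x" "d y x \<le> 1" if "x \<in> space MX" for x y
    using e01[OF that] by (auto simp: d_def)
  have int: "integrable (marginal MX P) (\<lambda>x. indicator A x * d y x)" if "A \<in> sets MX" for A y
    using that d01 by (intro PX.integrable_const_bound[of _ 1]) (auto simp: indicator_def intro!: AE_I2)
  have int1: "integrable (marginal MX P) (indicator A :: 'a \<Rightarrow> real)" if "A \<in> sets MX" for A
    using that by (intro PX.integrable_const_bound[of _ 1]) (auto simp: indicator_def)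
  have meas: "measure P (A \<times> {y}) = (LINT x|marginal MX P. indicator A x * d y x)"
    if A: "A \<in> sets MX" and y: "y \<in> {-1, 1}" for A y
  proof (cases "y = 1")
    case True
    then show ?thesis using reg A
      by (simp add: is_regression_def d_def set_lebesgue_integral_def)
  next
    case False
    with y have y: "y = -1" by simp
    have "measure P (A \<times> {-1, 1}) = measure P (A \<times> {-1} \<union> A \<times> {1})"
      by (rule arg_cong[where f = "measure P"]) auto
    also have "\<dots> = measure P (A \<times> {-1}) + measure P (A \<times> {1})"
      by (intro P.finite_measure_Union sets_Times_distribution[OF dist A]) auto
    finally have "measure P (A \<times> {-1}) = measure (marginal MX P) A - measure P (A \<times> {1})"
      by (simp add: measure_marginal[OF dist A])
    also have "\<dots> = (LINT x|marginal MX P. indicator A x) - (LINT x|marginal MX P. indicator A x * d 1 x)"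
      using reg A sets.sets_into_space[OF A]
      by (simp add: is_regression_def d_def set_lebesgue_integral_def Int_absorb2)
    also have "\<dots> = (LINT x|marginal MX P. indicator A x - indicator A x * d 1 x)"
      using int1[OF A] int[OF A] by simp
    also have "\<dots> = (LINT x|marginal MX P. indicator A x * d (-1) x)"
      by (intro Bochner_Integration.integral_cong) (auto simp: d_def algebra_simps)
    finally show ?thesis using y by simp
  qed
  define N where "N y = distr (density P (indicator {z \<in> space P. snd z = y})) MX fst" for y
  have N: "N y = density (marginal MX P) (\<lambda>x. ennreal (d y x))" if y: "y \<in> {-1, 1}" for y
  proof (rule measure_eqI)
    fix A assume "A \<in> sets (N y)"
    then have A: "A \<in> sets MX" by (simp add: N_def)
    have vi: "fst -` A \<inter> space P = A \<times> {-1, 1}"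
      using sets.sets_into_space[OF A] by (auto simp: space_distribution[OF dist])
    have "emeasure (N y) A = (\<integral>\<^sup>+z. indicator {z \<in> space P. snd z = y} z * indicator (A \<times> {-1, 1}) z \<partial>P)"
      unfolding N_def using A sets_Times_distribution[OF dist A, of "{-1, 1}"]
      by (subst emeasure_distr) (auto simp: vi emeasure_density)
    also have "\<dots> = (\<integral>\<^sup>+z. indicator (A \<times> {y}) z \<partial>P)"
      using y sets.sets_into_space[OF A]
      by (intro nn_integral_cong) (auto simp: indicator_def space_distribution[OF dist])
    also have "\<dots> = emeasure P (A \<times> {y})"
      using sets_Times_distribution[OF dist A, of "{y}"] y by (subst nn_integral_indicator) auto
    also have "\<dots> = ennreal (LINT x|marginal MX P. indicator A x * d y x)"
      by (simp add: P.emeasure_eq_measure meas[OF A y])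
    also have "\<dots> = (\<integral>\<^sup>+x. ennreal (indicator A x * d y x) \<partial>marginal MX P)"
      using d01 by (intro nn_integral_eq_integral[symmetric] int A) (auto intro!: AE_I2)
    also have "\<dots> = emeasure (density (marginal MX P) (\<lambda>x. ennreal (d y x))) A"
      using A by (subst emeasure_density) (auto intro!: nn_integral_cong simp: indicator_def)
    finally show "emeasure (N y) A = emeasure (density (marginal MX P) (\<lambda>x. ennreal (d y x))) A" .
  qed (simp add: N_def)
  have part: "(\<integral>\<^sup>+z. indicator {z \<in> space P. snd z = y} z * g z \<partial>P)
    = (\<integral>\<^sup>+x. ennreal (d y x) * g (x, y) \<partial>marginal MX P)" if y: "y \<in> {-1, 1}" for y
  proof -
    have "(\<integral>\<^sup>+z. indicator {z \<in> space P. snd z = y} z * g z \<partial>P)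
      = (\<integral>\<^sup>+z. indicator {z \<in> space P. snd z = y} z * g (fst z, y) \<partial>P)"
      by (intro nn_integral_cong) (auto simp: indicator_def)
    also have "\<dots> = (\<integral>\<^sup>+z. g (fst z, y) \<partial>density P (indicator {z \<in> space P. snd z = y}))"
      using y by (subst nn_integral_density) auto
    also have "\<dots> = (\<integral>\<^sup>+x. g (x, y) \<partial>N y)"
      unfolding N_def using y by (subst nn_integral_distr) auto
    also have "\<dots> = (\<integral>\<^sup>+x. ennreal (d y x) * g (x, y) \<partial>marginal MX P)"
      using y by (simp add: N[OF y] nn_integral_density)
    finally show ?thesis .
  qed
  have "(\<integral>\<^sup>+ z. g z \<partial>P) = (\<integral>\<^sup>+z. indicator {z \<in> space P. snd z = 1} z * g z
      + indicator {z \<in> space P. snd z = -1} z * g z \<partial>P)"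
    by (intro nn_integral_cong) (auto simp: indicator_def space_distribution[OF dist])
  also have "\<dots> = (\<integral>\<^sup>+x. ennreal (d 1 x) * g (x, 1) \<partial>marginal MX P)
      + (\<integral>\<^sup>+x. ennreal (d (-1) x) * g (x, -1) \<partial>marginal MX P)"
    by (subst nn_integral_add) (auto simp: part)
  also have "\<dots> = (\<integral>\<^sup>+x. ennreal (d 1 x) * g (x, 1) + ennreal (d (-1) x) * g (x, -1) \<partial>marginal MX P)"
    by (subst nn_integral_add) auto
  finally show ?thesis by (simp add: d_def)
qed

section \<open>Risks and risk transforms\<close>

lemma neg_one_times_ereal [simp]: "ereal (- 1) * z = - z"
  by (cases z) auto

lemma one_times_ereal [simp]: "ereal 1 * z = z"
  by (simp add: one_ereal_def[symmetric])

lemma measurable_loss: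
  assumes dist: "is_distribution MX P" and l: "l \<in> borel_measurable borel"
    and h: "h \<in> borel_measurable MX"
  shows "(\<lambda>z. l (ereal (snd z) * h (fst z))) \<in> borel_measurable P"
proof -
  note [measurable] = measurable_fst_distribution[OF dist] measurable_snd_distribution[OF dist] h l
  show ?thesis by measurable
qed

lemma measurable_cond_risk:
  assumes "l \<in> borel_measurable borel" "h \<in> borel_measurable M" "e \<in> borel_measurable M"
  shows "(\<lambda>x. cond_risk l (e x) (h x)) \<in> borel_measurable M"
  using assms unfolding cond_risk_def by measurable

lemma risk_eq_cond_risk:
  assumes "is_distribution MX P" "is_regression MX P e" "l \<in> borel_measurable borel"
    and "h \<in> borel_measurable MX"
  shows "risk l P h = enn2ereal (\<integral>\<^sup>+ x. cond_risk l (e x) (h x) \<partial>marginal MX P)"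
  unfolding risk_def
  by (subst nn_integral_distribution[OF assms(1,2) measurable_loss[OF assms(1,3,4)]])
    (simp add: cond_risk_def)

lemma risk_mono_cond:
  assumes "is_distribution MX P" "is_regression MX P e" "l \<in> borel_measurable borel"
    and "h \<in> borel_measurable MX" "g \<in> borel_measurable MX"
    and "\<And>x. x \<in> space MX \<Longrightarrow> cond_risk l (e x) (h x) \<le> cond_risk l (e x) (g x)"
  shows "risk l P h \<le> risk l P g"
  unfolding risk_eq_cond_risk[OF assms(1-4)] risk_eq_cond_risk[OF assms(1-3,5)]
  using assms(6) by (auto simp: less_eq_ennreal.rep_eq[symmetric] intro!: nn_integral_mono)

lemma patch_in_Fstar:
  assumes "U \<in> sets MX" "f \<in> Fstar MX" "h \<in> Fstar MX"
  shows "patch U f h \<in> Fstar MX"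
  using assms unfolding patch_def Fstar_def by (auto simp: extensional_def)

lemma patch_patch: "D \<subseteq> U \<Longrightarrow> patch D f (patch U f h) = patch D f h"
  by (auto simp: patch_def fun_eq_iff)

lemma patch_self [simp]: "patch U f f = f"
  by (auto simp: patch_def)

lemma patch_space:
  assumes "f \<in> Fstar MX" "h \<in> Fstar MX"
  shows "patch (space MX) f h = h"
  using assms by (auto simp: patch_def Fstar_def extensional_def fun_eq_iff)

lemma risk_patch_le:
  assumes "is_distribution MX P" "is_regression MX P e" "l \<in> borel_measurable borel"
    and "U \<in> sets MX" "f \<in> Fstar MX" "h \<in> Fstar MX"
    and "\<And>x z. x \<in> space MX \<Longrightarrow> cond_risk l (e x) (f x) \<le> cond_risk l (e x) z"
  shows "risk l P (patch U f h) \<le> risk l P h"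
  using patch_in_Fstar[OF assms(4-6)] assms(6,7)
  by (intro risk_mono_cond[OF assms(1-3)]) (auto simp: Fstar_def patch_def)

lemma DIS_mono: "H \<subseteq> H' \<Longrightarrow> DIS MX c H \<subseteq> DIS MX c H'"
  by (auto simp: DIS_def)

text \<open>Patching alters functions only outside the disagreement region, so every witness
  survives inside it. Requests occur in the region of the unpatched class, while \<open>Uj\<close>
  is defined from the patched one.\<close>

lemma DIS_subset_patch_set: "DIS MX c H \<subseteq> DIS MX c (patch_set H (DIS MX c H) f)"
proof
  fix x assume x: "x \<in> DIS MX c H"
  then obtain h g where "x \<in> space MX" "h \<in> H" "g \<in> H" "sign c (h x) \<noteq> sign c (g x)"
    by (auto simp: DIS_def)
  then have "patch (DIS MX c H) f h \<in> patch_set H (DIS MX c H) f"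
    "patch (DIS MX c H) f g \<in> patch_set H (DIS MX c H) f"
    "sign c (patch (DIS MX c H) f h x) \<noteq> sign c (patch (DIS MX c H) f g x)"
    using x by (auto simp: patch_set_def patch_def)
  then show "x \<in> DIS MX c (patch_set H (DIS MX c H) f)"
    using \<open>x \<in> space MX\<close> unfolding DIS_def by blast
qed

text \<open>Since \<open>f\<close> itself belongs to \<open>V\<close>, it has the sign of
  \<open>h\<close> wherever \<open>V\<close> agrees.\<close>

lemma er_patch:
  assumes "is_distribution MX P" "h \<in> V" "f \<in> V" "DIS MX c V \<subseteq> U"
  shows "er c P (patch U f h) = er c P h"
proof -
  have "sign c (patch U f h x) = sign c (h x)" if "x \<in> space MX" for x
    using assms(2-4) that by (auto simp: patch_def DIS_def)
  then show ?thesis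
    unfolding er_def by (intro arg_cong[where f = "measure P"]) (auto simp: space_distribution[OF assms(1)])
qed

lemma er_bounds:
  assumes "is_distribution MX P"
  shows "0 \<le> er c P h" "er c P h \<le> 1"
proof -
  interpret P: prob_space P using assms by (simp add: is_distribution_def)
  show "0 \<le> er c P h" "er c P h \<le> 1" by (auto simp: er_def)
qed

lemma measurable_sign: "c \<in> {-1, 1} \<Longrightarrow> h \<in> borel_measurable M \<Longrightarrow> (\<lambda>x. sign c (h x)) \<in> borel_measurable M"
  unfolding sign_def by (intro measurable_If borel_measurable_less) simp_all

lemma err_set_FstarD:
  assumes dist: "is_distribution MX P" and f: "f \<in> Fstar MX" and h: "h \<in> err_set c P (Fstar MX) \<epsilon>"
  shows "er c P h - er c P f \<le> \<epsilon>" "F \<subseteq> Fstar MX \<Longrightarrow> h \<in> F \<Longrightarrow> h \<in> err_set c P F \<epsilon>"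
proof -
  have bdd: "bdd_below (er c P ` H)" for H
    using er_bounds(1)[OF dist] by (auto intro!: bdd_belowI)
  have "(INF g\<in>Fstar MX. er c P g) \<le> er c P f" using f by (intro cINF_lower bdd)
  then show "er c P h - er c P f \<le> \<epsilon>" using h by (simp add: err_set_def)
  show "h \<in> err_set c P F \<epsilon>" if F: "F \<subseteq> Fstar MX" "h \<in> F"
  proof -
    have "(INF g\<in>Fstar MX. er c P g) \<le> (INF g\<in>F. er c P g)"
      using F by (intro cINF_superset_mono bdd) auto
    then show ?thesis using h F by (simp add: err_set_def)
  qed
qed

lemma err_set_of_excess_less_Gamma:
  assumes dist: "is_distribution MX P"
    and f: "f \<in> Fstar MX" "\<And>g. g \<in> Fstar MX \<Longrightarrow> risk l P f \<le> risk l P g"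
    and h: "h \<in> Fstar MX" "risk l P h - risk l P f < ereal \<gamma>" "ereal \<gamma> \<le> Gamma_l MX c l P \<epsilon>"
  shows "h \<in> err_set c P (Fstar MX) \<epsilon>"
proof -
  have INF: "(INF g\<in>Fstar MX. risk l P g) = risk l P f"
    using f by (intro antisym INF_lower INF_greatest) auto
  have nn: "0 \<le> risk l P h - risk l P f" if "risk l P f \<noteq> \<infinity>"
    using f(2)[OF h(1)] that by (intro ereal_diff_positive) auto
  \<comment> \<open>In \<open>ereal\<close>, \<open>\<infinity> - \<infinity> = \<infinity>\<close>,
    so a finite bound on the excess excludes an infinite risk of \<open>f\<close>.\<close>
  have fin: "risk l P f \<noteq> \<infinity>"
  proof
    assume *: "risk l P f = \<infinity>"
    then have "risk l P h = \<infinity>" using f(2)[OF h(1)] by simp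
    then show False using h(2) * by simp
  qed
  have "risk l P h - risk l P f < Gamma_l MX c l P \<epsilon>"
    using h(2,3) by (rule less_le_trans)
  then obtain y where y: "y \<in> {ereal \<gamma> | \<gamma>. \<gamma> > 0 \<and> surr_set l P (Fstar MX) \<gamma> \<subseteq> err_set c P (Fstar MX) \<epsilon>} \<union> {0}"
    "risk l P h - risk l P f < y"
    unfolding Gamma_l_def less_Sup_iff by blast
  \<comment> \<open>The added element \<open>0\<close> is ruled out because \<open>y\<close> exceeds
    a nonnegative excess.\<close>
  then obtain \<gamma>' where "y = ereal \<gamma>'" "surr_set l P (Fstar MX) \<gamma>' \<subseteq> err_set c P (Fstar MX) \<epsilon>"
    using nn[OF fin] by auto
  then show ?thesis using y(2) h(1) INF by (auto simp: surr_set_def)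
qed

text \<open>Error rates lie in \<open>[0, 1]\<close>, so \<open>err_set\<close> with tolerance 1 is
  everything. This makes the set in \<open>Eps_l\<close> nonempty, which the real-valued
  \<open>Inf\<close> requires.\<close>

lemma Gamma_l_one:
  assumes dist: "is_distribution MX P"
  shows "Gamma_l MX c l P 1 = \<infinity>"
proof -
  have "err_set c P (Fstar MX) 1 = Fstar MX"
  proof -
    have "er c P h - (INF g\<in>Fstar MX. er c P g) \<le> 1" if "h \<in> Fstar MX" for h
    proof -
      have "0 \<le> (INF g\<in>Fstar MX. er c P g)"
        using that er_bounds(1)[OF dist] by (intro cINF_greatest) auto
      then show ?thesis using er_bounds(2)[OF dist, of c h] by linarith
    qed
    then show ?thesis by (auto simp: err_set_def)
  qed
  then have "surr_set l P (Fstar MX) \<gamma> \<subseteq> err_set c P (Fstar MX) 1" for \<gamma>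
    by (auto simp: surr_set_def)
  then have *: "ereal \<gamma> \<le> Gamma_l MX c l P 1" if "\<gamma> > 0" for \<gamma>
    using that unfolding Gamma_l_def by (intro Sup_upper) auto
  show ?thesis
  proof (rule ereal_top)
    fix B :: real
    have "ereal B \<le> ereal (max B 1)" by simp
    also have "\<dots> \<le> Gamma_l MX c l P 1" by (rule *) simp
    finally show "ereal B \<le> Gamma_l MX c l P 1" .
  qed
qed

text \<open>For every \<epsilon> in the set defining \<open>Eps_l\<close>, the surrogate bound for
  the patched function becomes an error bound, which \<open>er_patch\<close> moves to
  \<open>h\<close>; passing from \<open>Fstar MX\<close> to the smaller class \<open>F\<close> only
  raises the reference infimum. As \<open>h\<close> does not depend on \<epsilon>, the bound passes
  to the infimum.\<close>

lemma excess_in_Gset: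
  assumes dist: "is_distribution MX P" and F: "F \<subseteq> Fstar MX"
    and f: "f \<in> F" "\<And>g. g \<in> Fstar MX \<Longrightarrow> risk l P f \<le> risk l P g"
    and V: "V \<subseteq> F" "f \<in> V" "h \<in> V" and U: "U \<in> sets MX" "DIS MX c V \<subseteq> U"
    and less: "risk l P (patch U f h) - risk l P f < ereal (2 powi (2 - j))"
  shows "h \<in> Gset MX c F l P j"
proof -
  let ?S = "{\<epsilon>. 0 < \<epsilon> \<and> \<epsilon> \<le> 1 \<and> ereal (2 powi (2 - j)) \<le> Gamma_l MX c l P \<epsilon>}"
  have mem: "er c P h - (INF g\<in>F. er c P g) \<le> \<epsilon>" if "\<epsilon> \<in> ?S" for \<epsilon>
  proof -
    have "patch U f h \<in> err_set c P (Fstar MX) \<epsilon>"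
      using f F V that patch_in_Fstar[OF U(1), of f h]
      by (intro err_set_of_excess_less_Gamma[OF dist _ f(2) _ less]) auto
    then have "h \<in> err_set c P (Fstar MX) \<epsilon>"
      using er_patch[OF dist V(3,2) U(2)] V F by (auto simp: err_set_def)
    then have "h \<in> err_set c P F \<epsilon>"
      by (rule err_set_FstarD(2)[OF dist, of f, rotated]) (use f F V in auto)
    then show ?thesis by (simp add: err_set_def)
  qed
  have "1 \<in> ?S" by (simp add: Gamma_l_one[OF dist])
  then have "er c P h - (INF g\<in>F. er c P g) \<le> Inf ?S"
    using mem by (intro cInf_greatest) auto
  then show ?thesis
    using V by (auto simp: Gset_def err_set_def Eps_l_def)
qed

section \<open>Measurable infima of conditional risks and positivity of
  \<open>Gamma_l\<close>\<close>

text \<open>The family is uncountable, but where \<open>l z\<close> and \<open>l (- z)\<close> are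
  finite the conditional risk is continuous in \<open>e\<close>, so strict sublevel sets of the
  infimum are open. For \<open>e\<close> strictly between 0 and 1 every other \<open>z\<close>
  contributes \<open>top\<close>; at the endpoints it need not, as
  \<open>0 * top = 0\<close>.\<close>

lemma measurable_INF_cond_risk:
  obtains g where "g \<in> borel_measurable borel"
    "\<And>e. e \<in> {0<..<1} \<Longrightarrow> (INF z\<in>Z. cond_risk l e z) = g e"
proof
  define Z' where "Z' = {z \<in> Z. l z < top \<and> l (- z) < top}"
  define g where "g e = (INF z\<in>Z'. cond_risk l e z)" for e
  have *: "continuous_on UNIV (\<lambda>e. cond_risk l e z)" if z: "z \<in> Z'" for z
  proof -
    obtain a b where ab: "0 \<le> a" "l z = ennreal a" "0 \<le> b" "l (- z) = ennreal b"
      using z unfolding Z'_def by (cases "l z"; cases "l (- z)") auto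
    \<comment> \<open>\<open>ennreal\<close> sends negative reals to 0; the truncation by
      \<open>max 0\<close> gives a formula valid on the whole line.\<close>
    have eq: "ennreal x * ennreal y = ennreal (max 0 x * y)" if "0 \<le> y" for x y
      using that by (cases "0 \<le> x") (auto simp: ennreal_mult ennreal_neg)
    have eq': "(\<lambda>e. cond_risk l e z) = (\<lambda>e. ennreal (max 0 e * a + max 0 (1 - e) * b))"
      unfolding cond_risk_def ab using ab(1,3) by (auto simp: eq ennreal_plus)
    show ?thesis unfolding eq' by (intro continuous_on_ennreal continuous_intros)
  qed
  show "g \<in> borel_measurable borel"
  proof (rule borel_measurableI_less)
    fix y :: ennreal
    have "{e. g e < y} = (\<Union>z\<in>Z'. {e. cond_risk l e z < y})"
      unfolding g_def by (auto simp: INF_less_iff)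
    moreover have "open {e. cond_risk l e z < y}" if "z \<in> Z'" for z
      using *[OF that] by (intro open_Collect_less) auto
    ultimately have "open {e. g e < y}" by auto
    then show "{x \<in> space borel. g x < y} \<in> sets borel" by simp
  qed
  show "(INF z\<in>Z. cond_risk l e z) = g e" if e: "e \<in> {0<..<1}" for e
  proof (rule antisym)
    show "(INF z\<in>Z. cond_risk l e z) \<le> g e"
      unfolding g_def Z'_def by (intro INF_superset_mono) auto
    show "g e \<le> (INF z\<in>Z. cond_risk l e z)"
    proof (rule INF_greatest)
      fix z assume z: "z \<in> Z"
      show "g e \<le> cond_risk l e z"
      proof (cases "z \<in> Z'")
        case True then show ?thesis unfolding g_def by (intro INF_lower)
      next
        case False
        then have "l z = top \<or> l (- z) = top" using z top.not_eq_extremum[of "l z"] top.not_eq_extremum[of "l (- z)"] unfolding Z'_def by blast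
        then have "cond_risk l e z = top"
          using e by (auto simp: cond_risk_def ennreal_mult_top)
        then show ?thesis by simp
      qed
    qed
  qed
qed

text \<open>On each side of \<open>1/2\<close> the constraint on \<open>z\<close> is a fixed
  half-line, so the previous lemma applies; the two endpoints are put in as constants.\<close>

lemma measurable_lstar_minus:
  obtains g where "g \<in> borel_measurable borel"
    "\<And>e. e \<in> {0..1} - {1/2} \<Longrightarrow> lstar_minus l e = g e"
proof -
  have neg: "{z. z * ereal (2 * e - 1) \<le> 0} = {..0}" if "1/2 < e" for e
  proof -
    have "z * ereal (2 * e - 1) \<le> 0 \<longleftrightarrow> z \<le> 0" for z
      using that by (cases z) (auto simp: mult_le_0_iff)
    then show ?thesis by auto
  qed
  have pos: "{z. z * ereal (2 * e - 1) \<le> 0} = {0..}" if "e < 1/2" for e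
  proof -
    have "z * ereal (2 * e - 1) \<le> 0 \<longleftrightarrow> 0 \<le> z" for z
      using that by (cases z) (auto simp: mult_le_0_iff)
    then show ?thesis by auto
  qed
  obtain g1 where g1 [measurable]: "g1 \<in> borel_measurable borel"
    and eq1: "\<And>e. e \<in> {0<..<1} \<Longrightarrow> (INF z\<in>{..0}. cond_risk l e z) = g1 e"
    using measurable_INF_cond_risk[of l "{..0}"] by blast
  obtain g2 where g2 [measurable]: "g2 \<in> borel_measurable borel"
    and eq2: "\<And>e. e \<in> {0<..<1} \<Longrightarrow> (INF z\<in>{0..}. cond_risk l e z) = g2 e"
    using measurable_INF_cond_risk[of l "{0..}"] by blast
  define g where "g e = (if e = 0 then lstar_minus l 0 else if e = 1 then lstar_minus l 1
     else if 1/2 < e then g1 e else g2 e)" for e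
  have "g \<in> borel_measurable borel" unfolding g_def by measurable
  moreover have "lstar_minus l e = g e" if "e \<in> {0..1} - {1/2}" for e
  proof (cases "1/2 < e")
    case True
    then show ?thesis using that eq1[of e] neg[of e]
      by (auto simp: g_def lstar_minus_def)
  next
    case False
    then have "e < 1/2" using that by auto
    then show ?thesis using that eq2[of e] pos[of e]
      by (auto simp: g_def lstar_minus_def)
  qed
  ultimately show thesis by (rule that)
qed

lemma er_eq_nn_integral:
  assumes dist: "is_distribution MX P" and reg: "is_regression MX P e" and c: "c \<in> {-1, 1}"
    and h: "h \<in> borel_measurable MX"
  shows "ennreal (er c P h) = (\<integral>\<^sup>+ x. ennreal (if sign c (h x) = 1 then 1 - e x else e x) \<partial>marginal MX P)"
proof -
  interpret P: prob_space P using dist by (simp add: is_distribution_def)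
  have m: "(\<lambda>z. sign c (h (fst z))) \<in> borel_measurable P"
    by (rule measurable_sign[OF c measurable_compose[OF measurable_fst_distribution[OF dist] h]])
  have S: "{z \<in> space P. sign c (h (fst z)) \<noteq> snd z} \<in> sets P"
    by (intro borel_measurable_neq m  measurable_snd_distribution[OF dist])
  have "ennreal (er c P h) = (\<integral>\<^sup>+ z. indicator {z \<in> space P. sign c (h (fst z)) \<noteq> snd z} z \<partial>P)"
    unfolding er_def P.emeasure_eq_measure[symmetric] by (rule nn_integral_indicator[symmetric, OF S])
  also have "\<dots> = (\<integral>\<^sup>+ x. ennreal (if sign c (h x) = 1 then 1 - e x else e x) \<partial>marginal MX P)"
    unfolding nn_integral_distribution[OF dist reg borel_measurable_indicator[OF S]]
  proof (rule nn_integral_cong)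
    fix x assume "x \<in> space (marginal MX P)"
    then have "(x, 1) \<in> space P" "(x, -1) \<in> space P" by (auto simp: space_distribution[OF dist])
    moreover have "sign c (h x) = 1 \<or> sign c (h x) = -1" using c by (auto simp: sign_def)
    ultimately show "ennreal (e x) * indicator {z \<in> space P. sign c (h (fst z)) \<noteq> snd z} (x, 1)
        + ennreal (1 - e x) * indicator {z \<in> space P. sign c (h (fst z)) \<noteq> snd z} (x, -1)
      = ennreal (if sign c (h x) = 1 then 1 - e x else e x)"
      by (elim disjE) simp_all
  qed
  finally show ?thesis .
qed

text \<open>Where \<open>h\<close> has the Bayes sign, or \<open>e x = 1/2\<close>, its conditional
  error is at most that of \<open>g\<close>; on the exceptional set \<open>A\<close> the two differ
  by at most 1.\<close>

lemma er_diff_le: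
  assumes dist: "is_distribution MX P" and reg: "is_regression MX P e" and c: "c \<in> {-1, 1}"
    and h: "h \<in> borel_measurable MX" and g: "g \<in> borel_measurable MX"
    and A: "A \<in> sets MX"
    and bayes: "\<And>x. x \<in> space MX - A \<Longrightarrow> e x \<noteq> 1/2 \<Longrightarrow> sign c (h x) = (if 1/2 < e x then 1 else -1)"
  shows "er c P h \<le> er c P g + measure (marginal MX P) A"
proof -
  interpret PX: prob_space "marginal MX P" by (rule prob_space_marginal[OF dist])
  have [measurable]: "e \<in> borel_measurable MX" using reg by (simp add: is_regression_def)
  have e01: "0 \<le> e x" "e x \<le> 1" if "x \<in> space MX" for x
    using reg that by (auto simp: is_regression_def)
  note [measurable] = measurable_sign[OF c h] measurable_sign[OF c g]
  have "ennreal (er c P h) \<le> (\<integral>\<^sup>+ x. ennreal (if sign c (g x) = 1 then 1 - e x else e x) + indicator A x \<partial>marginal MX P)"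
    unfolding er_eq_nn_integral[OF dist reg c h]
  proof (intro nn_integral_mono)
    fix x assume "x \<in> space (marginal MX P)"
    then have x: "x \<in> space MX" by simp
    let ?r = "\<lambda>h. if sign c (h x) = 1 then 1 - e x else e x"
    have "?r h \<le> ?r g + indicator A x"
    proof (cases "x \<in> A \<or> e x = 1/2")
      case True
      then show ?thesis using e01[OF x] by (auto simp: indicator_def)
    next
      case False
      then show ?thesis using bayes[of x] x e01[OF x] by (cases "1/2 < e x") auto
    qed
    moreover have "0 \<le> ?r g" using e01[OF x] by auto
    moreover have "ennreal (?r g + indicator A x) = ennreal (?r g) + indicator A x"
      using e01[OF x] by (subst ennreal_plus) (auto simp: ennreal_indicator)
    ultimately show "ennreal (?r h) \<le> ennreal (?r g) + indicator A x"
      using ennreal_leI[of "?r h" "?r g + indicator A x"] by (simp only:)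
  qed
  also have "\<dots> = ennreal (er c P g) + emeasure (marginal MX P) A"
    unfolding er_eq_nn_integral[OF dist reg c g] using A by (subst nn_integral_add) auto
  also have "\<dots> = ennreal (er c P g + measure (marginal MX P) A)"
    using er_bounds(1)[OF dist, of c g] by (simp add: PX.emeasure_eq_measure)
  finally show ?thesis using er_bounds(1)[OF dist, of c g] by (subst (asm) ennreal_le_iff) auto
qed

text \<open>Pointwise the conditional excess risk of a wrong sign is at least
  \<open>lstar_minus - lstar > 0\<close>; this gap exceeds some \<open>\<delta> > 0\<close> off a set of small probability,
  so a function with small excess risk has the wrong sign only on a set of small probability.\<close>

lemma Gamma_l_pos:
  assumes dist: "is_distribution MX P" and reg: "is_regression MX P e" and c: "c \<in> {-1, 1}"
    and l: "l \<in> borel_measurable borel" "l 0 < \<infinity>" and cal: "classification_calibrated l"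
    and f: "f \<in> Fstar MX" "\<And>x. x \<in> space MX \<Longrightarrow> cond_risk l (e x) (f x) = lstar l (e x)"
    and fin: "risk l P f < \<infinity>" and \<epsilon>: "0 < \<epsilon>"
  shows "0 < Gamma_l MX c l P \<epsilon>"
proof -
  interpret PX: prob_space "marginal MX P" by (rule prob_space_marginal[OF dist])
  have [measurable]: "e \<in> borel_measurable MX" using reg by (simp add: is_regression_def)
  have e01: "0 \<le> e x" "e x \<le> 1" if "x \<in> space MX" for x
    using reg that by (auto simp: is_regression_def)
  have fm: "f \<in> borel_measurable MX" using f by (simp add: Fstar_def)
  \<comment> \<open>\<open>W\<close> below is defined by comparison with \<open>lstar_minus\<close>;
    the measurable version \<open>g\<close> makes it a measurable set.\<close>
  obtain g where g [measurable]: "g \<in> borel_measurable borel"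
    and geq: "\<And>e. e \<in> {0..1} - {1/2} \<Longrightarrow> lstar_minus l e = g e"
    using measurable_lstar_minus[of l] by blast
  define L where "L x = cond_risk l (e x) (f x)" for x
  have [measurable]: "L \<in> borel_measurable MX"
    unfolding L_def by (intro measurable_cond_risk l fm) simp
  have Lfin: "L x < top" if "x \<in> space MX" for x
  proof -
    have "L x \<le> cond_risk l (e x) 0"
      using f(2)[OF that] by (simp add: L_def lstar_def INF_lower)
    also have "\<dots> < top" using l(2) by (auto simp: cond_risk_def ennreal_mult_less_top)
    finally show ?thesis .
  qed
  define W where "W n = {x \<in> space MX. e x \<noteq> 1/2 \<and> g (e x) \<le> L x + ennreal (1 / Suc n)}" for n :: nat
  have [measurable]: "W n \<in> sets MX" for n unfolding W_def by measurable
  have "(\<lambda>n. measure (marginal MX P) (W n)) \<longlonglongrightarrow> measure (marginal MX P) (\<Inter>n. W n)"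
  proof (rule PX.finite_Lim_measure_decseq)
    show "decseq W"
    proof (rule decseq_SucI, rule subsetI)
      fix n x assume "x \<in> W (Suc n)"
      moreover have "ennreal (1 / Suc (Suc n)) \<le> ennreal (1 / Suc n)"
        by (intro ennreal_leI frac_le) auto
      ultimately show "x \<in> W n" unfolding W_def by (auto intro: order_trans add_left_mono)
    qed
  qed auto
  moreover have "(\<Inter>n. W n) = {}"
  proof (rule ccontr)
    assume "(\<Inter>n. W n) \<noteq> {}"
    then obtain x where x: "\<And>n. x \<in> W n" by auto
    then have xs: "x \<in> space MX" "e x \<noteq> 1/2" by (auto simp: W_def)
    have "L x < g (e x)"
    proof -
      have "e x \<in> {0..1} - {1/2}" using e01[OF xs(1)] xs(2) by simp
      then show ?thesis
        using cal geq f(2)[OF xs(1)] unfolding classification_calibrated_def L_def by metis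
    qed
    obtain a where a: "0 \<le> a" "L x = ennreal a" using Lfin[OF xs(1)] by (cases "L x") auto
    have "(\<lambda>n. ennreal (a + 1 / Suc n)) \<longlonglongrightarrow> ennreal (a + 0)"
      by (intro tendsto_ennrealI tendsto_add tendsto_const lim_1_over_n[THEN filterlim_sequentially_Suc[THEN iffD2]])
    moreover have "g (e x) \<le> ennreal (a + 1 / Suc n)" for n
      using x[of n] a by (simp add: W_def ennreal_plus[symmetric] del: ennreal_plus)
    ultimately have "g (e x) \<le> ennreal a"
      by (intro LIMSEQ_le_const[of _ _ "g (e x)"]) auto
    then show False using \<open>L x < g (e x)\<close> a by simp
  qed
  ultimately have "(\<lambda>n. measure (marginal MX P) (W n)) \<longlonglongrightarrow> 0" by simp
  then have "\<forall>\<^sub>F n in sequentially. measure (marginal MX P) (W n) < \<epsilon> / 2"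
    using \<epsilon> by (intro order_tendstoD(2)) auto
  then obtain n where n: "measure (marginal MX P) (W n) < \<epsilon> / 2"
    by (auto simp: eventually_sequentially)
  define \<delta> where "\<delta> = 1 / real (Suc n)"
  have \<delta>: "0 < \<delta>" by (simp add: \<delta>_def)
  have INF: "(INF g\<in>Fstar MX. risk l P g) = risk l P f"
    using f(1) by (intro antisym INF_lower INF_greatest risk_mono_cond[OF dist reg l(1)])
      (auto simp: f(2) lstar_def INF_lower Fstar_def)
  \<comment> \<open>A wrong sign off \<open>W n\<close> costs at least \<open>\<delta>\<close>, so
    an excess of \<open>\<delta> * (\<epsilon> / 2)\<close> permits wrong signs there with
    probability at most \<open>\<epsilon> / 2\<close>; \<open>W n\<close> uses up the other
    half.\<close>
  have "h \<in> err_set c P (Fstar MX) \<epsilon>" if h: "h \<in> surr_set l P (Fstar MX) (\<delta> * (\<epsilon> / 2))" for h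
  proof -
    have hm: "h \<in> borel_measurable MX" using h by (auto simp: surr_set_def Fstar_def)
    note [measurable] = measurable_sign[OF c hm]
    define A where "A = {x \<in> space MX. e x \<noteq> 1/2 \<and> sign c (h x) \<noteq> (if 1/2 < e x then 1 else -1)}"
    have A [measurable]: "A \<in> sets MX" unfolding A_def by measurable
    have "(\<integral>\<^sup>+x. L x \<partial>marginal MX P) + ennreal \<delta> * emeasure (marginal MX P) (A - W n)
      = (\<integral>\<^sup>+x. L x + ennreal \<delta> * indicator (A - W n) x \<partial>marginal MX P)"
      by (subst nn_integral_add) (auto simp: nn_integral_cmult)
    also have "\<dots> \<le> (\<integral>\<^sup>+x. cond_risk l (e x) (h x) \<partial>marginal MX P)"
    proof (rule nn_integral_mono)
      fix x assume "x \<in> space (marginal MX P)"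
      then have x: "x \<in> space MX" by simp
      show "L x + ennreal \<delta> * indicator (A - W n) x \<le> cond_risk l (e x) (h x)"
      proof (cases "x \<in> A - W n")
        case True
        \<comment> \<open>The case \<open>h x = 0\<close>, where the sign is the fixed
          \<open>c\<close>, is covered because the constraint in \<open>lstar_minus\<close> is not
          strict.\<close>
        have "h x * ereal (2 * e x - 1) \<le> 0"
          using True c unfolding A_def sign_def
          by (cases "h x") (auto simp: mult_le_0_iff split: if_splits)
        then have "lstar_minus l (e x) \<le> cond_risk l (e x) (h x)"
          unfolding lstar_minus_def by (intro INF_lower) auto
        moreover have "L x + ennreal \<delta> \<le> g (e x)"
          using True x by (auto simp: W_def A_def \<delta>_def)
        moreover have "lstar_minus l (e x) = g (e x)"
          using True e01[OF x] by (intro geq) (auto simp: A_def)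
        ultimately show ?thesis using True by simp
      next
        case False
        then show ?thesis using f(2)[OF x] by (simp add: L_def lstar_def INF_lower)
      qed
    qed
    also have "\<dots> \<le> (\<integral>\<^sup>+x. L x \<partial>marginal MX P) + ennreal (\<delta> * (\<epsilon> / 2))"
    proof -
      have "risk l P h - risk l P f \<le> ereal (\<delta> * (\<epsilon> / 2))" using h INF by (simp add: surr_set_def)
      then have "risk l P h \<le> ereal (\<delta> * (\<epsilon> / 2)) + risk l P f"
        using fin by (subst (asm) ereal_minus_le_iff) (auto simp: risk_def)
      then show ?thesis
        using \<delta> \<epsilon> unfolding risk_eq_cond_risk[OF dist reg l(1) hm] risk_eq_cond_risk[OF dist reg l(1) fm] L_def
        by (simp add: less_eq_ennreal.rep_eq plus_ennreal.rep_eq enn2ereal_ennreal add.commute)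
    qed
    finally have "ennreal \<delta> * emeasure (marginal MX P) (A - W n) \<le> ennreal (\<delta> * (\<epsilon> / 2))"
      using fin unfolding risk_eq_cond_risk[OF dist reg l(1) fm] L_def[symmetric]
      by (subst (asm) ennreal_add_left_cancel_le) (auto simp: less_top[symmetric] enn2ereal_eq_top_iff top_ereal_def)
    then have "\<delta> * measure (marginal MX P) (A - W n) \<le> \<delta> * (\<epsilon> / 2)"
      using \<delta> \<epsilon> by (simp add: PX.emeasure_eq_measure ennreal_mult[symmetric])
    then have "measure (marginal MX P) (A - W n) \<le> \<epsilon> / 2" using \<delta> by simp
    moreover have "measure (marginal MX P) A \<le> measure (marginal MX P) ((A - W n) \<union> W n)"
      by (intro PX.finite_measure_mono) auto
    moreover have "\<dots> \<le> measure (marginal MX P) (A - W n) + measure (marginal MX P) (W n)"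
      by (intro measure_Un_le) auto
    ultimately have mA: "measure (marginal MX P) A \<le> \<epsilon>" using n by linarith
    have "er c P h - \<epsilon> \<le> (INF g\<in>Fstar MX. er c P g)"
    proof (rule cINF_greatest)
      fix g assume "g \<in> Fstar MX"
      then show "er c P h - \<epsilon> \<le> er c P g"
        using er_diff_le[OF dist reg c hm _ A, of g] mA by (auto simp: A_def Fstar_def)
    qed (use f in auto)
    then show ?thesis using h by (auto simp: err_set_def surr_set_def)
  qed
  then have "ereal (\<delta> * (\<epsilon> / 2)) \<le> Gamma_l MX c l P \<epsilon>"
    unfolding Gamma_l_def using \<delta> \<epsilon>
    by (intro Sup_upper UnI1 CollectI exI[of _ "\<delta> * (\<epsilon> / 2)"]) auto
  moreover have "0 < ereal (\<delta> * (\<epsilon> / 2))" using \<delta> \<epsilon> by simp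
  ultimately show ?thesis by (rule less_le_trans[rotated])
qed

section \<open>Empirical quantities of patched classes\<close>

text \<open>\<open>Q\<close> is indexed by pairs of index and label, the concentration inequality by
  \<open>{1..m}\<close>, a block by its absolute indices; this identifies the three.\<close>

lemma emp_reindex:
  assumes "inj_on p J"
  shows "emp_risk l (p ` J) S h = emp_risk l J (\<lambda>j. S (p j)) h"
    and "emp_phi l H (p ` J) S \<xi> = emp_phi l H J (\<lambda>j. S (p j)) (\<lambda>j. \<xi> (p j))"
    and "emp_D l H (p ` J) S = emp_D l H J (\<lambda>j. S (p j))"
    and "Uhat l lb H (p ` J) S \<xi> s = Uhat l lb H J (\<lambda>j. S (p j)) (\<lambda>j. \<xi> (p j)) s"
proof -
  note r = sum.reindex[OF assms] card_image[OF assms]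
  show "emp_risk l (p ` J) S h = emp_risk l J (\<lambda>j. S (p j)) h"
    by (auto simp: emp_risk_def r)
  show 1: "emp_phi l H (p ` J) S \<xi> = emp_phi l H J (\<lambda>j. S (p j)) (\<lambda>j. \<xi> (p j))"
    by (simp add: emp_phi_def r)
  show 2: "emp_D l H (p ` J) S = emp_D l H J (\<lambda>j. S (p j))"
    by (simp add: emp_D_def r)
  show "Uhat l lb H (p ` J) S \<xi> s = Uhat l lb H J (\<lambda>j. S (p j)) (\<lambda>j. \<xi> (p j)) s"
    unfolding Uhat_def 1 2 by (simp add: r)
qed

lemma emp_cong:
  assumes "\<And>j. j \<in> J \<Longrightarrow> S j = S' j"
  shows "emp_risk l J S = emp_risk l J S'" "emp_D l H J S = emp_D l H J S'"
    and "(\<And>j. j \<in> J \<Longrightarrow> \<xi> j = \<xi>' j) \<Longrightarrow> emp_phi l H J S \<xi> = emp_phi l H J S' \<xi>'"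
    and "(\<And>j. j \<in> J \<Longrightarrow> \<xi> j = \<xi>' j) \<Longrightarrow> Uhat l lb H J S \<xi> s = Uhat l lb H J S' \<xi>' s"
proof -
  show "emp_risk l J S = emp_risk l J S'"
    using assms by (simp add: emp_risk_def fun_eq_iff cong: sum.cong)
  show 2: "emp_D l H J S = emp_D l H J S'"
    using assms by (simp add: emp_D_def cong: sum.cong)
  show 3: "emp_phi l H J S \<xi> = emp_phi l H J S' \<xi>'" if "\<And>j. j \<in> J \<Longrightarrow> \<xi> j = \<xi>' j"
    using assms that by (simp add: emp_phi_def cong: sum.cong)
  show "Uhat l lb H J S \<xi> s = Uhat l lb H J S' \<xi>' s" if "\<And>j. j \<in> J \<Longrightarrow> \<xi> j = \<xi>' j"
    using 3[OF that] by (simp add: Uhat_def 2)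
qed

lemma conc_event_reindex:
  assumes "inj_on p J"
  shows "conc_event l lb K1 K2 K3 K H hs P s (p ` J) S \<xi>
    \<longleftrightarrow> conc_event l lb K1 K2 K3 K H hs P s J (\<lambda>j. S (p j)) (\<lambda>j. \<xi> (p j))"
  by (simp add: conc_event_def emp_reindex[OF assms] card_image[OF assms])

lemma conc_event_cong:
  assumes "\<And>j. j \<in> J \<Longrightarrow> S j = S' j" "\<And>j. j \<in> J \<Longrightarrow> \<xi> j = \<xi>' j"
  shows "conc_event l lb K1 K2 K3 K H hs P s J S \<xi> \<longleftrightarrow> conc_event l lb K1 K2 K3 K H hs P s J S' \<xi>'"
  using emp_cong(1)[of J S S' l] emp_cong(4)[of J S S' \<xi> \<xi>' l lb H s] assms by (simp add: conc_event_def)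

lemma SUP_ereal_mult_left_real:
  assumes "0 < c"
  shows "(SUP i\<in>I. ereal c * F i) = ereal c * (SUP i\<in>I. F i)"
proof (rule antisym)
  show "(SUP i\<in>I. ereal c * F i) \<le> ereal c * (SUP i\<in>I. F i)"
    using assms by (intro SUP_least ereal_mult_left_mono SUP_upper) auto
  have "F i \<le> (SUP i\<in>I. ereal c * F i) / ereal c" if "i \<in> I" for i
    using assms that by (subst ereal_le_divide_pos) (auto intro: SUP_upper)
  then have "(SUP i\<in>I. F i) \<le> (SUP i\<in>I. ereal c * F i) / ereal c"
    by (intro SUP_least)
  then show "ereal c * (SUP i\<in>I. F i) \<le> (SUP i\<in>I. ereal c * F i)"
    using assms by (subst (asm) ereal_le_divide_pos) auto
qed

lemma esqrt_nonneg: "0 \<le> x \<Longrightarrow> 0 \<le> esqrt x"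
  by (cases x) (auto simp: esqrt_def)

lemma esqrt_mult_left:
  assumes "0 < c" "0 \<le> x"
  shows "esqrt (ereal c * x) = ereal (sqrt c) * esqrt x"
  using assms by (cases x) (auto simp: esqrt_def real_sqrt_mult)

text \<open>Isolates \<open>x\<close>, so that for an infimum \<open>x\<close> the inequality
  becomes one for each member by \<open>le_INF_iff\<close>.\<close>

lemma ereal_diff_le_iff: "ereal a - x \<le> ereal u \<longleftrightarrow> ereal (a - u) \<le> x"
  by (cases x) auto

lemma emp_phi_nonneg:
  assumes "f \<in> H" "\<And>k. k \<in> I \<Longrightarrow> loss l f (S k) = ereal (r k)"
  shows "0 \<le> emp_phi l H I S \<xi>"
proof -
  have "(\<Sum>k\<in>I. ereal (\<xi> k) * (loss l f (S k) - loss l f (S k))) / ereal (real (card I)) = 0"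
    using assms(2) by (cases "card I = 0") (auto simp: sum.neutral)
  then show ?thesis unfolding emp_phi_def using assms(1) by (intro SUP_upper2[OF assms(1)]) auto
qed

lemma emp_D_nonneg:
  assumes "f \<in> H" "\<And>k. k \<in> I \<Longrightarrow> loss l f (S k) = ereal (r k)"
  shows "0 \<le> emp_D l H I S"
proof -
  have "(\<Sum>k\<in>I. (loss l f (S k) - loss l f (S k))\<^sup>2) / ereal (real (card I)) = 0"
    using assms(2) by (cases "card I = 0") (auto simp: power2_eq_square)
  then show ?thesis unfolding emp_D_def
    by (intro esqrt_nonneg SUP_upper2[OF assms(1)]) auto
qed

text \<open>Outside \<open>D\<close> all patched functions agree, so differences of empirical risks over \<open>I\<close> are those
  over \<open>J\<close>, up to the factor \<open>card J / card I\<close> from normalization.\<close>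

locale patched_block =
  fixes l :: "ereal \<Rightarrow> ennreal" and V :: "('a \<Rightarrow> ereal) set" and f :: "'a \<Rightarrow> ereal"
    and D :: "'a set" and I J :: "'i set" and S :: "'i \<Rightarrow> 'a \<times> real"
    and r :: "('a \<Rightarrow> ereal) \<Rightarrow> 'i \<Rightarrow> real"
  assumes f: "f \<in> V" and I: "finite I" and J: "J \<noteq> {}" "J = {k \<in> I. fst (S k) \<in> D}"
    and fin: "\<And>h k. h \<in> V \<Longrightarrow> k \<in> I \<Longrightarrow> loss l h (S k) = ereal (r h k)"
begin

lemma card_pos: "0 < card J" "0 < card I"
  using I J by (auto simp: card_gt_0_iff)

definition "q = real (card J) / real (card I)"

lemma q_pos: "0 < q"
  using card_pos by (simp add: q_def)

lemma loss_patch: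
  assumes "h \<in> V" "k \<in> I"
  shows "loss l (patch D f h) (S k) = ereal (if k \<in> J then r h k else r f k)"
  using fin[OF assms] fin[OF f assms(2)] assms J(2) by (auto simp: loss_def patch_def)

lemma emp_risk_sub: "h \<in> V \<Longrightarrow> emp_risk l J S h = ereal ((\<Sum>k\<in>J. r h k) / card J)"
proof -
  assume h: "h \<in> V"
  have "(\<Sum>k\<in>J. loss l h (S k)) = ereal (\<Sum>k\<in>J. r h k)"
    unfolding sum_ereal[symmetric] using fin[OF h] J(2) by (intro sum.cong) auto
  then show ?thesis using card_pos J(1) by (simp add: emp_risk_def)
qed

lemma emp_risk_patch:
  assumes "h \<in> V"
  shows "emp_risk l I S (patch D f h) = ereal (q * ((\<Sum>k\<in>J. r h k) / card J) + (\<Sum>k\<in>I - J. r f k) / card I)"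
proof -
  have "(\<Sum>k\<in>I. loss l (patch D f h) (S k)) = ereal (\<Sum>k\<in>I. if k \<in> J then r h k else r f k)"
    using loss_patch[OF assms] by simp
  also have "(\<Sum>k\<in>I. if k \<in> J then r h k else r f k) = (\<Sum>k\<in>J. r h k) + (\<Sum>k\<in>I - J. r f k)"
    using I J(2) by (subst sum.If_cases) (auto simp: Int_absorb1 intro!: arg_cong2[where f = "(+)"] sum.cong)
  finally show ?thesis using card_pos I by (auto simp: emp_risk_def q_def field_simps)
qed

lemma emp_phi_patch: "emp_phi l (patch_set V D f) I S \<xi> = ereal q * emp_phi l V J S \<xi>"
proof -
  have "(\<Sum>k\<in>I. ereal (\<xi> k) * (loss l (patch D f h) (S k) - loss l (patch D f g) (S k))) / ereal (real (card I))
     = ereal q * ((\<Sum>k\<in>J. ereal (\<xi> k) * (loss l h (S k) - loss l g (S k))) / ereal (real (card J)))"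
    if h: "h \<in> V" and g: "g \<in> V" for h g
  proof -
    have "(\<Sum>k\<in>I. ereal (\<xi> k) * (loss l (patch D f h) (S k) - loss l (patch D f g) (S k)))
        = ereal (\<Sum>k\<in>I. if k \<in> J then \<xi> k * (r h k - r g k) else 0)"
      unfolding sum_ereal[symmetric] using loss_patch[OF h] loss_patch[OF g] by (intro sum.cong) auto
    also have "(\<Sum>k\<in>I. if k \<in> J then \<xi> k * (r h k - r g k) else 0) = (\<Sum>k\<in>J. \<xi> k * (r h k - r g k))"
      using I J(2) by (subst sum.inter_restrict[symmetric]) (auto intro!: sum.cong)
    also have "ereal \<dots> = (\<Sum>k\<in>J. ereal (\<xi> k) * (loss l h (S k) - loss l g (S k)))"
      unfolding sum_ereal[symmetric] using fin[OF h] fin[OF g] J(2) by (intro sum.cong) auto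
    finally have eq: "(\<Sum>k\<in>I. ereal (\<xi> k) * (loss l (patch D f h) (S k) - loss l (patch D f g) (S k)))
      = (\<Sum>k\<in>J. ereal (\<xi> k) * (loss l h (S k) - loss l g (S k)))" .
    have eq2: "(\<Sum>k\<in>J. ereal (\<xi> k) * (loss l h (S k) - loss l g (S k))) = ereal (\<Sum>k\<in>J. \<xi> k * (r h k - r g k))"
      unfolding sum_ereal[symmetric] using fin[OF h] fin[OF g] J(2) by (intro sum.cong) auto
    show ?thesis unfolding eq unfolding eq2 using card_pos by (simp add: q_def)
  qed
  then have "emp_phi l (patch_set V D f) I S \<xi> = (SUP h\<in>V. SUP g\<in>V.
      ereal q * ((\<Sum>k\<in>J. ereal (\<xi> k) * (loss l h (S k) - loss l g (S k))) / ereal (real (card J))))"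
    unfolding emp_phi_def patch_set_def by (simp add: image_image)
  then show ?thesis
    unfolding emp_phi_def SUP_ereal_mult_left_real[OF q_pos] .
qed

lemma emp_D_patch: "emp_D l (patch_set V D f) I S = ereal (sqrt q) * emp_D l V J S"
proof -
  let ?F = "\<lambda>h g. (\<Sum>k\<in>J. (loss l h (S k) - loss l g (S k))\<^sup>2) / ereal (real (card J))"
  have "(\<Sum>k\<in>I. (loss l (patch D f h) (S k) - loss l (patch D f g) (S k))\<^sup>2) / ereal (real (card I))
     = ereal q * ?F h g"
    if h: "h \<in> V" and g: "g \<in> V" for h g
  proof -
    have eq2: "(\<Sum>k\<in>J. (loss l h (S k) - loss l g (S k))\<^sup>2) = ereal (\<Sum>k\<in>J. (r h k - r g k)\<^sup>2)"
      unfolding sum_ereal[symmetric] using fin[OF h] fin[OF g] J(2) by (intro sum.cong) auto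
    have "(\<Sum>k\<in>I. (loss l (patch D f h) (S k) - loss l (patch D f g) (S k))\<^sup>2)
        = ereal (\<Sum>k\<in>I. if k \<in> J then (r h k - r g k)\<^sup>2 else 0)"
      unfolding sum_ereal[symmetric] using loss_patch[OF h] loss_patch[OF g] by (intro sum.cong) auto
    also have "(\<Sum>k\<in>I. if k \<in> J then (r h k - r g k)\<^sup>2 else 0) = (\<Sum>k\<in>J. (r h k - r g k)\<^sup>2)"
      using I J(2) by (subst sum.inter_restrict[symmetric]) (auto intro!: sum.cong)
    finally have eq: "(\<Sum>k\<in>I. (loss l (patch D f h) (S k) - loss l (patch D f g) (S k))\<^sup>2)
      = (\<Sum>k\<in>J. (loss l h (S k) - loss l g (S k))\<^sup>2)" unfolding eq2 .
    show ?thesis unfolding eq unfolding eq2 using card_pos by (simp add: q_def)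
  qed
  then have "emp_D l (patch_set V D f) I S = esqrt (SUP h\<in>V. SUP g\<in>V. ereal q * ?F h g)"
    unfolding emp_D_def patch_set_def by (simp add: image_image)
  also have "\<dots> = esqrt (ereal q * (SUP h\<in>V. SUP g\<in>V. ?F h g))"
    unfolding SUP_ereal_mult_left_real[OF q_pos] ..
  also have "\<dots> = ereal (sqrt q) * emp_D l V J S"
  proof -
    have "?F f f = 0" using fin[OF f] J(2) card_pos by (auto simp: power2_eq_square)
    then have "0 \<le> (SUP h\<in>V. SUP g\<in>V. ?F h g)" using f by (intro SUP_upper2[OF f]) auto
    then show ?thesis unfolding emp_D_def by (intro esqrt_mult_left q_pos)
  qed
  finally show ?thesis .
qed

text \<open>\<open>emp_phi\<close> scales by \<open>q\<close> and \<open>emp_D\<close> by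
  \<open>sqrt q\<close>; the missing \<open>sqrt q\<close> comes from replacing
  \<open>card J\<close> by \<open>card I\<close> under the root, and the last term scales by
  \<open>q\<close> for the same reason. Hence normalizing by the number of requested labels loses
  nothing against the whole block.\<close>

lemma Uhat_patch:
  assumes s: "0 < s"
  shows "Uhat l lb (patch_set V D f) I S \<xi> s = ereal q * Uhat l lb V J S \<xi> s"
proof -
  have \<Phi>: "0 \<le> emp_phi l V J S \<xi>" and \<Delta>: "0 \<le> emp_D l V J S"
    using fin[OF f] J(2) by (auto intro!: emp_phi_nonneg[OF f] emp_D_nonneg[OF f])
  have ne: "I \<noteq> {}" using card_pos by auto
  let ?a = "sqrt (s / real (card J))"
  have "sqrt q * sqrt (s / real (card I)) = q * ?a"
  proof -
    have "s / real (card I) = q * (s / real (card J))" using card_pos by (simp add: q_def)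
    then have "sqrt (s / real (card I)) = sqrt q * ?a" by (simp only: real_sqrt_mult)
    then have "sqrt q * sqrt (s / real (card I)) = (sqrt q * sqrt q) * ?a" by (simp only: mult.assoc)
    then show ?thesis using q_pos by simp
  qed
  then have D: "34 * (ereal (sqrt q) * emp_D l V J S) * ereal (sqrt (s / real (card I)))
      = ereal q * (34 * emp_D l V J S * ereal ?a)"
  proof (cases "emp_D l V J S")
    case (real d)
    have "34 * (sqrt q * d) * sqrt (s / real (card I)) = 34 * d * (sqrt q * sqrt (s / real (card I)))"
      by (simp only: mult_ac)
    also have "\<dots> = q * (34 * d * ?a)"
      unfolding \<open>sqrt q * sqrt (s / real (card I)) = q * ?a\<close> by (simp only: mult_ac)
    finally show ?thesis unfolding real by simp
  qed (use q_pos s card_pos \<Delta> in auto)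
  have K: "752 * lb * s / real (card I) = q * (752 * lb * s / real (card J))"
    using card_pos by (simp add: q_def)
  have "ereal q * (x + y + ereal z) = ereal q * x + ereal q * y + ereal (q * z)"
    if "0 \<le> x" "0 \<le> y" for x y z
    using that q_pos by (cases x; cases y) (auto simp: algebra_simps)
  moreover have "12 * (ereal q * emp_phi l V J S \<xi>) = ereal q * (12 * emp_phi l V J S \<xi>)"
    by (simp only: mult_ac)
  ultimately show ?thesis
    unfolding Uhat_def emp_phi_patch emp_D_patch D K using J(1) ne s \<Phi> \<Delta> by simp
qed

lemma emp_excess_patch_le_iff:
  assumes s: "0 < s" and h: "h \<in> V"
  shows "emp_risk l I S (patch D f h) - (INF g\<in>patch_set V D f. emp_risk l I S g)
      \<le> Uhat l lb (patch_set V D f) I S \<xi> s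
    \<longleftrightarrow> emp_risk l J S h - (INF g\<in>V. emp_risk l J S g) \<le> Uhat l lb V J S \<xi> s"
proof -
  have \<Phi>: "0 \<le> emp_phi l V J S \<xi>" and \<Delta>: "0 \<le> emp_D l V J S"
    using fin[OF f] J(2) by (auto intro!: emp_phi_nonneg[OF f] emp_D_nonneg[OF f])
  show ?thesis
  proof (cases "Uhat l lb V J S \<xi> s")
    case (real u)
    \<comment> \<open>\<open>C\<close> stands for the contribution of \<open>I - J\<close>, the same
      for all patched functions, which cancels.\<close>
    have "q * x + C - q * u \<le> q * y + C \<longleftrightarrow> x - u \<le> y" for x y C
      using mult_le_cancel_left_pos[OF q_pos, of "x - u" y] by (simp add: algebra_simps)
    moreover have "(INF g\<in>patch_set V D f. emp_risk l I S g)
      = (INF g\<in>V. ereal (q * ((\<Sum>k\<in>J. r g k) / card J) + (\<Sum>k\<in>I - J. r f k) / card I))"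
      unfolding patch_set_def image_image by (intro INF_cong refl emp_risk_patch)
    moreover have "(INF g\<in>V. emp_risk l J S g) = (INF g\<in>V. ereal ((\<Sum>k\<in>J. r g k) / card J))"
      by (intro INF_cong refl emp_risk_sub)
    ultimately show ?thesis
      unfolding Uhat_patch[OF s] real emp_risk_patch[OF h] emp_risk_sub[OF h] times_ereal.simps
      by (simp only: ereal_diff_le_iff le_INF_iff ereal_less_eq)
  next
    case PInf
    then show ?thesis unfolding Uhat_patch[OF s] using q_pos by simp
  next
    \<comment> \<open>Impossible: \<open>Uhat\<close> is a sum of two nonnegative terms and a real
      number.\<close>
    case MInf
    then show ?thesis using \<Phi> \<Delta> J(1) s
      unfolding Uhat_def by (cases "emp_phi l V J S \<xi>"; cases "emp_D l V J S") (auto split: if_splits)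
  qed
qed

end

section \<open>Runs of the algorithm\<close>

text \<open>The algorithm starts with \<open>m = 1\<close> and never uses the first data point, so its state at \<open>m\<close> is
  reached after \<open>m - 1\<close> steps.\<close>

definition alg_state ::
  "'a measure \<Rightarrow> real \<Rightarrow> ('a \<Rightarrow> ereal) set \<Rightarrow> (ereal \<Rightarrow> ennreal) \<Rightarrow> (nat \<Rightarrow> real)
   \<Rightarrow> (nat \<Rightarrow> 'a \<times> real) \<Rightarrow> (nat \<Rightarrow> real) \<Rightarrow> nat \<Rightarrow> 'a state" where
  "alg_state MX c F l sh d \<xi> m = (alg_step MX c l (lbar MX F l) sh d \<xi> ^^ (m - 1)) (F, {}, 1, 0)"

context
  fixes MX :: "'a measure" and c :: real and F :: "('a \<Rightarrow> ereal) set" and l :: "ereal \<Rightarrow> ennreal"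
    and sh :: "nat \<Rightarrow> real" and d :: "nat \<Rightarrow> 'a \<times> real" and \<xi> :: "nat \<Rightarrow> real"
begin

private abbreviation "state \<equiv> alg_state MX c F l sh d \<xi>"
private abbreviation "VS m \<equiv> fst (state m)"
private abbreviation "QS m \<equiv> fst (snd (state m))"
private abbreviation "TS m \<equiv> snd (snd (snd (state m)))"
private abbreviation "hit m \<equiv> fst (d (Suc m)) \<in> DIS MX c (VS m)"
private abbreviation "Qnext m \<equiv> (if hit m then insert (Suc m, snd (d (Suc m))) (QS m) else QS m)"

lemma alg_state_1 [simp]: "state (Suc 0) = (F, {}, 1, 0)"
  by (simp add: alg_state_def)

lemma alg_state_Suc:
  assumes "1 \<le> m"
  shows "state (Suc m) = alg_step MX c l (lbar MX F l) sh d \<xi> (state m)"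
proof -
  have "Suc m - 1 = Suc (m - 1)" using assms by simp
  then show ?thesis unfolding alg_state_def by (simp only: funpow.simps comp_apply)
qed

lemma alg_state_index: "1 \<le> m \<Longrightarrow> fst (snd (snd (state m))) = m"
proof (induction m rule: dec_induct)
  case (step m)
  then show ?case unfolding alg_state_Suc[OF step(1)]
    by (cases "state m") (auto simp: alg_step_def Let_def split: if_splits)
qed simp

lemma alg_state_Suc_eq:
  assumes "1 \<le> m"
  shows "VS (Suc m) = (if log2_pos_int (Suc m)
      then {h \<in> VS m. emp_risk l (Qnext m) (sample_of d) h - (INF g\<in>VS m. emp_risk l (Qnext m) (sample_of d) g)
                       \<le> That l (lbar MX F l) sh d \<xi> (VS m) (Qnext m) (Suc m)} else VS m)"
    and "QS (Suc m) = (if log2_pos_int (Suc m) then {} else Qnext m)"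
    and "TS (Suc m) = TS m + (if hit m then 1 else 0)"
  using alg_state_index[OF assms] unfolding alg_state_Suc[OF assms]
  by (cases "state m"; auto simp: alg_step_def Let_def)+

lemma VS_antimono:
  assumes "1 \<le> m" "m \<le> m'"
  shows "VS m' \<subseteq> VS m"
  using assms(2)
proof (induction m' rule: dec_induct)
  case (step k)
  then show ?case using alg_state_Suc_eq(1)[of k] assms(1) by (auto split: if_splits)
qed simp

lemma TS_mono:
  assumes "1 \<le> m" "m \<le> m'"
  shows "TS m \<le> TS m'"
  using assms(2)
proof (induction m' rule: dec_induct)
  case (step k)
  then show ?case using alg_state_Suc_eq(3)[of k] assms(1) by auto
qed simp

text \<open>Backward induction from the stopping index: at \<open>M\<close> the guard fails, and at
  smaller indices \<open>while_unfold\<close> performs one step, so termination needs no separate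
  argument.\<close>

lemma alg_run_eqI:
  assumes "1 \<le> M" "\<And>j. 1 \<le> j \<Longrightarrow> j < M \<Longrightarrow> j < u \<and> TS j < n" "\<not> (M < u \<and> TS M < n)"
  shows "alg_run MX c F l sh u n d \<xi> = state M"
proof -
  let ?b = "\<lambda>(V, Q, m, t). m < u \<and> t < n" and ?c = "alg_step MX c l (lbar MX F l) sh d \<xi>"
  have b: "?b (state j) \<longleftrightarrow> j < u \<and> TS j < n" if "1 \<le> j" for j
    using alg_state_index[OF that] by (auto simp: case_prod_unfold)
  have "while ?b ?c (state j) = state M" if "1 \<le> j" "j \<le> M" for j
    using that(2,1)
  proof (induction j rule: inc_induct)
    case base
    then show ?case using b[of M] assms(3) by (subst while_unfold) simp
  next
    case (step j)
    then show ?case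
      using b[of j] assms(2)[of j] alg_state_Suc[of j] by (subst while_unfold) simp
  qed
  from this[of 1] show ?thesis using assms(1) by (simp add: alg_run_def)
qed

lemma alg_run_cases:
  assumes "1 \<le> u"
  obtains M where "1 \<le> M" "M \<le> u" "alg_run MX c F l sh u n d \<xi> = state M"
    "\<And>j. 1 \<le> j \<Longrightarrow> j < M \<Longrightarrow> j < u \<and> TS j < n" "\<not> (M < u \<and> TS M < n)"
proof -
  let ?P = "\<lambda>m. 1 \<le> m \<and> \<not> (m < u \<and> TS m < n)"
  define M where "M = (LEAST m. ?P m)"
  have "?P M" unfolding M_def by (rule LeastI[of ?P u]) (use assms in auto)
  moreover have min: "j < u \<and> TS j < n" if "1 \<le> j" "j < M" for j
    using not_less_Least[of j ?P] that by (auto simp: M_def)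
  moreover have "M \<le> u" unfolding M_def by (rule Least_le) (use assms in auto)
  ultimately show thesis using alg_run_eqI[of M u n] that by blast
qed

lemma alg_run_full:
  assumes "1 \<le> u" "\<And>j. 1 \<le> j \<Longrightarrow> j < u \<Longrightarrow> TS j < n"
  shows "alg_run MX c F l sh u n d \<xi> = state u"
  using assms by (intro alg_run_eqI) auto

lemma alg_budgets:
  assumes "1 \<le> u"
  shows "alg_unlabeled MX c F l sh u n d \<xi> \<le> u" "alg_requests MX c F l sh u n d \<xi> \<le> n"
proof -
  obtain M where M: "1 \<le> M" "M \<le> u" "alg_run MX c F l sh u n d \<xi> = state M"
    "\<And>j. 1 \<le> j \<Longrightarrow> j < M \<Longrightarrow> j < u \<and> TS j < n"
    using alg_run_cases[OF assms, of n] by metis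
  show "alg_unlabeled MX c F l sh u n d \<xi> \<le> u"
    using M alg_state_index[OF M(1)] by (simp add: alg_unlabeled_def)
  \<comment> \<open>The guard held one step earlier, and a step adds at most one request.\<close>
  have "TS M \<le> n"
  proof (cases "M = 1")
    case False
    then obtain k where k: "M = Suc k" "1 \<le> k" using M(1) by (cases M) auto
    then show ?thesis using M(4)[of k] alg_state_Suc_eq(3)[of k] by auto
  qed simp
  then show "alg_requests MX c F l sh u n d \<xi> \<le> n" by (simp add: alg_requests_def M(3))
qed

lemma log2_pos_int_between:
  assumes "2 ^ i < m" "m < 2 ^ Suc i"
  shows "\<not> log2_pos_int m"
proof
  assume "log2_pos_int m"
  then obtain k where "m = 2 ^ k" by (auto simp: log2_pos_int_def)
  then show False using assms power_less_imp_less_exp[of "2::nat" i k]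
      power_less_imp_less_exp[of "2::nat" k "Suc i"] by auto
qed

text \<open>Filtering happens only at powers of two, so within a block the version space is frozen
  and the requests accumulate. At the left end the buffer is empty: for \<open>i \<ge> 1\<close> the
  filter has just cleared it, for \<open>i = 0\<close> the run has just started.\<close>

lemma state_in_block:
  assumes "2 ^ i \<le> m" "m < 2 ^ Suc i"
  shows "VS m = VS (2 ^ i)"
    and "QS m = (\<lambda>k. (k, snd (d k))) ` {k \<in> {2 ^ i + 1..m}. fst (d k) \<in> DIS MX c (VS (2 ^ i))}"
  using assms
proof (induction m rule: dec_induct)
  case base
  case 2
  show ?case
  proof (cases i)
    case (Suc j)
    then obtain p :: nat where p: "2 ^ i = 2 * p" by simp
    moreover have "2 ^ i \<noteq> (0 :: nat)" by simp
    ultimately obtain k where "2 ^ i = Suc k" "1 \<le> k"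
      by (metis One_nat_def Suc_leI double_not_eq_Suc_double mult_0_right neq0_conv not0_implies_Suc)
    moreover have "log2_pos_int (2 ^ i)" using Suc by (auto simp: log2_pos_int_def)
    ultimately show ?thesis using alg_state_Suc_eq(2)[of k] by simp
  qed simp
next
  case (step m)
  have m: "1 \<le> m" using step(1) one_le_power[of "2::nat" i] by linarith
  {
    case 1
    then show ?case
      using step log2_pos_int_between[of i "Suc m"] alg_state_Suc_eq(1)[OF m] by simp
  next
    case 2
    have V: "VS m = VS (2 ^ i)" using step 2 by simp
    have "{2 ^ i + 1..Suc m} = insert (Suc m) {2 ^ i + 1..m}" using step(1) by auto
    then show ?case
      using 2 step log2_pos_int_between[of i "Suc m"] alg_state_Suc_eq(2)[OF m] V by auto
  }
qed auto

text \<open>The stored pairs correspond injectively to the requested indices \<open>J\<close>, and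
  the stored labels are those of \<open>d\<close>, so the filter can be written over
  \<open>J\<close> with the original data.\<close>

lemma VS_block_end:
  assumes "a = 2 ^ i"
  defines "J \<equiv> {k \<in> {a + 1..2 * a}. fst (d k) \<in> DIS MX c (VS a)}"
  shows "VS (2 * a) = {h \<in> VS a. emp_risk l J d h - (INF g\<in>VS a. emp_risk l J d g)
      \<le> Uhat l (lbar MX F l) (VS a) J d \<xi> (sh (2 * a))}"
proof -
  let ?p = "\<lambda>k. (k, snd (d k))"
  obtain m where m: "2 * a = Suc m" "1 \<le> m" "a \<le> m"
    using assms(1) one_le_power[of "2::nat" i] by (cases "2 * a") auto
  have V: "VS m = VS a"
    using state_in_block(1)[of i m] m assms(1) by simp
  have Q: "Qnext m = ?p ` J"
  proof -
    have *: "{a + 1..2 * a} = insert (Suc m) {a + 1..m}" using m by auto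
    have "QS m = ?p ` {k \<in> {a + 1..m}. fst (d k) \<in> DIS MX c (VS a)}"
      using state_in_block(2)[of i m] m assms(1) by simp
    then show ?thesis unfolding J_def * V by auto
  qed
  have inj: "inj_on ?p J" by (auto simp: inj_on_def)
  have S: "(\<lambda>j. sample_of d (?p j)) = d" by (simp add: sample_of_def)
  have "log2_pos_int (Suc m)" unfolding m(1)[symmetric] log2_pos_int_def assms(1)
    by (intro exI[of _ "Suc i"]) simp
  then show ?thesis
    unfolding m(1) alg_state_Suc_eq(1)[OF m(2)] unfolding Q
    unfolding That_def emp_reindex[OF inj] V S by simp
qed

end

text \<open>The bound on the indices stored in the buffer is carried along because the filter reads
  data and signs at exactly these indices.\<close>

lemma alg_state_cong:
  assumes "1 \<le> m" "\<And>k. k \<in> {1..m} \<Longrightarrow> d k = d' k" "\<And>k. k \<in> {1..m} \<Longrightarrow> \<xi> k = \<xi>' k"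
  shows "alg_state MX c F l sh d \<xi> m = alg_state MX c F l sh d' \<xi>' m
    \<and> fst ` fst (snd (alg_state MX c F l sh d \<xi> m)) \<subseteq> {1..m}"
  using assms
proof (induction m rule: dec_induct)
  case (step m)
  then have IH: "alg_state MX c F l sh d \<xi> m = alg_state MX c F l sh d' \<xi>' m"
    "fst ` fst (snd (alg_state MX c F l sh d \<xi> m)) \<subseteq> {1..m}"
    using step.IH by (simp_all add: step.prems)
  obtain V Q t where st: "alg_state MX c F l sh d \<xi> m = (V, Q, m, t)"
    using alg_state_index[OF step(1), of MX c F l sh d \<xi>] by (metis prod.collapse)
  have Q: "fst p \<in> {1..m}" if "p \<in> Q" for p using IH(2) that st by auto
  have dm: "d (Suc m) = d' (Suc m)" using step by simp
  define Q' where "Q' = (if fst (d (Suc m)) \<in> DIS MX c V then insert (Suc m, snd (d (Suc m))) Q else Q)"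
  have Q': "fst p \<in> {1..Suc m}" if "p \<in> Q'" for p
    using that Q[of p] by (auto simp: Q'_def split: if_splits)
  have S: "sample_of d p = sample_of d' p" "\<xi> (fst p) = \<xi>' (fst p)" if "p \<in> Q'" for p
    using Q'[OF that] step by (auto simp: sample_of_def)
  have "emp_risk l Q' (sample_of d) = emp_risk l Q' (sample_of d')"
    by (rule emp_cong) (rule S)
  moreover have "That l lb sh d \<xi> V Q' k = That l lb sh d' \<xi>' V Q' k" for lb k
    unfolding That_def by (intro emp_cong(4) S)
  moreover have "fst ` Q' \<subseteq> {1..Suc m}" using Q' by blast
  moreover define t' where "t' = (if fst (d (Suc m)) \<in> DIS MX c V then t + 1 else t)"
  moreover have "alg_step MX c l (lbar MX F l) sh d \<xi> (V, Q, m, t) = (if log2_pos_int (Suc m)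
      then ({h \<in> V. emp_risk l Q' (sample_of d) h - (INF g\<in>V. emp_risk l Q' (sample_of d) g)
               \<le> That l (lbar MX F l) sh d \<xi> V Q' (Suc m)}, {}, Suc m, t') else (V, Q', Suc m, t'))"
    by (auto simp: alg_step_def Let_def Q'_def t'_def)
  moreover have "alg_step MX c l (lbar MX F l) sh d' \<xi>' (V, Q, m, t) = (if log2_pos_int (Suc m)
      then ({h \<in> V. emp_risk l Q' (sample_of d') h - (INF g\<in>V. emp_risk l Q' (sample_of d') g)
               \<le> That l (lbar MX F l) sh d' \<xi>' V Q' (Suc m)}, {}, Suc m, t') else (V, Q', Suc m, t'))"
    by (auto simp: alg_step_def Let_def Q'_def t'_def dm)
  ultimately show ?case
    unfolding alg_state_Suc[OF step(1)] IH(1)[symmetric] st by simp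
qed simp

text \<open>Both runs stop at the same index. This is what conditioning rests on: changing the data
  after the first \<open>u\<close> points, in particular in the next block, leaves the class
  unchanged.\<close>

lemma alg_V_cong:
  assumes "1 \<le> u" "\<And>k. k \<in> {1..u} \<Longrightarrow> d k = d' k" "\<And>k. k \<in> {1..u} \<Longrightarrow> \<xi> k = \<xi>' k"
  shows "alg_V MX c F l sh u n d \<xi> = alg_V MX c F l sh u n d' \<xi>'"
proof -
  obtain M where M: "1 \<le> M" "M \<le> u" "alg_run MX c F l sh u n d \<xi> = alg_state MX c F l sh d \<xi> M"
    "\<And>j. 1 \<le> j \<Longrightarrow> j < M \<Longrightarrow> j < u \<and> snd (snd (snd (alg_state MX c F l sh d \<xi> j))) < n"
    "\<not> (M < u \<and> snd (snd (snd (alg_state MX c F l sh d \<xi> M))) < n)"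
    using alg_run_cases[OF assms(1)] by metis
  have eq: "alg_state MX c F l sh d \<xi> j = alg_state MX c F l sh d' \<xi>' j" if "1 \<le> j" "j \<le> M" for j
    using that M(2) assms(2,3) by (intro alg_state_cong[THEN conjunct1]) auto
  have "alg_run MX c F l sh u n d' \<xi>' = alg_state MX c F l sh d' \<xi>' M"
    using M(1,4,5) eq by (intro alg_run_eqI) auto
  then show ?thesis using M(3) eq[OF M(1)] by (simp add: alg_V_def)
qed

section \<open>The filter on the concentration event\<close>

lemma Dset_nonneg:
  assumes "f \<in> H"
  shows "0 \<le> Dset l P H"
  unfolding Dset_def Dfun_def by (intro SUP_upper2[OF assms] esqrt_nonneg) simp

lemma phi_nonneg: "0 \<le> phi l H m P"
  by (simp add: phi_def)

lemma Ubar_nonneg: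
  assumes "0 \<le> K1" "0 \<le> K2" "0 \<le> K3" "0 \<le> lb" "0 \<le> s" "f \<in> H"
  shows "0 \<le> Ubar l lb K1 K2 K3 H P m s"
  unfolding Ubar_def using assms Dset_nonneg[OF assms(6)] phi_nonneg
  by (intro add_nonneg_nonneg ereal_0_le_mult) auto

text \<open>The patched \<open>f\<close> is \<open>f\<close>, with true excess 0, so its empirical
  excess is at most \<open>Ubar\<close>, which is below the threshold \<open>Uhat\<close>; hence it
  survives. A survivor has patched empirical excess at most \<open>Uhat\<close>, hence true excess
  at most \<open>Uhat + Ubar\<close>, and both terms are below \<open>\<gamma>\<close>.\<close>

lemma conc_event_block_update:
  fixes S :: "'i \<Rightarrow> 'a \<times> real"
  assumes conc: "conc_event l lb K1 K2 K3 K (patch_set V D f) f P s I S \<xi>"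
    and f: "f \<in> V" and I: "finite I"
    and fin: "\<And>h k. h \<in> V \<Longrightarrow> k \<in> I \<Longrightarrow> loss l h (S k) = ereal (r h k)"
    and nonneg: "0 \<le> K1" "0 \<le> K2" "0 \<le> K3" "0 \<le> lb" and s: "0 < s"
    and risk: "risk l P f = ereal \<rho>"
  defines "J \<equiv> {k \<in> I. fst (S k) \<in> D}"
  defines "V' \<equiv> {h \<in> V. emp_risk l J S h - (INF g\<in>V. emp_risk l J S g) \<le> Uhat l lb V J S \<xi> s}"
  shows "f \<in> V'"
    and "h \<in> V' \<Longrightarrow> Utilde l lb K (patch_set V D f) P (card I) s \<le> ereal \<gamma>
      \<Longrightarrow> risk l P (patch D f h) - risk l P f < ereal (2 * \<gamma>)"
proof -
  let ?H = "patch_set V D f"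
  let ?R = "emp_risk l I S"
  let ?u = "Uhat l lb ?H I S \<xi> s" and ?b = "Ubar l lb K1 K2 K3 ?H P (card I) s"
  have fH: "f \<in> ?H" using f unfolding patch_set_def by (metis image_eqI patch_self)
  have b0: "0 \<le> ?b" using nonneg s by (intro Ubar_nonneg[OF _ _ _ _ _ fH]) auto
  have bu: "?b < ?u" using conc by (simp add: conc_event_def)
  \<comment> \<open>Finiteness of \<open>risk l P f\<close> makes its difference with itself 0 and
    not \<open>\<infinity>\<close>.\<close>
  have "?R f - (INF g\<in>?H. ?R g) \<le> ?b"
    using conc fH risk unfolding conc_event_def by (metis add_0 ereal_minus(1) diff_self zero_ereal_def)
  then have f_le: "?R f - (INF g\<in>?H. ?R g) \<le> ?u" using bu by (metis order.strict_implies_order order_trans)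
  have *: "f \<in> V' \<and> (h \<in> V' \<longrightarrow> ?R (patch D f h) - (INF g\<in>?H. ?R g) \<le> ?u)" for h
  proof (cases "J = {}")
    \<comment> \<open>Without requests the filter compares 0 with a nonnegative threshold, and all
      patched functions coincide with \<open>f\<close> on the block.\<close>
    case True
    have "loss l (patch D f h) (S k) = loss l f (S k)" if "k \<in> I" for k
      using True that by (auto simp: J_def loss_def patch_def)
    then have "?R (patch D f h) = ?R f" by (simp add: emp_risk_def cong: sum.cong)
    moreover have "f \<in> V'"
    proof -
      have "(INF g\<in>V. 0 :: ereal) = 0" using f by (intro INF_eq_const) auto
      then show ?thesis using f True nonneg s by (auto simp: V'_def emp_risk_def Uhat_def)
    qed
    ultimately show ?thesis using f_le by simp
  next
    case False
    interpret patched_block l V f D I J S r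
      by unfold_locales (use f I False fin J_def in auto)
    show ?thesis
      using emp_excess_patch_le_iff[OF s f, of lb \<xi>] emp_excess_patch_le_iff[OF s, of h lb \<xi>] f f_le
      by (auto simp: V'_def)
  qed
  then show "f \<in> V'" by blast
  show "risk l P (patch D f h) - risk l P f < ereal (2 * \<gamma>)"
    if h: "h \<in> V'" and \<gamma>: "Utilde l lb K ?H P (card I) s \<le> ereal \<gamma>"
  proof -
    have "?u < ereal \<gamma>" using conc \<gamma> unfolding conc_event_def by (meson less_le_trans)
    then obtain u b where ub: "?u = ereal u" "?b = ereal b" "b < u" "u < \<gamma>"
      using b0 bu by (cases ?u; cases ?b) auto
    have "h \<in> V" using h by (simp add: V'_def)
    then have "risk l P (patch D f h) - risk l P f \<le> ?R (patch D f h) - ?R f + ?b"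
      using conc by (auto simp: conc_event_def patch_set_def)
    also have "?R (patch D f h) - ?R f \<le> ?R (patch D f h) - (INF g\<in>?H. ?R g)"
      using fH by (intro ereal_minus_mono INF_lower) auto
    also have "\<dots> \<le> ?u" using * h by blast
    also have "?u + ?b < ereal (2 * \<gamma>)" using ub by simp
    finally show ?thesis by (simp add: add_right_mono)
  qed
qed

section \<open>Conditional concentration and label requests\<close>

text \<open>The fresh block is numbered from 1, as in \<open>conc_space\<close>, hence the shift by
  \<open>a\<close>; restriction to \<open>{1..}\<close> keeps the sequence in the product
  space.\<close>

definition resample :: "nat \<Rightarrow> nat \<Rightarrow> (nat \<Rightarrow> 'a) \<Rightarrow> (nat \<Rightarrow> 'a) \<Rightarrow> nat \<Rightarrow> 'a" where
  "resample a m x x' = (\<lambda>k\<in>{1..}. if k \<in> {a + 1..a + m} then x' (k - a) else x k)"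

lemma measurable_resample [measurable]:
  "(\<lambda>z. resample a m (fst z) (snd z)) \<in> (PiM {1..} (\<lambda>_. M) \<Otimes>\<^sub>M PiM {1..m} (\<lambda>_. M)) \<rightarrow>\<^sub>M PiM {1..} (\<lambda>_. M)"
  unfolding resample_def
proof (rule measurable_restrict)
  fix k :: nat assume k: "k \<in> {1..}"
  show "(\<lambda>z. if k \<in> {a + 1..a + m} then snd z (k - a) else fst z k)
    \<in> (PiM {1..} (\<lambda>_. M) \<Otimes>\<^sub>M PiM {1..m} (\<lambda>_. M)) \<rightarrow>\<^sub>M M"
  proof (cases "k \<in> {a + 1..a + m}")
    case True
    then have "k - a \<in> {1..m}" by auto
    then have "(\<lambda>z. snd z (k - a)) \<in> (PiM {1..} (\<lambda>_. M) \<Otimes>\<^sub>M PiM {1..m} (\<lambda>_. M)) \<rightarrow>\<^sub>M M"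
      by (intro measurable_compose[OF measurable_snd] measurable_component_singleton)
    then show ?thesis unfolding if_P[OF True] .
  next
    case False
    have "(\<lambda>z. fst z k) \<in> (PiM {1..} (\<lambda>_. M) \<Otimes>\<^sub>M PiM {1..m} (\<lambda>_. M)) \<rightarrow>\<^sub>M M"
      using k by (intro measurable_compose[OF measurable_fst] measurable_component_singleton)
    then show ?thesis unfolding if_not_P[OF False] .
  qed
qed

text \<open>It suffices to compare cylinders. The preimage of a cylinder is a rectangle: its
  constraints outside the block concern only the old sequence, those inside only the fresh
  block.\<close>

lemma distr_resample:
  assumes "prob_space M"
  shows "distr (PiM {1..} (\<lambda>_. M) \<Otimes>\<^sub>M PiM {1..m} (\<lambda>_. M)) (PiM {1..} (\<lambda>_. M)) (\<lambda>z. resample a m (fst z) (snd z))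
    = PiM {1..} (\<lambda>_. M)" (is "?D = _")
proof -
  interpret M: prob_space M by fact
  interpret I: product_prob_space "\<lambda>_. M" "{1..} :: nat set" ..
  interpret B: product_prob_space "\<lambda>_. M" "{1..m} :: nat set" ..
  show ?thesis
  proof (rule I.PiM_eq)
    show "sets ?D = sets (PiM {1..} (\<lambda>_. M))" by simp
    fix J :: "nat set" and F
    assume J: "finite J" "J \<subseteq> {1..}" and F: "\<And>j. j \<in> J \<Longrightarrow> F j \<in> sets M"
    define JB where "JB = J \<inter> {a + 1..a + m}"
    define J' where "J' = (\<lambda>j. j - a) ` JB"
    have J': "finite J'" "J' \<subseteq> {1..m}" "\<And>k. k \<in> J' \<Longrightarrow> k + a \<in> J"
      using J by (auto simp: J'_def JB_def)
    define E1 where "E1 = {x \<in> space (PiM {1..} (\<lambda>_. M)). \<forall>j\<in>J - JB. x j \<in> F j}"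
    define E2 where "E2 = {x \<in> space (PiM {1..m} (\<lambda>_. M)). \<forall>k\<in>J'. x k \<in> F (k + a)}"
    let ?X = "prod_emb {1..} (\<lambda>_. M) J (Pi\<^sub>E J F)"
    have X: "?X = {x \<in> space (PiM {1..} (\<lambda>_. M)). \<forall>j\<in>J. x j \<in> F j}"
      unfolding prod_emb_def using J(2) by (auto simp: space_PiM Pi_iff)
    have "(\<lambda>z. resample a m (fst z) (snd z)) -` ?X \<inter> space (PiM {1..} (\<lambda>_. M) \<Otimes>\<^sub>M PiM {1..m} (\<lambda>_. M)) = E1 \<times> E2"
    proof (rule set_eqI)
      fix z
      have "resample a m (fst z) (snd z) \<in> space (PiM {1..} (\<lambda>_. M))"
        if "z \<in> space (PiM {1..} (\<lambda>_. M) \<Otimes>\<^sub>M PiM {1..m} (\<lambda>_. M))"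
        using measurable_space[OF measurable_resample that] .
      moreover have "(\<forall>j\<in>J. resample a m x y j \<in> F j) \<longleftrightarrow> (\<forall>j\<in>J - JB. x j \<in> F j) \<and> (\<forall>k\<in>J'. y k \<in> F (k + a))" for x y
      proof -
        have "(\<forall>j\<in>J. resample a m x y j \<in> F j) \<longleftrightarrow> (\<forall>j\<in>J - JB. resample a m x y j \<in> F j) \<and> (\<forall>j\<in>JB. resample a m x y j \<in> F j)"
          by (auto simp: JB_def)
        also have "(\<forall>j\<in>J - JB. resample a m x y j \<in> F j) \<longleftrightarrow> (\<forall>j\<in>J - JB. x j \<in> F j)"
          using J(2) by (intro ball_cong) (auto simp: resample_def JB_def)
        also have "(\<forall>j\<in>JB. resample a m x y j \<in> F j) \<longleftrightarrow> (\<forall>k\<in>J'. y k \<in> F (k + a))"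
          unfolding J'_def by (auto simp: resample_def JB_def)
        finally show ?thesis .
      qed
      ultimately show "z \<in> (\<lambda>z. resample a m (fst z) (snd z)) -` ?X \<inter> space (PiM {1..} (\<lambda>_. M) \<Otimes>\<^sub>M PiM {1..m} (\<lambda>_. M))
          \<longleftrightarrow> z \<in> E1 \<times> E2"
        unfolding X E1_def E2_def by (cases z) (auto simp: space_pair_measure)
    qed
    moreover have "?X \<in> sets (PiM {1..} (\<lambda>_. M))"
      using J F by (intro sets_PiM_I) auto
    ultimately have "emeasure ?D ?X = emeasure (PiM {1..} (\<lambda>_. M) \<Otimes>\<^sub>M PiM {1..m} (\<lambda>_. M)) (E1 \<times> E2)"
      by (subst emeasure_distr[OF measurable_resample]) auto
    also have "\<dots> = emeasure (PiM {1..} (\<lambda>_. M)) E1 * emeasure (PiM {1..m} (\<lambda>_. M)) E2"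
    proof (rule B.emeasure_pair_measure_Times)
      show "E1 \<in> sets (PiM {1..} (\<lambda>_. M))"
        unfolding E1_def using J F by (intro sets.sets_Collect_finite_All sets_Collect_single) auto
      show "E2 \<in> sets (PiM {1..m} (\<lambda>_. M))"
        unfolding E2_def using J' F by (intro sets.sets_Collect_finite_All sets_Collect_single) auto
    qed
    also have "emeasure (PiM {1..} (\<lambda>_. M)) E1 = (\<Prod>j\<in>J - JB. emeasure M (F j))"
      unfolding E1_def using J F by (intro I.emeasure_PiM_Collect) auto
    also have "emeasure (PiM {1..m} (\<lambda>_. M)) E2 = (\<Prod>k\<in>J'. emeasure M (F (k + a)))"
      unfolding E2_def using J' F by (intro B.emeasure_PiM_Collect) auto
    also have "(\<Prod>k\<in>J'. emeasure M (F (k + a))) = (\<Prod>j\<in>JB. emeasure M (F j))"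
      unfolding J'_def by (subst prod.reindex) (auto simp: inj_on_def JB_def intro!: prod.cong)
    also have "(\<Prod>j\<in>J - JB. emeasure M (F j)) * (\<Prod>j\<in>JB. emeasure M (F j)) = (\<Prod>j\<in>J. emeasure M (F j))"
      using J by (intro prod.subset_diff[symmetric]) (auto simp: JB_def)
    finally show "emeasure ?D ?X = (\<Prod>j\<in>J. emeasure M (F j))" .
  qed
qed

lemma nn_integral_resample:
  assumes "prob_space M" and g: "g \<in> borel_measurable (PiM {1..} (\<lambda>_. M))"
  shows "(\<integral>\<^sup>+x. g x \<partial>PiM {1..} (\<lambda>_. M))
    = (\<integral>\<^sup>+x. \<integral>\<^sup>+x'. g (resample a m x x') \<partial>PiM {1..m} (\<lambda>_. M) \<partial>PiM {1..} (\<lambda>_. M))"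
proof -
  interpret M: prob_space M by fact
  interpret B: product_prob_space "\<lambda>_. M" "{1..m} :: nat set" ..
  have "(\<lambda>z. g (resample a m (fst z) (snd z))) \<in> borel_measurable (PiM {1..} (\<lambda>_. M) \<Otimes>\<^sub>M PiM {1..m} (\<lambda>_. M))"
    by (rule measurable_compose[OF measurable_resample g])
  then have *: "(\<lambda>(x, x'). g (resample a m x x')) \<in> borel_measurable (PiM {1..} (\<lambda>_. M) \<Otimes>\<^sub>M PiM {1..m} (\<lambda>_. M))"
    by (simp only: case_prod_unfold)
  have "(\<integral>\<^sup>+x. g x \<partial>PiM {1..} (\<lambda>_. M))
    = (\<integral>\<^sup>+z. g (resample a m (fst z) (snd z)) \<partial>(PiM {1..} (\<lambda>_. M) \<Otimes>\<^sub>M PiM {1..m} (\<lambda>_. M)))"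
    using nn_integral_distr[OF measurable_resample, of g M m a] g
    by (simp only: distr_resample[OF assms(1)])
  also have "\<dots> = (\<integral>\<^sup>+x. \<integral>\<^sup>+x'. g (resample a m x x') \<partial>PiM {1..m} (\<lambda>_. M) \<partial>PiM {1..} (\<lambda>_. M))"
    using B.nn_integral_fst[OF *] by (simp only: case_prod_unfold fst_conv snd_conv)
  finally show ?thesis .
qed

text \<open>Resampling a block of both sequences preserves their joint law, so it suffices to bound the
  probability of an event conditionally on all coordinates outside the block.\<close>

lemma block_event_prob:
  assumes M: "prob_space M" and R: "prob_space R"
    and E: "E \<in> sets (PiM {1..} (\<lambda>_. M) \<Otimes>\<^sub>M PiM {1..} (\<lambda>_. R))"
    and p: "\<And>x y. x \<in> space (PiM {1..} (\<lambda>_. M)) \<Longrightarrow> y \<in> space (PiM {1..} (\<lambda>_. R)) \<Longrightarrow>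
      p \<le> measure (PiM {1..m} (\<lambda>_. M) \<Otimes>\<^sub>M PiM {1..m} (\<lambda>_. R))
        {c \<in> space (PiM {1..m} (\<lambda>_. M) \<Otimes>\<^sub>M PiM {1..m} (\<lambda>_. R)).
          (resample a m x (fst c), resample a m y (snd c)) \<in> E}"
  shows "p \<le> measure (PiM {1..} (\<lambda>_. M) \<Otimes>\<^sub>M PiM {1..} (\<lambda>_. R)) E"
proof -
  interpret M: prob_space M by fact
  interpret R: prob_space R by fact
  let ?SM = "PiM {1::nat..} (\<lambda>_. M)" and ?SR = "PiM {1::nat..} (\<lambda>_. R)"
  let ?BM = "PiM {1..m} (\<lambda>_. M)" and ?BR = "PiM {1..m} (\<lambda>_. R)"
  interpret SM: prob_space ?SM by (intro prob_space_PiM M)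
  interpret SR: prob_space ?SR by (intro prob_space_PiM R)
  interpret BM: prob_space ?BM by (intro prob_space_PiM M)
  interpret BR: prob_space ?BR by (intro prob_space_PiM R)
  interpret SS: pair_prob_space ?SM ?SR ..
  interpret BB: pair_prob_space ?BM ?BR ..
  interpret BS: pair_sigma_finite ?BM ?SR ..
  let ?T = "resample a m"
  let ?I = "indicator E :: _ \<Rightarrow> ennreal"
  have meas: "(\<lambda>z. ?I (f z, g z)) \<in> borel_measurable N"
    if "f \<in> N \<rightarrow>\<^sub>M ?SM" "g \<in> N \<rightarrow>\<^sub>M ?SR" for f g and N :: "'z measure"
    using measurable_compose[OF measurable_Pair[OF that] borel_measurable_indicator[OF E]] .
  have rs: "(\<lambda>z. resample a m (f z) (g z)) \<in> N \<rightarrow>\<^sub>M PiM {1..} (\<lambda>_. L)"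
    if "f \<in> N \<rightarrow>\<^sub>M PiM {1..} (\<lambda>_. L)" "g \<in> N \<rightarrow>\<^sub>M PiM {1..m} (\<lambda>_. L)" for f g and N :: "'z measure" and L :: "'y measure"
    using measurable_compose[OF measurable_Pair[OF that] measurable_resample] by simp
  have "emeasure (?SM \<Otimes>\<^sub>M ?SR) E = (\<integral>\<^sup>+x. \<integral>\<^sup>+y. ?I (x, y) \<partial>?SR \<partial>?SM)"
    using SR.emeasure_pair_measure[OF E] by simp
  also have "\<dots> = (\<integral>\<^sup>+x. \<integral>\<^sup>+x'. (\<integral>\<^sup>+y. ?I (?T x x', y) \<partial>?SR) \<partial>?BM \<partial>?SM)"
    using E by (intro nn_integral_resample M SR.borel_measurable_nn_integral)
      (simp add: case_prod_unfold)
  \<comment> \<open>Fubini moves the fresh data block inside the integral over the signs, so that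
    the sign sequence can be resampled in the same way.\<close>
  also have "\<dots> = (\<integral>\<^sup>+x. \<integral>\<^sup>+y. \<integral>\<^sup>+x'. ?I (?T x x', y) \<partial>?BM \<partial>?SR \<partial>?SM)"
  proof (rule nn_integral_cong)
    fix x assume x: "x \<in> space ?SM"
    have "(\<lambda>(x', y). ?I (?T x x', y)) \<in> borel_measurable (?BM \<Otimes>\<^sub>M ?SR)"
      unfolding case_prod_unfold by (intro meas rs measurable_const x measurable_fst measurable_snd)
    then show "(\<integral>\<^sup>+x'. \<integral>\<^sup>+y. ?I (?T x x', y) \<partial>?SR \<partial>?BM) = (\<integral>\<^sup>+y. \<integral>\<^sup>+x'. ?I (?T x x', y) \<partial>?BM \<partial>?SR)"
      by (rule BS.Fubini'[symmetric])
  qed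
  also have "\<dots> = (\<integral>\<^sup>+x. \<integral>\<^sup>+y. \<integral>\<^sup>+y'. (\<integral>\<^sup>+x'. ?I (?T x x', ?T y y') \<partial>?BM) \<partial>?BR \<partial>?SR \<partial>?SM)"
  proof (rule nn_integral_cong)
    fix x assume x: "x \<in> space ?SM"
    have "(\<lambda>(y, x'). ?I (?T x x', y)) \<in> borel_measurable (?SR \<Otimes>\<^sub>M ?BM)"
      unfolding case_prod_unfold by (intro meas rs measurable_const x measurable_fst measurable_snd)
    then show "(\<integral>\<^sup>+y. \<integral>\<^sup>+x'. ?I (?T x x', y) \<partial>?BM \<partial>?SR)
        = (\<integral>\<^sup>+y. \<integral>\<^sup>+y'. (\<integral>\<^sup>+x'. ?I (?T x x', ?T y y') \<partial>?BM) \<partial>?BR \<partial>?SR)"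
      by (intro nn_integral_resample R BM.borel_measurable_nn_integral)
  qed
  also have "\<dots> = (\<integral>\<^sup>+x. \<integral>\<^sup>+y. emeasure (?BM \<Otimes>\<^sub>M ?BR) {c \<in> space (?BM \<Otimes>\<^sub>M ?BR). (?T x (fst c), ?T y (snd c)) \<in> E} \<partial>?SR \<partial>?SM)"
  proof (intro nn_integral_cong)
    fix x y assume x: "x \<in> space ?SM" and y: "y \<in> space ?SR"
    let ?A = "{c \<in> space (?BM \<Otimes>\<^sub>M ?BR). (?T x (fst c), ?T y (snd c)) \<in> E}"
    have m: "(\<lambda>c. (?T x (fst c), ?T y (snd c))) \<in> (?BM \<Otimes>\<^sub>M ?BR) \<rightarrow>\<^sub>M (?SM \<Otimes>\<^sub>M ?SR)"
      by (intro measurable_Pair rs measurable_const x y measurable_fst measurable_snd)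
    have A: "?A \<in> sets (?BM \<Otimes>\<^sub>M ?BR)"
      using measurable_sets[OF m E] by (simp add: vimage_def Int_def conj_commute)
    have "(\<integral>\<^sup>+y'. \<integral>\<^sup>+x'. ?I (?T x x', ?T y y') \<partial>?BM \<partial>?BR) = (\<integral>\<^sup>+c. ?I (?T x (fst c), ?T y (snd c)) \<partial>(?BM \<Otimes>\<^sub>M ?BR))"
      using BB.nn_integral_snd[OF measurable_compose[OF m borel_measurable_indicator[OF E]]] by simp
    also have "\<dots> = (\<integral>\<^sup>+c. indicator ?A c \<partial>(?BM \<Otimes>\<^sub>M ?BR))"
      by (intro nn_integral_cong) (simp add: indicator_def)
    also have "\<dots> = emeasure (?BM \<Otimes>\<^sub>M ?BR) ?A" by (rule nn_integral_indicator[OF A])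
    finally show "(\<integral>\<^sup>+y'. \<integral>\<^sup>+x'. ?I (?T x x', ?T y y') \<partial>?BM \<partial>?BR) = emeasure (?BM \<Otimes>\<^sub>M ?BR) ?A" .
  qed
  finally have eq: "emeasure (?SM \<Otimes>\<^sub>M ?SR) E = \<dots>" .
  have "(\<integral>\<^sup>+x. \<integral>\<^sup>+y. ennreal p \<partial>?SR \<partial>?SM) \<le> emeasure (?SM \<Otimes>\<^sub>M ?SR) E"
    unfolding eq BB.emeasure_eq_measure by (intro nn_integral_mono ennreal_leI p)
  then have "ennreal p \<le> emeasure (?SM \<Otimes>\<^sub>M ?SR) E"
    by (simp add: SM.emeasure_space_1 SR.emeasure_space_1 del: One_nat_def)
  then show ?thesis unfolding SS.emeasure_eq_measure by (simp only: ennreal_le_iff measure_nonneg)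
qed

text \<open>Transfers the abstract sample space to the product law on which blocks can be resampled:
  each sequence has product law by its own independence, and the joint law is fixed by its values on
  rectangles, where \<open>ind\<close> applies.\<close>

lemma (in prob_space) distr_indep_sequences:
  assumes Z: "indep_vars (\<lambda>_. P) Z {1::nat..}" "\<And>k. 1 \<le> k \<Longrightarrow> distr M P (Z k) = P"
    and \<xi>: "indep_vars (\<lambda>_. R) \<xi> {1::nat..}" "\<And>k. 1 \<le> k \<Longrightarrow> distr M R (\<xi> k) = R"
    and ind: "indep_set
      {(\<lambda>w. \<lambda>k\<in>{1..}. Z k w) -` A \<inter> space M | A. A \<in> sets (\<Pi>\<^sub>M k\<in>{1..}. P)}
      {(\<lambda>w. \<lambda>k\<in>{1..}. \<xi> k w) -` B \<inter> space M | B. B \<in> sets (\<Pi>\<^sub>M k\<in>{1..}. R)}"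
  shows "(\<lambda>w. (\<lambda>k\<in>{1..}. Z k w, \<lambda>k\<in>{1..}. \<xi> k w)) \<in> M \<rightarrow>\<^sub>M (PiM {1..} (\<lambda>_. P) \<Otimes>\<^sub>M PiM {1..} (\<lambda>_. R))" (is ?meas)
    and "distr M (PiM {1..} (\<lambda>_. P) \<Otimes>\<^sub>M PiM {1..} (\<lambda>_. R)) (\<lambda>w. (\<lambda>k\<in>{1..}. Z k w, \<lambda>k\<in>{1..}. \<xi> k w))
      = PiM {1..} (\<lambda>_. P) \<Otimes>\<^sub>M PiM {1..} (\<lambda>_. R)" (is ?law)
proof -
  have seq: "(\<lambda>w. \<lambda>k\<in>{1..}. W k w) \<in> M \<rightarrow>\<^sub>M PiM {1..} (\<lambda>_. N)"
    "distr M (PiM {1..} (\<lambda>_. N)) (\<lambda>w. \<lambda>k\<in>{1..}. W k w) = PiM {1..} (\<lambda>_. N)"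
    if "indep_vars (\<lambda>_. N) W {1..}" "\<And>k. 1 \<le> k \<Longrightarrow> distr M N (W k) = N" for W :: "nat \<Rightarrow> 'a \<Rightarrow> 'z" and N
  proof -
    have rv: "W k \<in> M \<rightarrow>\<^sub>M N" if "k \<in> {1..}" for k
      using \<open>indep_vars (\<lambda>_. N) W {1..}\<close> that by (auto simp: indep_vars_def)
    then show "(\<lambda>w. \<lambda>k\<in>{1..}. W k w) \<in> M \<rightarrow>\<^sub>M PiM {1..} (\<lambda>_. N)"
      by (intro measurable_restrict)
    have "distr M (PiM {1..} (\<lambda>_. N)) (\<lambda>w. \<lambda>k\<in>{1..}. W k w) = PiM {1..} (\<lambda>k. distr M N (W k))"
      using indep_vars_iff_distr_eq_PiM'[of "{1..}" W "\<lambda>_. N"] rv that(1) by fast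
    also have "\<dots> = PiM {1..} (\<lambda>_. N)" using that(2) by (intro PiM_cong) auto
    finally show "distr M (PiM {1..} (\<lambda>_. N)) (\<lambda>w. \<lambda>k\<in>{1..}. W k w) = PiM {1..} (\<lambda>_. N)" .
  qed
  let ?D = "\<lambda>w. \<lambda>k\<in>{1..}. Z k w" and ?X = "\<lambda>w. \<lambda>k\<in>{1..}. \<xi> k w"
  let ?P = "PiM {1::nat..} (\<lambda>_. P)" and ?R = "PiM {1::nat..} (\<lambda>_. R)"
  have D: "?D \<in> M \<rightarrow>\<^sub>M ?P" and X: "?X \<in> M \<rightarrow>\<^sub>M ?R"
    by (rule seq(1)[OF Z] seq(1)[OF \<xi>]; assumption)+
  show m: ?meas by (intro measurable_Pair D X)
  have PD: "emeasure ?P A = emeasure M (?D -` A \<inter> space M)" if "A \<in> sets ?P" for A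
    using emeasure_distr[OF D that] seq(2)[OF Z] by simp
  have RX: "emeasure ?R B = emeasure M (?X -` B \<inter> space M)" if "B \<in> sets ?R" for B
    using emeasure_distr[OF X that] seq(2)[OF \<xi>] by simp
  have "prob_space ?P" "prob_space ?R"
    using prob_space_distr[OF D] prob_space_distr[OF X] seq(2)[OF Z] seq(2)[OF \<xi>] by simp_all
  then have sf: "sigma_finite_measure ?P" "sigma_finite_measure ?R"
    by (auto intro: prob_space_imp_sigma_finite)
  have "?P \<Otimes>\<^sub>M ?R = distr M (?P \<Otimes>\<^sub>M ?R) (\<lambda>w. (?D w, ?X w))"
  proof (rule pair_measure_eqI[OF sf])
    fix A B assume A: "A \<in> sets ?P" and B: "B \<in> sets ?R"
    have "emeasure (distr M (?P \<Otimes>\<^sub>M ?R) (\<lambda>w. (?D w, ?X w))) (A \<times> B)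
      = emeasure M ((?D -` A \<inter> space M) \<inter> (?X -` B \<inter> space M))"
      using A B by (subst emeasure_distr[OF m]) (auto intro!: arg_cong[where f = "emeasure M"])
    also have "\<dots> = emeasure M (?D -` A \<inter> space M) * emeasure M (?X -` B \<inter> space M)"
    proof -
      have "prob ((?D -` A \<inter> space M) \<inter> (?X -` B \<inter> space M))
        = prob (?D -` A \<inter> space M) * prob (?X -` B \<inter> space M)"
        using A B by (intro indep_setD[OF ind]) auto
      then show ?thesis by (simp only: emeasure_eq_measure ennreal_mult measure_nonneg)
    qed
    finally show "emeasure ?P A * emeasure ?R B
      = emeasure (distr M (?P \<Otimes>\<^sub>M ?R) (\<lambda>w. (?D w, ?X w))) (A \<times> B)"
      by (simp only: PD[OF A] RX[OF B])
  qed simp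
  then show ?law by simp
qed

section \<open>The concentration event on one block of the run\<close>

text \<open>At each point a patched function takes the value of some member of \<open>F\<close>. It
  need not belong to \<open>F\<close>, but the hull, over which \<open>concentration\<close> and
  \<open>admissible\<close> range, contains it.\<close>

lemma patch_set_subset_fhull:
  assumes "V \<subseteq> F" "F \<subseteq> Fstar MX" "f \<in> F" "D \<in> sets MX"
  shows "patch_set V D f \<subseteq> fhull MX F"
proof
  fix g assume "g \<in> patch_set V D f"
  then obtain h where h: "h \<in> V" "g = patch D f h" by (auto simp: patch_set_def)
  then have "g \<in> Fstar MX" using assms by (auto intro: patch_in_Fstar)
  moreover have "(INF h\<in>F. h x) \<le> g x \<and> g x \<le> (SUP h\<in>F. h x)" for x
    using h assms by (auto simp: patch_def intro: INF_lower SUP_upper)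
  ultimately show "g \<in> fhull MX F" by (simp add: fhull_def)
qed

lemma alg_V_subset:
  assumes "1 \<le> u"
  shows "alg_V MX c F l sh u n d \<xi> \<subseteq> F"
proof -
  obtain M where M: "1 \<le> M" "alg_run MX c F l sh u n d \<xi> = alg_state MX c F l sh d \<xi> M"
    using alg_run_cases[OF assms, of MX c F l sh n d \<xi>] by metis
  then show ?thesis
    using VS_antimono[of 1 M MX c F l sh d \<xi>] by (simp add: alg_V_def)
qed

lemma sets_seq_space:
  assumes "is_distribution MX P"
  shows "sets (seq_space MX) = sets (PiM {1..} (\<lambda>_. P) \<Otimes>\<^sub>M PiM {1..} (\<lambda>_. rademacher))"
proof -
  have "sets labels = sets rademacher"
    by (simp add: labels_def rademacher_def sets_uniform_count_measure)
  then show ?thesis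
    using assms unfolding seq_space_def is_distribution_def
    by (intro sets_pair_measure_cong sets_PiM_cong) auto
qed

lemma prob_space_rademacher: "prob_space rademacher"
  unfolding rademacher_def by (rule prob_space_uniform_count_measure) auto

text \<open>With all entries outside the block frozen, the class \<open>H w\<close> is a fixed set
  and the block is a fresh sample of size \<open>2 ^ (i - 1)\<close>. Where \<open>f\<close> has
  been lost there is no known minimizer to which the inequality could be applied, and
  \<open>E\<close> imposes nothing.\<close>

lemma conc_event_prob:
  assumes dist: "is_distribution MX P"
    and conc: "concentration MX F l (lbar MX F l) K1 K2 K3 K"
    and F: "F \<subseteq> Fstar MX" "f \<in> F"
    and bounded: "\<And>h x y. h \<in> F \<Longrightarrow> x \<in> space MX \<Longrightarrow> y \<in> {-1, 1} \<Longrightarrow> loss l h (x, y) \<le> ereal (lbar MX F l)"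
    and min: "\<And>g. g \<in> Fstar MX \<Longrightarrow> risk l P f \<le> risk l P g"
    and meas: "alg_measurable MX c F l sh K1 K2 K3 K f P u n"
    and i: "1 \<le> i" "2 ^ i \<le> u" and s: "1 \<le> sh (2 ^ i)"
  defines "V \<equiv> \<lambda>w. alg_V MX c F l sh (2 ^ (i - 1)) n (fst w) (snd w)"
  defines "H \<equiv> \<lambda>w. patch_set (V w) (DIS MX c (V w)) f"
  defines "E \<equiv> {w \<in> space (seq_space MX). f \<in> V w \<longrightarrow>
    conc_event l (lbar MX F l) K1 K2 K3 K (H w) f P (sh (2 ^ i)) {2 ^ (i - 1) + 1..2 ^ i} (fst w) (snd w)}"
  shows "E \<in> sets (PiM {1..} (\<lambda>_. P) \<Otimes>\<^sub>M PiM {1..} (\<lambda>_. rademacher))"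
    and "1 - 6 * exp (- sh (2 ^ i)) \<le> measure (PiM {1..} (\<lambda>_. P) \<Otimes>\<^sub>M PiM {1..} (\<lambda>_. rademacher)) E"
proof -
  let ?S = "PiM {1::nat..} (\<lambda>_. P)" and ?R = "PiM {1::nat..} (\<lambda>_. rademacher)"
  define a where "a = (2::nat) ^ (i - 1)"
  have a: "1 \<le> a" "2 ^ i = a + a"
    using i(1) by (cases i; simp add: a_def)+
  interpret P: prob_space P using dist by (simp add: is_distribution_def)
  interpret C: prob_space "conc_space P a"
  proof -
    interpret X: prob_space "PiM {1..a} (\<lambda>_. P)" by (intro prob_space_PiM P.prob_space_axioms)
    interpret Y: prob_space "PiM {1..a} (\<lambda>_. rademacher)" by (intro prob_space_PiM prob_space_rademacher)
    interpret XY: pair_prob_space "PiM {1..a} (\<lambda>_. P)" "PiM {1..a} (\<lambda>_. rademacher)" ..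
    show "prob_space (conc_space P a)" unfolding conc_space_def by unfold_locales
  qed
  have sp: "space (seq_space MX) = space (?S \<Otimes>\<^sub>M ?R)"
    by (rule sets_eq_imp_space_eq[OF sets_seq_space[OF dist]])
  have ms: "(\<forall>w\<in>space (seq_space MX). DIS MX c (V w) \<in> sets MX) \<and>
    (\<forall>w\<in>space (seq_space MX). f \<in> V w \<longrightarrow>
       conc_measurable l (lbar MX F l) K1 K2 K3 K (H w) f P (sh (2 ^ i)) a) \<and>
    E \<in> sets (seq_space MX)"
    unfolding V_def H_def E_def a_def
    by (rule meas[unfolded alg_measurable_def Let_def, THEN spec, THEN mp, OF conjI[OF i]])
  then have m: "\<And>w. w \<in> space (seq_space MX) \<Longrightarrow> DIS MX c (V w) \<in> sets MX"
    "\<And>w. w \<in> space (seq_space MX) \<Longrightarrow> f \<in> V w \<Longrightarrow>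
       conc_measurable l (lbar MX F l) K1 K2 K3 K (H w) f P (sh (2 ^ i)) a"
    by blast+
  show E: "E \<in> sets (?S \<Otimes>\<^sub>M ?R)"
    using ms sets_seq_space[OF dist] by blast
  then show "1 - 6 * exp (- sh (2 ^ i)) \<le> measure (?S \<Otimes>\<^sub>M ?R) E"
  proof (rule block_event_prob[OF P.prob_space_axioms prob_space_rademacher, where a = a and m = a])
    fix x y assume x: "x \<in> space ?S" and y: "y \<in> space ?R"
    let ?w = "\<lambda>z. (resample a a x (fst z), resample a a y (snd z))"
    let ?A = "{z \<in> space (conc_space P a). ?w z \<in> E}"
    have xy: "(x, y) \<in> space (seq_space MX)" using x y by (simp add: sp space_pair_measure)
    have w: "?w z \<in> space (seq_space MX)" if z: "z \<in> space (conc_space P a)" for z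
    proof -
      have "resample a a x (fst z) \<in> space ?S" "resample a a y (snd z) \<in> space ?R"
        using z x y measurable_space[OF measurable_resample, of "(x, fst z)" P a a]
          measurable_space[OF measurable_resample, of "(y, snd z)" rademacher a a]
        by (auto simp: conc_space_def space_pair_measure)
      then show ?thesis by (simp add: sp space_pair_measure)
    qed
    \<comment> \<open>The class uses only the first \<open>a\<close> entries, and resampling changes
      the entries from \<open>a + 1\<close> to \<open>a + a\<close>.\<close>
    have V: "V (?w z) = V (x, y)" for z
      unfolding V_def a_def[symmetric] using a(1) by (intro alg_V_cong) (auto simp: resample_def)
    then have H: "H (?w z) = H (x, y)" for z by (simp add: H_def)
    show "1 - 6 * exp (- sh (2 ^ i)) \<le> measure (PiM {1..a} (\<lambda>_. P) \<Otimes>\<^sub>M PiM {1..a} (\<lambda>_. rademacher))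
       {c \<in> space (PiM {1..a} (\<lambda>_. P) \<Otimes>\<^sub>M PiM {1..a} (\<lambda>_. rademacher)). ?w c \<in> E}"
      unfolding conc_space_def[symmetric]
    proof (cases "f \<in> V (x, y)")
      case False
      then have "?A = space (conc_space P a)" using w V by (auto simp: E_def)
      then show "1 - 6 * exp (- sh (2 ^ i)) \<le> measure (conc_space P a) ?A"
        by (simp add: C.prob_space)
    next
      case True
      have VF: "V (x, y) \<subseteq> F" unfolding V_def by (intro alg_V_subset) simp
      have "conc_event l (lbar MX F l) K1 K2 K3 K (H (x, y)) f P (sh (2 ^ i)) {a + 1..2 ^ i} (resample a a x (fst z)) (resample a a y (snd z))
        \<longleftrightarrow> conc_event l (lbar MX F l) K1 K2 K3 K (H (x, y)) f P (sh (2 ^ i)) {1..a} (fst z) (snd z)" for z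
      proof -
        have im: "{a + 1..2 ^ i} = (\<lambda>k. k + a) ` {1..a}"
          unfolding a(2) by (simp add: image_add_atLeastAtMost' add.commute)
        have inj: "inj_on (\<lambda>k. k + a) {1..a}" by (auto simp: inj_on_def)
        show ?thesis unfolding im conc_event_reindex[OF inj]
          by (intro conc_event_cong) (auto simp: resample_def)
      qed
      then have "?A = conc_set l (lbar MX F l) K1 K2 K3 K (H (x, y)) f P (sh (2 ^ i)) a"
        unfolding E_def conc_set_def a_def[symmetric] using w V H True
        by (auto simp del: One_nat_def Suc_eq_plus1)
      moreover have "measure (conc_space P a) (conc_set l (lbar MX F l) K1 K2 K3 K (H (x, y)) f P (sh (2 ^ i)) a)
        \<ge> 1 - 6 * exp (- sh (2 ^ i))"
      proof (rule conc[unfolded concentration_def, rule_format], intro conjI ballI)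
        show "H (x, y) \<subseteq> fhull MX F"
          unfolding H_def by (intro patch_set_subset_fhull VF F m(1)[OF xy])
        show "f \<in> H (x, y)"
          using True unfolding H_def patch_set_def by (metis image_eqI patch_self)
        show "conc_measurable l (lbar MX F l) K1 K2 K3 K (H (x, y)) f P (sh (2 ^ i)) a"
          by (rule m(2)[OF xy True])
        fix h assume "h \<in> H (x, y)"
        then obtain g where g: "g \<in> V (x, y)" "h = patch (DIS MX c (V (x, y))) f g"
          by (auto simp: H_def patch_set_def)
        show "risk l P f \<le> risk l P h"
          using g VF F m(1)[OF xy] by (intro min) (auto intro!: patch_in_Fstar)
        fix z and y' :: real assume "z \<in> space MX" "y' \<in> {-1, 1}"
        then show "loss l h (z, y') \<le> ereal (lbar MX F l)"
          using g VF F bounded[of g z y'] bounded[of f z y'] by (auto simp: loss_def patch_def)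
      qed (use dist a s in auto)
      ultimately show "1 - 6 * exp (- sh (2 ^ i)) \<le> measure (conc_space P a) ?A" by simp
    qed
  qed
qed

text \<open>Chernoff's bound with base 2: the expectation of \<open>2\<close> to the number of hits is
  \<open>\<Prod>(1 + p k) \<le> exp (\<Sum> p k)\<close>.\<close>

lemma (in prob_space) prob_many_hits_le:
  fixes X :: "nat \<Rightarrow> 'a \<Rightarrow> 'b" and N :: "'b measure" and B :: "nat \<Rightarrow> 'b set"
  assumes ind: "indep_vars (\<lambda>_. N) X I" and I: "finite I"
    and B: "\<And>k. k \<in> I \<Longrightarrow> B k \<in> sets N"
    and n: "s + 2 * exp 1 * (\<Sum>k\<in>I. measure (distr M N (X k)) (B k)) \<le> real n"
  shows "{w \<in> space M. n \<le> card {k \<in> I. X k w \<in> B k}} \<in> events"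
    and "prob {w \<in> space M. n \<le> card {k \<in> I. X k w \<in> B k}} \<le> 2 powr (- s)"
proof -
  have rv: "X k \<in> M \<rightarrow>\<^sub>M N" if "k \<in> I" for k
    using ind that by (auto simp: indep_vars_def)
  define p where "p k = measure (distr M N (X k)) (B k)" for k
  define G where "G w = (\<Prod>k\<in>I. 1 + indicator (B k) (X k w) :: ennreal)" for w
  have hit: "(\<lambda>x. 1 + indicator (B k) x :: ennreal) \<in> borel_measurable N" if "k \<in> I" for k
    using B[OF that] by measurable
  have Gm [measurable]: "G \<in> borel_measurable M"
    unfolding G_def using measurable_compose[OF rv hit] by (intro borel_measurable_prod_ennreal) auto
  have "(\<integral>\<^sup>+w. G w \<partial>M) = (\<Prod>k\<in>I. \<integral>\<^sup>+w. 1 + indicator (B k) (X k w) \<partial>M)"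
    unfolding G_def using indep_vars_compose2[OF ind hit] I by (intro indep_vars_nn_integral) auto
  also have "\<dots> = (\<Prod>k\<in>I. ennreal (1 + p k))"
  proof (rule prod.cong)
    fix k assume k: "k \<in> I"
    interpret D: prob_space "distr M N (X k)" by (rule prob_space_distr[OF rv[OF k]])
    have "(\<integral>\<^sup>+w. 1 + indicator (B k) (X k w) \<partial>M) = (\<integral>\<^sup>+x. 1 + indicator (B k) x \<partial>distr M N (X k))"
      using hit[OF k] rv[OF k] by (subst nn_integral_distr) auto
    also have "\<dots> = 1 + emeasure (distr M N (X k)) (B k)"
      using B[OF k] by (subst nn_integral_add) (auto simp: D.emeasure_space_1[simplified])
    also have "\<dots> = ennreal (1 + p k)"
      by (simp add: D.emeasure_eq_measure p_def)
    finally show "(\<integral>\<^sup>+w. 1 + indicator (B k) (X k w) \<partial>M) = ennreal (1 + p k)" .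
  qed simp
  also have "\<dots> = ennreal (\<Prod>k\<in>I. 1 + p k)"
    by (intro prod_ennreal) (simp add: p_def)
  also have "\<dots> \<le> ennreal (exp (\<Sum>k\<in>I. p k))"
    unfolding exp_sum[OF I] by (intro ennreal_leI prod_mono) (auto simp: p_def)
  finally have exp_le: "(\<integral>\<^sup>+w. G w \<partial>M) \<le> ennreal (exp (\<Sum>k\<in>I. p k))" .
  have G: "G w = ennreal (2 ^ card {k \<in> I. X k w \<in> B k})" for w
  proof -
    have "G w = (\<Prod>k\<in>I. if X k w \<in> B k then 2 else 1)"
      unfolding G_def by (intro prod.cong) (auto simp: indicator_def)
    also have "\<dots> = 2 ^ card {k \<in> I. X k w \<in> B k}"
      using I by (subst prod.If_cases) (simp_all add: Int_def)
    finally show ?thesis by (simp add: ennreal_power[symmetric])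
  qed
  have "n \<le> card {k \<in> I. X k w \<in> B k} \<longleftrightarrow> 1 \<le> ennreal (2 powr (- real n)) * G w" for w
  proof -
    have "ennreal (2 powr (- real n)) * G w = ennreal (2 powr (real (card {k \<in> I. X k w \<in> B k}) - real n))"
      unfolding G by (simp add: ennreal_mult[symmetric] powr_realpow[symmetric] powr_add[symmetric])
    then show ?thesis
      using powr_le_cancel_iff[of 2 0 "real (card {k \<in> I. X k w \<in> B k}) - real n"]
      by (simp add: ennreal_1[symmetric] del: ennreal_1)
  qed
  then have eq: "{w \<in> space M. n \<le> card {k \<in> I. X k w \<in> B k}}
      = {w \<in> space M. 1 \<le> ennreal (2 powr (- real n)) * G w}" by auto
  show "{w \<in> space M. n \<le> card {k \<in> I. X k w \<in> B k}} \<in> events"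
    unfolding eq by measurable
  have "emeasure M {w \<in> space M. 1 \<le> ennreal (2 powr (- real n)) * G w}
    \<le> ennreal (2 powr (- real n)) * (\<integral>\<^sup>+w. G w * indicator (space M) w \<partial>M)"
    by (rule nn_integral_Markov_inequality) auto
  also have "(\<integral>\<^sup>+w. G w * indicator (space M) w \<partial>M) = (\<integral>\<^sup>+w. G w \<partial>M)"
    by (intro nn_integral_cong) auto
  also have "ennreal (2 powr (- real n)) * \<dots> \<le> ennreal (2 powr (- real n)) * ennreal (exp (\<Sum>k\<in>I. p k))"
    by (intro mult_left_mono exp_le) auto
  also have "\<dots> \<le> ennreal (2 powr (- s))"
  proof -
    define \<mu> where "\<mu> = (\<Sum>k\<in>I. p k)"
    have \<mu>: "0 \<le> \<mu>" by (auto simp: \<mu>_def p_def intro: sum_nonneg)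
    \<comment> \<open>Markov with base 2 leaves \<open>exp \<mu> * 2 powr (- n)\<close>, which is at
      most \<open>2 powr (- s)\<close> once \<open>\<mu> \<le> (n - s) * ln 2\<close>; the factor
      \<open>2 * exp 1\<close> in the budget provides this.\<close>
    have "\<mu> \<le> 2 * exp 1 * \<mu> * ln 2"
    proof -
      have "1 \<le> 2 * exp 1 * ln (2::real)"
      proof -
        have "(2 * 1) * (2/3) \<le> 2 * exp 1 * ln (2::real)"
          by (intro mult_mono ln2_ge_two_thirds) auto
        then show ?thesis by simp
      qed
      then have "1 * \<mu> \<le> (2 * exp 1 * ln 2) * \<mu>" by (intro mult_right_mono \<mu>)
      then show ?thesis by (simp add: mult_ac)
    qed
    also have "\<dots> \<le> (real n - s) * ln 2"
      using n by (intro mult_right_mono) (auto simp: \<mu>_def p_def)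
    finally have "exp (- real n * ln 2 + \<mu>) \<le> exp (- s * ln 2)" by (simp add: algebra_simps)
    moreover have "2 powr (- real n) * exp \<mu> = exp (- real n * ln 2 + \<mu>)" "2 powr (- s) = exp (- s * ln 2)"
      by (simp_all add: powr_def flip: exp_add)
    ultimately show ?thesis
      unfolding \<mu>_def[symmetric] by (simp only: ennreal_mult[symmetric] powr_ge_zero exp_ge_zero ennreal_leI)
  qed
  finally show "prob {w \<in> space M. n \<le> card {k \<in> I. X k w \<in> B k}} \<le> 2 powr (- s)"
    unfolding eq emeasure_eq_measure by (subst (asm) ennreal_le_iff) auto
qed

section \<open>Levels of the version spaces\<close>

text \<open>In \<open>enat\<close> the infimum of a nonempty set is attained, and the empty set has
  infimum \<open>\<infinity>\<close>, which the finite bound excludes.\<close>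

lemma Mring_leD:
  assumes "2 * Mring MX l lb K \<phi>0 \<gamma>1 \<gamma>2 H P s \<le> enat (2 * a)"
  obtains m where "1 \<le> m" "m \<le> a" "Uring MX l lb K \<phi>0 H \<gamma>2 P m s \<le> ereal \<gamma>1"
proof -
  let ?A = "{enat m | m. 1 \<le> m \<and> Uring MX l lb K \<phi>0 H \<gamma>2 P m s \<le> ereal \<gamma>1}"
  have ne: "?A \<noteq> {}"
  proof
    assume "?A = {}"
    then have "Mring MX l lb K \<phi>0 \<gamma>1 \<gamma>2 H P s = \<infinity>"
      unfolding Mring_def by (metis Inf_enat_def)
    then show False using assms by (simp add: numeral_eq_enat)
  qed
  then have "Inf ?A \<in> ?A" by (auto simp: Inf_enat_def intro: LeastI)
  then obtain m where m: "Mring MX l lb K \<phi>0 \<gamma>1 \<gamma>2 H P s = enat m" "1 \<le> m"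
    "Uring MX l lb K \<phi>0 H \<gamma>2 P m s \<le> ereal \<gamma>1"
    unfolding Mring_def by blast
  have "m \<le> a" using assms m(1) by (simp add: numeral_eq_enat)
  then show thesis using that m by blast
qed

text \<open>Data and signs are not part of the context; they appear later as fixed sequences, so
  that everything proved here is deterministic.\<close>

locale label_complexity =
  fixes MX :: "'a measure" and F :: "('a \<Rightarrow> ereal) set" and P :: "('a \<times> real) measure"
    and l :: "ereal \<Rightarrow> ennreal" and c :: real
    and zs :: "real \<Rightarrow> ereal" and \<eta> :: "('a \<times> real) measure \<Rightarrow> 'a \<Rightarrow> real"
    and \<phi>0 :: "ereal \<Rightarrow> ('a \<Rightarrow> ereal) set \<Rightarrow> nat \<Rightarrow> ('a \<times> real) measure \<Rightarrow> ereal"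
    and K :: real and sh :: "nat \<Rightarrow> real" and uu :: "int \<Rightarrow> nat"
    and lb :: real and f :: "'a \<Rightarrow> ereal" and jl :: int
  defines "lb \<equiv> lbar MX F l" and "f \<equiv> fopt MX zs (\<eta> P)" and "jl \<equiv> j_ell lb"
  assumes distribution: "is_distribution MX P"
    and F_subset: "F \<subseteq> Fstar MX"
    and loss_measurable: "l \<in> borel_measurable borel"
    and loss_bounded: "loss_sup MX F l < \<infinity>"
    and minimizer: "\<And>e. e \<in> {0..1} \<Longrightarrow> cond_risk l e (zs e) = lstar l e"
    and regression: "is_regression MX P (\<eta> P)"
    and K_nonneg: "0 \<le> K"
    and admissible: "admissible MX F l zs \<eta> \<phi>0"
    and sh_ge: "\<And>m. 1 \<le> m \<Longrightarrow> 1 \<le> sh m"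
    and uu_init: "uu (jl - 2) = 1" "uu (jl - 1) = 1"
    and uu_power: "\<And>j. jl \<le> j \<Longrightarrow> log2_pos_int (uu j)"
    and uu_ge: "\<And>j. jl \<le> j \<Longrightarrow>
          enat (uu j) \<ge> max (2 * Mring MX l lb K \<phi>0 (2 powi (- j - 1)) (2 powi (2 - j))
                                 (Fj MX c F l P f j) P (sh (uu j)))
                          (max (enat (uu (j - 1))) (enat (2 * uu (j - 2))))"
    and f_in_F: "f \<in> F"
    and Gset_measurable: "\<And>j. jl \<le> j \<Longrightarrow> DIS MX c (Gset MX c F l P j) \<in> sets MX"
begin

lemma uu_mono: "jl \<le> j \<Longrightarrow> uu (j - 1) \<le> uu j" and uu_double: "jl \<le> j \<Longrightarrow> 2 * uu (j - 2) \<le> uu j"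
  using uu_ge[of j] by simp_all

lemma f_Fstar: "f \<in> Fstar MX"
  using f_in_F F_subset by auto

lemma f_opt:
  assumes "x \<in> space MX"
  shows "cond_risk l (\<eta> P x) (f x) = lstar l (\<eta> P x)"
  using assms minimizer[of "\<eta> P x"] regression by (simp add: f_def fopt_def is_regression_def)

lemma f_min: "g \<in> Fstar MX \<Longrightarrow> risk l P f \<le> risk l P g"
  using f_Fstar
  by (intro risk_mono_cond[OF distribution regression loss_measurable])
    (auto simp: f_opt Fstar_def lstar_def intro: INF_lower)

lemma risk_patch_f_le: "U \<in> sets MX \<Longrightarrow> h \<in> Fstar MX \<Longrightarrow> risk l P (patch U f h) \<le> risk l P h"
  by (intro risk_patch_le[OF distribution regression loss_measurable] f_Fstar)
    (auto simp: f_opt lstar_def intro: INF_lower)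

lemma lb: "1 \<le> lb" "ereal lb = max 1 (loss_sup MX F l)"
proof -
  have "max 1 (loss_sup MX F l) \<noteq> \<infinity>" "max 1 (loss_sup MX F l) \<noteq> - \<infinity>"
    using loss_bounded by (auto simp: max_def)
  then show *: "ereal lb = max 1 (loss_sup MX F l)"
    unfolding lb_def lbar_def by (cases "max 1 (loss_sup MX F l)") auto
  have "ereal 1 \<le> ereal lb" unfolding * by (simp add: one_ereal_def)
  then show "1 \<le> lb" by simp
qed

lemma loss_le:
  assumes "h \<in> F" "x \<in> space MX" "y \<in> {-1, 1}"
  shows "loss l h (x, y) \<le> ereal lb"
proof -
  have "loss l h (x, y) \<le> loss_sup MX F l"
    unfolding loss_sup_def
    by (rule SUP_upper2[OF assms(2)], rule SUP_upper2[OF assms(3)], rule SUP_upper[OF assms(1)])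
  then show ?thesis unfolding lb(2) by (simp only: le_max_iff_disj simp_thms)
qed

lemma loss_real:
  assumes "h \<in> F" "z \<in> space MX \<times> {-1, 1}"
  shows "loss l h z = ereal (real_of_ereal (loss l h z))"
proof -
  have "loss l h z \<le> ereal lb" using loss_le[OF assms(1)] assms(2) by (cases z) auto
  moreover have "0 \<le> loss l h z" by (simp add: loss_def)
  ultimately show ?thesis by (cases "loss l h z") auto
qed

lemma risk_nonneg: "0 \<le> risk l P h"
  by (simp add: risk_def)

lemma risk_le_lb:
  assumes "h \<in> F"
  shows "risk l P h \<le> ereal lb"
proof -
  interpret P: prob_space P using distribution by (simp add: is_distribution_def)
  have "(\<integral>\<^sup>+ z. l (ereal (snd z) * h (fst z)) \<partial>P) \<le> (\<integral>\<^sup>+ z. ennreal lb \<partial>P)"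
  proof (rule nn_integral_mono)
    fix z assume "z \<in> space P"
    then have "loss l h (fst z, snd z) \<le> ereal lb"
      by (intro loss_le assms) (auto simp: space_distribution[OF distribution])
    then show "l (ereal (snd z) * h (fst z)) \<le> ennreal lb"
      using lb(1) by (simp add: loss_def less_eq_ennreal.rep_eq enn2ereal_ennreal)
  qed
  also have "\<dots> = ennreal lb" by (simp add: P.emeasure_space_1)
  finally show ?thesis
    using lb(1) by (simp add: risk_def less_eq_ennreal.rep_eq enn2ereal_ennreal)
qed

lemma risk_f_real: obtains \<rho> where "risk l P f = ereal \<rho>"
  using risk_le_lb[OF f_in_F] risk_nonneg[of f] by (cases "risk l P f") auto

text \<open>The sets \<open>U\<close> occurring here are disagreement regions of earlier version spaces. The
  strictness of the inequality is what makes membership in \<open>Gset\<close> follow even if the supremum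
  defining \<open>Gamma_l\<close> is not attained.\<close>

definition close :: "int \<Rightarrow> ('a \<Rightarrow> ereal) set \<Rightarrow> bool" where
  "close j V \<longleftrightarrow> (\<exists>U\<in>sets MX. DIS MX c V \<subseteq> U \<and>
     (\<forall>h\<in>V. risk l P (patch U f h) - risk l P f < ereal (2 powi (- j))))"

lemma close_antimono: "close j V \<Longrightarrow> V' \<subseteq> V \<Longrightarrow> close j V'"
  unfolding close_def using DIS_mono[of V' V MX c] by blast

text \<open>All risks on \<open>F\<close> lie between 0 and \<open>lb\<close>, and
  \<open>j < jl\<close> gives \<open>2 powi (- j) \<ge> 2 * lb\<close>; the factor 2 yields
  strictness. With \<open>U\<close> the whole space, patching is the identity. This is why the
  levels start at \<open>jl\<close>.\<close>

lemma close_init: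
  assumes "j < jl"
  shows "close j F"
  unfolding close_def
proof (intro bexI conjI ballI)
  show "DIS MX c F \<subseteq> space MX" by (auto simp: DIS_def)
  fix h assume h: "h \<in> F"
  have "lb < 2 * 2 powr (log 2 lb)" using lb(1) by simp
  also have "\<dots> = 2 powr (1 + log 2 lb)" by (simp add: powr_add)
  also have "\<dots> \<le> 2 powr (of_int (- j))"
    using assms by (intro powr_mono) (simp_all add: jl_def j_ell_def, linarith)
  also have "\<dots> = 2 powi (- j)" using powr_real_of_int'[of 2 "- j"] by simp
  finally have "ereal lb < ereal (2 powi (- j))" by simp
  moreover have "risk l P h - risk l P f \<le> ereal lb"
    using risk_le_lb[OF h] risk_nonneg[of f] risk_nonneg[of h] by (metis ereal_diff_le_mono_left order_trans)
  ultimately have "risk l P h - risk l P f < ereal (2 powi (- j))" by (rule le_less_trans[rotated])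
  moreover have "patch (space MX) f h = h" using h F_subset f_Fstar by (intro patch_space) auto
  ultimately show "risk l P (patch (space MX) f h) - risk l P f < ereal (2 powi (- j))" by simp
qed simp

lemma close_Gset:
  assumes "close (j - 2) V" "V \<subseteq> F" "f \<in> V"
  shows "V \<subseteq> Gset MX c F l P j"
proof
  fix h assume "h \<in> V"
  obtain U where "U \<in> sets MX" "DIS MX c V \<subseteq> U"
    "risk l P (patch U f h) - risk l P f < ereal (2 powi (2 - j))"
    using assms(1) \<open>h \<in> V\<close> unfolding close_def by (auto simp: algebra_simps)
  then show "h \<in> Gset MX c F l P j"
    using assms \<open>h \<in> V\<close> by (intro excess_in_Gset[OF distribution F_subset f_in_F f_min])
qed

lemma close_er:
  assumes "close j V" "V \<subseteq> F" "f \<in> V" "h \<in> V" "ereal (2 powi (- j)) \<le> Gamma_l MX c l P \<epsilon>"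
  shows "er c P h - er c P f \<le> \<epsilon>"
proof -
  obtain U where U: "U \<in> sets MX" "DIS MX c V \<subseteq> U"
    "risk l P (patch U f h) - risk l P f < ereal (2 powi (- j))"
    using assms(1,4) unfolding close_def by auto
  have "patch U f h \<in> err_set c P (Fstar MX) \<epsilon>"
    using assms F_subset f_Fstar
    by (intro err_set_of_excess_less_Gamma[OF distribution f_Fstar f_min _ U(3)] patch_in_Fstar U(1)) auto
  then show ?thesis
    using err_set_FstarD(1)[OF distribution f_Fstar, of "patch U f h" c \<epsilon>]
      er_patch[OF distribution assms(4,3) U(2)] by simp
qed

text \<open>By the monotonicity of \<open>\<phi>0\<close>, the class may be enlarged to
  \<open>Fj\<close> and the sample size lowered from \<open>a\<close> to the \<open>m\<close>
  provided by \<open>Mring\<close>. The radius grows to that of the near-optimal part of the hull of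
  \<open>Fj\<close>, which contains the patched class because \<open>V\<close> is close at level
  \<open>j - 2\<close>.\<close>

lemma Utilde_level:
  assumes j: "jl \<le> j" "uu j = 2 * a"
    and V: "close (j - 2) V" "V \<subseteq> F" "f \<in> V" and D: "DIS MX c V \<in> sets MX"
  shows "Utilde l lb K (patch_set V (DIS MX c V) f) P a (sh (uu j)) \<le> ereal (2 powi (- j - 1))"
proof -
  define s where "s = sh (uu j)"
  have "1 \<le> uu j" using uu_power[OF j(1)] by (auto simp: log2_pos_int_def)
  then have s: "0 \<le> s" using sh_ge[of "uu j"] by (simp add: s_def)
  let ?D = "DIS MX c V" and ?G = "Gset MX c F l P j" and ?Fj = "Fj MX c F l P f j"
  let ?H = "patch_set V ?D f"
  have VG: "V \<subseteq> ?G" by (rule close_Gset[OF V])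
  have GF: "?G \<subseteq> F" by (auto simp: Gset_def err_set_def)
  have DG: "?D \<subseteq> DIS MX c ?G" by (rule DIS_mono[OF VG])
  \<comment> \<open>Members of \<open>V\<close> need not lie in \<open>Fj\<close>, but they do after
    patching on the larger region. The monotonicity of \<open>\<phi>0\<close> permits one further
    patch on \<open>DIS MX c V\<close>, and the two patches compose to the smaller one.\<close>
  define H0 where "H0 = patch_set V (DIS MX c ?G) f"
  have H: "?H = patch_set H0 ?D f"
    unfolding H0_def patch_set_def image_image patch_patch[OF DG] ..
  have f_mem: "f \<in> ?H" "f \<in> H0" "f \<in> ?Fj"
    using V(3) VG unfolding H0_def patch_set_def Fj_def by (metis image_eqI patch_self subsetD)+
  have H0F: "H0 \<subseteq> ?Fj" using VG by (auto simp: H0_def Fj_def patch_set_def)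
  have FjF: "?Fj \<subseteq> fhull MX F"
    unfolding Fj_def by (intro patch_set_subset_fhull GF F_subset f_in_F Gset_measurable j)
  have HF: "?H \<subseteq> fhull MX F" by (intro patch_set_subset_fhull V F_subset f_in_F D)
  \<comment> \<open>\<open>g\<close> mixes a member of \<open>Fj\<close> with \<open>f\<close>, also
    in \<open>Fj\<close>, so each of its values is attained in \<open>Fj\<close> even if
    \<open>g\<close> itself is not a member.\<close>
  have HFj: "?H \<subseteq> fhull MX ?Fj"
  proof
    fix g assume g: "g \<in> ?H"
    have "g \<in> patch_set H0 ?D f" unfolding H[symmetric] by (rule g)
    then obtain h where h: "h \<in> H0" "g = patch ?D f h" unfolding patch_set_def by blast
    have "(INF h\<in>?Fj. h x) \<le> g x \<and> g x \<le> (SUP h\<in>?Fj. h x)" for x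
    proof -
      obtain k where k: "k \<in> ?Fj" "g x = k x"
        using h H0F f_mem(3) unfolding patch_def by (cases "x \<in> ?D") auto
      show ?thesis unfolding k(2) by (intro conjI INF_lower SUP_upper k(1))
    qed
    then show "g \<in> fhull MX ?Fj" using g HF by (auto simp: fhull_def)
  qed
  have hull_min: "(INF g\<in>fhull MX ?Fj. risk l P g) = risk l P f"
  proof (rule antisym)
    show "(INF g\<in>fhull MX ?Fj. risk l P g) \<le> risk l P f"
      using f_mem(1) HFj by (intro INF_lower) auto
    show "risk l P f \<le> (INF g\<in>fhull MX ?Fj. risk l P g)"
      by (intro INF_greatest f_min) (auto simp: fhull_def)
  qed
  obtain U where U: "U \<in> sets MX" "?D \<subseteq> U"
    "\<And>h. h \<in> V \<Longrightarrow> risk l P (patch U f h) - risk l P f < ereal (2 powi (2 - j))"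
    using V(1) unfolding close_def by (auto simp: algebra_simps)
  have "?H \<subseteq> surr_set l P (fhull MX ?Fj) (2 powi (2 - j))"
  proof
    fix g assume g: "g \<in> ?H"
    then obtain h where h: "h \<in> V" "g = patch ?D f h" by (auto simp: patch_set_def)
    \<comment> \<open>Closeness is witnessed by some \<open>U\<close> containing the current region;
      patching further, down to that region, puts in more optimal values and so cannot raise the
      risk.\<close>
    have "risk l P (patch ?D f (patch U f h)) \<le> risk l P (patch U f h)"
      using h V F_subset f_Fstar by (intro risk_patch_f_le D patch_in_Fstar U(1)) auto
    then have "risk l P g - risk l P f \<le> risk l P (patch U f h) - risk l P f"
      unfolding h(2) patch_patch[OF U(2)] by (intro ereal_minus_mono) auto
    then show "g \<in> surr_set l P (fhull MX ?Fj) (2 powi (2 - j))"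
      using U(3)[OF h(1)] g HFj hull_min by (auto simp: surr_set_def)
  qed
  then have Dle: "Dset l P ?H \<le> Dset l P (surr_set l P (fhull MX ?Fj) (2 powi (2 - j)))" (is "_ \<le> ?\<sigma>")
    unfolding Dset_def by (intro SUP_subset_mono) auto
  have D0: "0 \<le> Dset l P ?H" by (rule Dset_nonneg[OF f_mem(1)])
  have "2 * Mring MX l lb K \<phi>0 (2 powi (- j - 1)) (2 powi (2 - j)) ?Fj P s \<le> enat (2 * a)"
    using uu_ge[OF j(1)] j(2) by (simp add: s_def)
  then obtain m where m: "1 \<le> m" "m \<le> a" "Uring MX l lb K \<phi>0 ?Fj (2 powi (2 - j)) P m s \<le> ereal (2 powi (- j - 1))"
    by (rule Mring_leD)
  have a1: "1 \<le> a" using m by simp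
  have adm: "(\<forall>\<sigma> \<sigma>' H' U m'. 0 \<le> \<sigma> \<and> \<sigma> \<le> \<sigma>' \<and> H \<subseteq> H' \<and> H' \<subseteq> fhull MX F \<and> U \<in> sets MX \<and>
        1 \<le> m' \<and> m' \<le> a \<longrightarrow> \<phi>0 \<sigma> (patch_set H U f) a P \<le> \<phi>0 \<sigma>' H' m' P) \<and>
      (\<forall>\<sigma>. 0 \<le> \<sigma> \<and> Dset l P H \<le> \<sigma> \<longrightarrow> phi l H a P \<le> \<phi>0 \<sigma> H a P)"
    if "H \<subseteq> fhull MX F" "f \<in> H" for H
    unfolding f_def
    by (rule admissible[unfolded admissible_def, THEN spec, THEN spec, THEN spec, THEN mp])
      (intro conjI that[unfolded f_def] distribution a1)
  have \<sigma>: "0 \<le> ?\<sigma>" using D0 Dle by (rule order_trans)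
  have "phi l ?H a P \<le> \<phi>0 ?\<sigma> ?H a P"
    by (rule adm[OF HF f_mem(1), THEN conjunct2, THEN spec, THEN mp]) (intro conjI \<sigma> Dle)
  also have "\<dots> \<le> \<phi>0 ?\<sigma> ?Fj m P"
    unfolding H
    by (rule adm[OF order_trans[OF H0F FjF] f_mem(2), THEN conjunct1, THEN spec, THEN spec, THEN spec,
          THEN spec, THEN spec, THEN mp])
      (intro conjI \<sigma> order_refl H0F FjF D m)
  finally have phi: "phi l ?H a P \<le> \<phi>0 ?\<sigma> ?Fj m P" .
  have frac: "s / real a \<le> s / real m" using s m by (intro divide_left_mono) auto
  have "Utilde l lb K ?H P a s \<le> Uring MX l lb K \<phi>0 ?Fj (2 powi (2 - j)) P m s"
    unfolding Utilde_def Uring_def Let_def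
  proof (intro ereal_mult_left_mono add_mono phi)
    have "Dset l P ?H * ereal (sqrt (s / real a)) \<le> ?\<sigma> * ereal (sqrt (s / real a))"
      by (intro ereal_mult_right_mono Dle) (use s in simp)
    also have "\<dots> \<le> ?\<sigma> * ereal (sqrt (s / real m))"
      using frac D0 Dle by (intro ereal_mult_left_mono) auto
    finally show "Dset l P ?H * ereal (sqrt (s / real a)) \<le> ?\<sigma> * ereal (sqrt (s / real m))" .
    show "ereal (lb * s / real a) \<le> ereal (lb * s / real m)"
      using mult_left_mono[OF frac, of lb] lb(1) by simp
  qed (use K_nonneg in simp)
  then show ?thesis using m(3) unfolding s_def by (rule order_trans)
qed

text \<open>Each data point is charged to the first level whose sample size reaches it, so that the
  preceding level is already complete when the point is drawn.\<close>

definition level :: "int \<Rightarrow> nat \<Rightarrow> int" where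
  "level je k = Min {j \<in> {jl..je}. k \<le> uu j}"

lemma level:
  assumes "jl \<le> je" "2 \<le> k" "k \<le> uu je"
  shows "level je k \<in> {jl..je}" "k \<le> uu (level je k)" "uu (level je k - 1) < k"
proof -
  let ?A = "{j \<in> {jl..je}. k \<le> uu j}"
  have fin: "finite ?A" by (rule finite_subset[of _ "{jl..je}"]) auto
  have "level je k \<in> ?A"
    unfolding level_def using assms by (intro Min_in fin) auto
  then show *: "level je k \<in> {jl..je}" "k \<le> uu (level je k)" by auto
  show "uu (level je k - 1) < k"
  proof (cases "level je k = jl")
    case True
    then show ?thesis using uu_init assms by simp
  next
    case False
    show ?thesis
    proof (rule ccontr)
      assume "\<not> uu (level je k - 1) < k"
      then have "level je k - 1 \<in> ?A" using * False by auto
      then have "level je k \<le> level je k - 1" unfolding level_def by (intro Min_le fin) auto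
      then show False by simp
    qed
  qed
qed

lemma DIS_subset_Uj:
  assumes "close (j - 2) V" "V \<subseteq> F" "f \<in> V"
  shows "DIS MX c V \<subseteq> Uj MX c F l P f j"
  unfolding Uj_def Fj_def by (rule order_trans[OF DIS_mono[OF close_Gset[OF assms]] DIS_subset_patch_set])

text \<open>The three claims need each other: survival of \<open>f\<close> makes the concentration
  event applicable, closeness places the next request in \<open>Uj\<close>, and a count below
  \<open>n\<close> ensures that the class named in \<open>good\<close>, which comes from a run
  limited to \<open>n\<close> requests, is the current version space.\<close>

lemma run_invariant:
  fixes d :: "nat \<Rightarrow> 'a \<times> real" and \<xi> :: "nat \<Rightarrow> real"
  assumes je: "jl \<le> je"
    and data: "\<And>k. 1 \<le> k \<Longrightarrow> d k \<in> space MX \<times> {-1, 1}"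
    and K: "0 \<le> K1" "0 \<le> K2" "0 \<le> K3"
    and good: "\<And>i V. 1 \<le> i \<Longrightarrow> 2 ^ i \<le> uu je \<Longrightarrow> V = alg_V MX c F l sh (2 ^ (i - 1)) n d \<xi> \<Longrightarrow>
      DIS MX c V \<in> sets MX \<and> (f \<in> V \<longrightarrow>
        conc_event l lb K1 K2 K3 K (patch_set V (DIS MX c V) f) f P (sh (2 ^ i)) {2 ^ (i - 1) + 1..2 ^ i} d \<xi>)"
    and hits: "card {k \<in> {2..uu je}. fst (d k) \<in> Uj MX c F l P f (level je k)} < n"
    and m: "1 \<le> m" "m \<le> uu je"
  defines "st \<equiv> alg_state MX c F l sh d \<xi>"
  defines "bad \<equiv> \<lambda>k. fst (d k) \<in> Uj MX c F l P f (level je k)"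
  shows "f \<in> fst (st m) \<and> snd (snd (snd (st m))) \<le> card {k \<in> {2..m}. bad k}
    \<and> (\<forall>j\<in>{jl - 2..je}. uu j \<le> m \<longrightarrow> close j (fst (st m)))"
  using m
proof (induction m rule: dec_induct)
  case base
  \<comment> \<open>Levels from \<open>jl\<close> on have \<open>uu j \<ge> 2\<close>, since
    \<open>log2_pos_int\<close> excludes 1; only the initial levels have to be close at the
    start.\<close>
  have "j < jl" if "uu j \<le> 1" for j
  proof (rule ccontr)
    assume "\<not> j < jl"
    then obtain k where "1 \<le> k" "uu j = 2 ^ k" using uu_power[of j] by (auto simp: log2_pos_int_def)
    then show False using that power_increasing[of 1 k "2::nat"] by simp
  qed
  then show ?case using f_in_F close_init by (auto simp: st_def)
next
  case (step m)
  let ?V = "fst (st m)" and ?V' = "fst (st (Suc m))"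
  have IH: "f \<in> ?V" "snd (snd (snd (st m))) \<le> card {k \<in> {2..m}. bad k}"
    "\<And>j. j \<in> {jl - 2..je} \<Longrightarrow> uu j \<le> m \<Longrightarrow> close j ?V"
    using step by auto
  have VF: "?V \<subseteq> F" using VS_antimono[of 1 m MX c F l sh d \<xi>] step(1) by (simp add: st_def)
  have V'V: "?V' \<subseteq> ?V" using VS_antimono[of m "Suc m" MX c F l sh d \<xi>] step(1) by (simp add: st_def)
  have few: "snd (snd (snd (st m))) < n"
  proof -
    have "card {k \<in> {2..m}. bad k} \<le> card {k \<in> {2..uu je}. bad k}"
      using step(2) step.prems by (intro card_mono) auto
    then show ?thesis using IH(2) hits by (simp add: bad_def)
  qed
  define \<tau> where "\<tau> = level je (Suc m)"
  have \<tau>: "\<tau> \<in> {jl..je}" "uu (\<tau> - 1) \<le> m"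
    using level[OF je, of "Suc m"] step by (auto simp: \<tau>_def)
  \<comment> \<open>Point \<open>Suc m\<close> comes after \<open>uu (\<tau> - 1)\<close>, hence
    after \<open>uu (\<tau> - 2)\<close>; closeness two levels back is what membership in
    \<open>Gset\<close> at level \<tau> asks for.\<close>
  have "uu (\<tau> - 2) \<le> uu (\<tau> - 1)"
    using uu_mono[of "\<tau> - 1"] uu_init \<tau>(1) by (cases "\<tau> = jl") (auto simp: algebra_simps)
  then have "close (\<tau> - 2) ?V" using \<tau> by (intro IH(3)) auto
  then have DU: "DIS MX c ?V \<subseteq> Uj MX c F l P f \<tau>"
    by (intro DIS_subset_Uj VF IH(1))
  have "snd (snd (snd (st (Suc m)))) \<le> card {k \<in> {2..Suc m}. bad k}"
  proof -
    have "{k \<in> {2..Suc m}. bad k} = (if bad (Suc m) then insert (Suc m) {k \<in> {2..m}. bad k} else {k \<in> {2..m}. bad k})"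
      using step(1) by (auto simp: le_Suc_eq)
    then have "card {k \<in> {2..Suc m}. bad k} = card {k \<in> {2..m}. bad k} + (if bad (Suc m) then 1 else 0)"
      by simp
    moreover have "bad (Suc m)" if "fst (d (Suc m)) \<in> DIS MX c ?V"
      using that DU by (auto simp: bad_def \<tau>_def)
    ultimately show ?thesis
      using alg_state_Suc_eq(3)[OF step(1), of MX c F l sh d \<xi>] IH(2) by (auto simp: st_def)
  qed
  moreover have "f \<in> ?V' \<and> (\<forall>j\<in>{jl - 2..je}. uu j = Suc m \<longrightarrow> close j ?V')"
  proof (cases "log2_pos_int (Suc m)")
    case False
    have "uu j \<noteq> Suc m" if "j \<in> {jl - 2..je}" for j
    proof (cases "jl \<le> j")
      case True
      then show ?thesis using uu_power[of j] False by auto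
    next
      case False
      then have "j = jl - 2 \<or> j = jl - 1" using that by auto
      then show ?thesis using uu_init step(1) by auto
    qed
    then show ?thesis
      using alg_state_Suc_eq(1)[OF step(1), of MX c F l sh d \<xi>] False IH(1) by (auto simp: st_def)
  next
    case True
    then obtain i where i: "1 \<le> i" "Suc m = 2 ^ i" by (auto simp: log2_pos_int_def)
    define a where "a = (2::nat) ^ (i - 1)"
    have a: "Suc m = 2 * a" "1 \<le> a" using i by (cases i; simp add: a_def)+
    have am: "a \<le> m" "m < 2 ^ Suc (i - 1)" using a i by auto
    have Va: "?V = fst (st a)"
      unfolding st_def a_def by (rule state_in_block) (use am in \<open>auto simp: a_def\<close>)
    \<comment> \<open>With fewer than \<open>n\<close> requests up to \<open>m\<close>, the run of
      budget \<open>a\<close> ends only because its data are used up.\<close>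
    have "alg_run MX c F l sh a n d \<xi> = st a"
      unfolding st_def
    proof (rule alg_run_full[OF a(2)])
      fix j assume "1 \<le> j" "j < a"
      then show "snd (snd (snd (alg_state MX c F l sh d \<xi> j))) < n"
        using TS_mono[of j m MX c F l sh d \<xi>] am few by (simp add: st_def)
    qed
    then have "?V = alg_V MX c F l sh (2 ^ (i - 1)) n d \<xi>"
      using Va by (simp add: alg_V_def a_def)
    then have D: "DIS MX c ?V \<in> sets MX"
      and conc: "conc_event l lb K1 K2 K3 K (patch_set ?V (DIS MX c ?V) f) f P (sh (2 * a)) {a + 1..2 * a} d \<xi>"
      using good[OF i(1), of ?V] IH(1) step.prems i(2) a by (auto simp: a_def)
    have fin: "loss l h (d k) = ereal (real_of_ereal (loss l h (d k)))" if "h \<in> ?V" "k \<in> {a + 1..2 * a}" for h k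
      using that VF by (intro loss_real data) auto
    have sh0: "0 < sh (2 * a)" using sh_ge[of "2 * a"] a(2) by linarith
    obtain \<rho> where \<rho>: "risk l P f = ereal \<rho>" by (rule risk_f_real)
    have V': "?V' = {h \<in> ?V. emp_risk l {k \<in> {a + 1..2 * a}. fst (d k) \<in> DIS MX c ?V} d h
        - (INF g\<in>?V. emp_risk l {k \<in> {a + 1..2 * a}. fst (d k) \<in> DIS MX c ?V} d g)
        \<le> Uhat l lb ?V {k \<in> {a + 1..2 * a}. fst (d k) \<in> DIS MX c ?V} d \<xi> (sh (2 * a))}"
      unfolding Va unfolding st_def a(1) lb_def by (rule VS_block_end[OF a_def])
    note upd = conc_event_block_update[OF conc IH(1) _ fin K _ sh0 \<rho>, folded V']
    have "f \<in> ?V'" using lb(1) by (intro upd(1)) auto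
    moreover have "close j ?V'" if j: "j \<in> {jl - 2..je}" "uu j = Suc m" for j
    proof -
      have jlj: "jl \<le> j"
      proof (rule ccontr)
        assume "\<not> jl \<le> j"
        then have "j = jl - 2 \<or> j = jl - 1" using j by auto
        then show False using uu_init j(2) step(1) by auto
      qed
      \<comment> \<open>The block ending at \<open>uu j\<close> begins after
        \<open>a = uu j / 2\<close> points, and these include the first
        \<open>uu (j - 2)\<close>.\<close>
      have "uu (j - 2) \<le> m" using uu_double[OF jlj] j(2) a am by simp
      then have "close (j - 2) ?V" using j(1) jlj by (intro IH(3)) auto
      then have "Utilde l lb K (patch_set ?V (DIS MX c ?V) f) P (card {a + 1..2 * a}) (sh (2 * a)) \<le> ereal (2 powi (- j - 1))"
        using Utilde_level[OF jlj, of a ?V] VF IH(1) D j(2) a(1) by simp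
      then have "risk l P (patch (DIS MX c ?V) f h) - risk l P f < ereal (2 * 2 powi (- j - 1))" if "h \<in> ?V'" for h
        using lb(1) that by (intro upd(2)) auto
      moreover have "2 * 2 powi (- j - 1) = (2 :: real) powi (- j)"
        by (simp add: power_int_diff)
      \<comment> \<open>The witness is the region before the filter, the one used for patching in
        the concentration event.\<close>
      ultimately show "close j ?V'"
        unfolding close_def using D DIS_mono[OF V'V] by (intro bexI[of _ "DIS MX c ?V"]) auto
    qed
    ultimately show ?thesis by blast
  qed
  moreover have "close j ?V'" if "j \<in> {jl - 2..je}" "uu j \<le> m" for j
    using close_antimono[OF IH(3)[OF that] V'V] .
  ultimately show ?case by (auto simp: le_Suc_eq)
qed

text \<open>The run cannot stop before \<open>uu je\<close>, as both budgets last that long. Later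
  filters only shrink the version space, and survival of \<open>f\<close> is used at
  \<open>uu je\<close> alone.\<close>

lemma alg_V_er:
  fixes d :: "nat \<Rightarrow> 'a \<times> real" and \<xi> :: "nat \<Rightarrow> real"
  assumes je: "jl \<le> je"
    and data: "\<And>k. 1 \<le> k \<Longrightarrow> d k \<in> space MX \<times> {-1, 1}"
    and K: "0 \<le> K1" "0 \<le> K2" "0 \<le> K3"
    and good: "\<And>i V. 1 \<le> i \<Longrightarrow> 2 ^ i \<le> uu je \<Longrightarrow> V = alg_V MX c F l sh (2 ^ (i - 1)) n d \<xi> \<Longrightarrow>
      DIS MX c V \<in> sets MX \<and> (f \<in> V \<longrightarrow>
        conc_event l lb K1 K2 K3 K (patch_set V (DIS MX c V) f) f P (sh (2 ^ i)) {2 ^ (i - 1) + 1..2 ^ i} d \<xi>)"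
    and hits: "card {k \<in> {2..uu je}. fst (d k) \<in> Uj MX c F l P f (level je k)} < n"
    and u: "uu je \<le> u" and h: "h \<in> alg_V MX c F l sh u n d \<xi>"
    and \<Gamma>: "ereal (2 powi (- je)) \<le> Gamma_l MX c l P \<epsilon>"
  shows "er c P h - er c P f \<le> \<epsilon>"
proof -
  let ?st = "alg_state MX c F l sh d \<xi>"
  note inv = run_invariant[OF je data K good hits]
  have u1: "1 \<le> uu je" using uu_power[OF je] by (auto simp: log2_pos_int_def)
  obtain M where M: "1 \<le> M" "alg_run MX c F l sh u n d \<xi> = ?st M"
    "\<not> (M < u \<and> snd (snd (snd (?st M))) < n)"
    using alg_run_cases[of u MX c F l sh n d \<xi>] u u1 by (metis order_trans)
  have "uu je \<le> M"
  proof (rule ccontr)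
    assume *: "\<not> uu je \<le> M"
    have "card {k \<in> {2..M}. fst (d k) \<in> Uj MX c F l P f (level je k)}
      \<le> card {k \<in> {2..uu je}. fst (d k) \<in> Uj MX c F l P f (level je k)}"
      using * by (intro card_mono) auto
    then show False using inv[of M] M * hits u by auto
  qed
  then have "h \<in> fst (?st (uu je))"
    using h M(2) VS_antimono[OF u1, of M MX c F l sh d \<xi>] by (auto simp: alg_V_def)
  moreover have "fst (?st (uu je)) \<subseteq> F"
    using VS_antimono[of 1 "uu je" MX c F l sh d \<xi>] u1 by simp
  moreover have "f \<in> fst (?st (uu je))" "close je (fst (?st (uu je)))"
    using inv[of "uu je"] u1 je by auto
  ultimately show ?thesis by (intro close_er[OF _ _ _ _ \<Gamma>])
qed

end

section \<open>From the level bounds to the probability of success\<close>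

lemma j_eps_le_Gamma:
  assumes "0 < G"
  shows "ereal (2 powi (- j_eps lb G)) \<le> G"
proof (cases G)
  case (real g)
  then have g: "0 < g" using assms by simp
  have "2 powi (- j_eps lb G) = 2 powr (real_of_int (- j_eps lb G))"
    by (rule powr_real_of_int'[symmetric]) simp_all
  also have "\<dots> \<le> 2 powr (log 2 g)"
  proof (rule powr_mono)
    have "log 2 (1 / g) \<le> real_of_int (j_eps lb G)" using real by (simp add: j_eps_def)
    then show "real_of_int (- j_eps lb G) \<le> log 2 g" using g by (simp add: log_divide)
  qed simp
  also have "\<dots> = g" using g by simp
  finally show ?thesis using real by simp
qed (use assms in auto)

theorem theorem18:
  fixes MX :: "'a measure" and F :: "('a \<Rightarrow> ereal) set" and P :: "('a \<times> real) measure"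
    and l :: "ereal \<Rightarrow> ennreal" and c :: real
    and zs :: "real \<Rightarrow> ereal" and \<eta> :: "('a \<times> real) measure \<Rightarrow> 'a \<Rightarrow> real"
    and \<phi>0 :: "ereal \<Rightarrow> ('a \<Rightarrow> ereal) set \<Rightarrow> nat \<Rightarrow> ('a \<times> real) measure \<Rightarrow> ereal"
    and K1 K2 K3 K :: real and sh :: "nat \<Rightarrow> real" and uu :: "int \<Rightarrow> nat"
    and \<epsilon> s :: real and u n :: nat
    and \<Omega> :: "'w measure" and X :: "nat \<Rightarrow> 'w \<Rightarrow> 'a" and Y \<xi> :: "nat \<Rightarrow> 'w \<Rightarrow> real"
    and hhat :: "'w \<Rightarrow> 'a \<Rightarrow> ereal"
  defines "lb \<equiv> lbar MX F l" and "f \<equiv> fopt MX zs (\<eta> P)"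
  defines "jl \<equiv> j_ell lb" and "je \<equiv> j_eps lb (Gamma_l MX c l P \<epsilon>)"
  assumes distribution: "is_distribution MX P"
    and sign_zero: "c \<in> {-1, 1}"
    and F_subset: "F \<subseteq> Fstar MX"
    and loss_measurable: "l \<in> borel_measurable borel"
    and loss_finite: "\<And>r::real. l (ereal r) < \<infinity>"
    and loss_bounded: "loss_sup MX F l < \<infinity>"
    and minimizer: "\<And>e. e \<in> {0..1} \<Longrightarrow> cond_risk l e (zs e) = lstar l e"
    and regression: "\<And>P'. is_distribution MX P' \<Longrightarrow> is_regression MX P' (\<eta> P')"
    and constants: "0 \<le> K1" "0 \<le> K2" "0 \<le> K3" "0 \<le> K"
    and conc: "concentration MX F l lb K1 K2 K3 K"
    and prob: "prob_space \<Omega>"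
    and data_indep: "prob_space.indep_vars \<Omega> (\<lambda>_. P) (\<lambda>k w. (X k w, Y k w)) {1..}"
    and data_distr: "\<And>k. 1 \<le> k \<Longrightarrow> distr \<Omega> P (\<lambda>w. (X k w, Y k w)) = P"
    and signs_indep: "prob_space.indep_vars \<Omega> (\<lambda>_. rademacher) \<xi> {1..}"
    and signs_distr: "\<And>k. 1 \<le> k \<Longrightarrow> distr \<Omega> rademacher (\<xi> k) = rademacher"
    and data_signs_indep: "prob_space.indep_set \<Omega>
          {(\<lambda>w. \<lambda>k\<in>{1..}. (X k w, Y k w)) -` A \<inter> space \<Omega> | A. A \<in> sets (\<Pi>\<^sub>M k\<in>{1..}. P)}
          {(\<lambda>w. \<lambda>k\<in>{1..}. \<xi> k w) -` B \<inter> space \<Omega> | B. B \<in> sets (\<Pi>\<^sub>M k\<in>{1..}. rademacher)}"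
    and calibrated: "classification_calibrated l"
    and admissible: "admissible MX F l zs \<eta> \<phi>0"
    and sh_ge: "\<And>m. 1 \<le> m \<Longrightarrow> 1 \<le> sh m"
    and uu_init: "uu (jl - 2) = 1" "uu (jl - 1) = 1"
    and uu_power: "\<And>j. jl \<le> j \<Longrightarrow> log2_pos_int (uu j)"
    and uu_ge: "\<And>j. jl \<le> j \<Longrightarrow>
          enat (uu j) \<ge> max (2 * Mring MX l lb K \<phi>0 (2 powi (- j - 1)) (2 powi (2 - j))
                                 (Fj MX c F l P f j) P (sh (uu j)))
                          (max (enat (uu (j - 1))) (enat (2 * uu (j - 2))))"
    and f_in_F: "f \<in> F"
    and DIS_measurable: "\<And>j. jl \<le> j \<Longrightarrow> DIS MX c (Gset MX c F l P j) \<in> sets MX"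
      "\<And>j. jl \<le> j \<Longrightarrow> Uj MX c F l P f j \<in> sets MX"
    and alg_meas: "alg_measurable MX c F l sh K1 K2 K3 K f P u n"
    and eps: "0 < \<epsilon>" "\<epsilon> < 1"
    and s: "1 \<le> s"
    and budgets_pos: "1 \<le> u" "1 \<le> n"
    and u_ge: "u \<ge> u_at lb uu je"
    and n_ge: "real n \<ge> s + 2 * exp 1 *
          (\<Sum>j=jl..je. measure (marginal MX P) (Uj MX c F l P f j) * real (uu j))"
    and returned: "\<And>w. w \<in> space \<Omega> \<Longrightarrow>
          alg_output MX c F l sh u n (\<lambda>k. (X k w, Y k w)) (\<lambda>k. \<xi> k w) (hhat w)"
    and event_measurable: "{w \<in> space \<Omega>. er c P (hhat w) - er c P f \<le> \<epsilon>} \<in> sets \<Omega>"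
  shows "(\<forall>w\<in>space \<Omega>.
            alg_unlabeled MX c F l sh u n (\<lambda>k. (X k w, Y k w)) (\<lambda>k. \<xi> k w) \<le> u \<and>
            alg_requests MX c F l sh u n (\<lambda>k. (X k w, Y k w)) (\<lambda>k. \<xi> k w) \<le> n) \<and>
         measure \<Omega> {w \<in> space \<Omega>. er c P (hhat w) - er c P f \<le> \<epsilon>}
           \<ge> 1 - 2 powr (- s)
               - (\<Sum>i=1..nat \<lfloor>log 2 (real (u_at lb uu je))\<rfloor>. 6 * exp (- sh (2 ^ i)))"
proof (intro conjI ballI)
  fix w
  show "alg_unlabeled MX c F l sh u n (\<lambda>k. (X k w, Y k w)) (\<lambda>k. \<xi> k w) \<le> u"
    "alg_requests MX c F l sh u n (\<lambda>k. (X k w, Y k w)) (\<lambda>k. \<xi> k w) \<le> n"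
    by (rule alg_budgets[OF budgets_pos(1)])+
next
  interpret prob_space \<Omega> by (rule prob)
  interpret label_complexity MX F P l c zs \<eta> \<phi>0 K sh uu lb f jl
    by unfold_locales
      (fact lb_def f_def jl_def distribution F_subset loss_measurable loss_bounded minimizer
        regression[OF distribution] constants(4) admissible sh_ge
        uu_init[unfolded jl_def lb_def] uu_power[unfolded jl_def lb_def]
        uu_ge[unfolded jl_def lb_def f_def] f_in_F[unfolded f_def]
        DIS_measurable(1)[unfolded jl_def lb_def])+
  let ?good = "{w \<in> space \<Omega>. er c P (hhat w) - er c P f \<le> \<epsilon>}"
  let ?Z = "\<lambda>k w. (X k w, Y k w)"
  define D where "D w = (\<lambda>k\<in>{1..}. ?Z k w)" for w
  define \<Xi> where "\<Xi> w = (\<lambda>k\<in>{1..}. \<xi> k w)" for w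
  obtain \<rho> where \<rho>: "risk l P f = ereal \<rho>" by (rule risk_f_real)
  \<comment> \<open>For \<open>Gamma_l = 0\<close> the index \<open>je\<close> would be a
    meaningless default, because of the division by 0 in \<open>j_eps\<close>.\<close>
  have "0 < Gamma_l MX c l P \<epsilon>"
    using loss_finite[of 0] \<rho>
    by (intro Gamma_l_pos[OF distribution regression sign_zero loss_measurable _ calibrated
          f_Fstar f_opt _ eps(1)]) (auto simp: zero_ereal_def)
  then have \<Gamma>: "ereal (2 powi (- je)) \<le> Gamma_l MX c l P \<epsilon>"
    unfolding je_def by (rule j_eps_le_Gamma)
  \<comment> \<open>The product space holds sequences restricted to \<open>{1..}\<close>; the
    algorithm reads no other index.\<close>
  have out: "hhat w \<in> alg_V MX c F l sh u n (D w) (\<Xi> w)" if "w \<in> space \<Omega>" for w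
  proof -
    have "hhat w \<in> alg_V MX c F l sh u n (\<lambda>k. ?Z k w) (\<lambda>k. \<xi> k w)"
      using returned[OF that] by (simp add: alg_output_def Let_def)
    also have "\<dots> = alg_V MX c F l sh u n (D w) (\<Xi> w)"
      using budgets_pos(1) by (intro alg_V_cong) (auto simp: D_def \<Xi>_def)
    finally show ?thesis .
  qed
  show "1 - 2 powr (- s) - (\<Sum>i=1..nat \<lfloor>log 2 (real (u_at lb uu je))\<rfloor>. 6 * exp (- sh (2 ^ i))) \<le> prob ?good"
  proof (cases "jl \<le> je")
    \<comment> \<open>Below \<open>jl\<close> the whole class already has the required accuracy;
      \<open>u_at\<close> is 1 and the sum of failure probabilities is empty.\<close>
    case False
    have "er c P (hhat w) - er c P f \<le> \<epsilon>" if "w \<in> space \<Omega>" for w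
      using out[OF that] alg_V_subset[OF budgets_pos(1), of MX c F l sh n "D w" "\<Xi> w"] False
      by (intro close_er[OF close_init _ f_in_F _ \<Gamma>]) auto
    then have "?good = space \<Omega>" by auto
    then show ?thesis using False by (simp add: u_at_def jl_def prob_space)
  next
    case True
    obtain L where L: "1 \<le> L" "uu je = 2 ^ L" using uu_power[OF True] by (auto simp: log2_pos_int_def)
    have uat: "u_at lb uu je = 2 ^ L" using True L by (simp add: u_at_def jl_def)
    then have Llog: "nat \<lfloor>log 2 (real (u_at lb uu je))\<rfloor> = L" by (simp add: log_nat_power)
    have uuu: "uu je \<le> u" using u_ge uat L(2) by simp
    have Z_rv: "?Z k \<in> \<Omega> \<rightarrow>\<^sub>M P" if "1 \<le> k" for k
      using data_indep that by (auto simp: indep_vars_def)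
    have bounded: "loss l h (x, y) \<le> ereal (lbar MX F l)"
      if "h \<in> F" "x \<in> space MX" "y \<in> {-1, 1}" for h x y
      using loss_le[OF that] by (simp add: lb_def)
    define V where "V i w = alg_V MX c F l sh (2 ^ (i - 1)) n (fst w) (snd w)" for i :: nat and w
    define E where "E i = {w \<in> space (seq_space MX). f \<in> V i w \<longrightarrow>
      conc_event l lb K1 K2 K3 K (patch_set (V i w) (DIS MX c (V i w)) f) f P (sh (2 ^ i))
        {2 ^ (i - 1) + 1..2 ^ i} (fst w) (snd w)}" for i
    let ?S = "PiM {1::nat..} (\<lambda>_. P)" and ?R = "PiM {1::nat..} (\<lambda>_. rademacher)"
    have law: "(\<lambda>w. (D w, \<Xi> w)) \<in> \<Omega> \<rightarrow>\<^sub>M (?S \<Otimes>\<^sub>M ?R)"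
      "distr \<Omega> (?S \<Otimes>\<^sub>M ?R) (\<lambda>w. (D w, \<Xi> w)) = ?S \<Otimes>\<^sub>M ?R"
      unfolding D_def \<Xi>_def
      by (rule distr_indep_sequences[OF data_indep data_distr signs_indep signs_distr data_signs_indep]; assumption)+
    have DX_space: "(D w, \<Xi> w) \<in> space (seq_space MX)" if "w \<in> space \<Omega>" for w
      using measurable_space[OF law(1) that] sets_eq_imp_space_eq[OF sets_seq_space[OF distribution]] by simp
    have E: "E i \<in> sets (?S \<Otimes>\<^sub>M ?R)" "1 - 6 * exp (- sh (2 ^ i)) \<le> measure (?S \<Otimes>\<^sub>M ?R) (E i)"
      if i: "i \<in> {1..L}" for i
    proof -
      have iu: "1 \<le> i" "2 ^ i \<le> u"
        using i order_trans[OF power_increasing[of i L "2::nat"]] uuu L(2) by simp_all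
      have "1 \<le> sh (2 ^ i)" by (intro sh_ge) simp
      note p = conc_event_prob[OF distribution conc[unfolded lb_def] F_subset f_in_F bounded f_min alg_meas iu this,
          folded lb_def V_def, folded E_def]
      show "E i \<in> sets (?S \<Otimes>\<^sub>M ?R)" "1 - 6 * exp (- sh (2 ^ i)) \<le> measure (?S \<Otimes>\<^sub>M ?R) (E i)"
        by (rule p; assumption)+
    qed
    define C where "C i = {w \<in> space \<Omega>. (D w, \<Xi> w) \<notin> E i}" for i
    have C: "C i \<in> events" "prob (C i) \<le> 6 * exp (- sh (2 ^ i))" if i: "i \<in> {1..L}" for i
    proof -
      let ?E = "(\<lambda>w. (D w, \<Xi> w)) -` E i \<inter> space \<Omega>"
      have ev: "?E \<in> events" by (rule measurable_sets[OF law(1) E(1)[OF i]])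
      have eq: "C i = space \<Omega> - ?E" by (auto simp: C_def)
      show "C i \<in> events" unfolding eq using ev by simp
      have "prob ?E = measure (?S \<Otimes>\<^sub>M ?R) (E i)"
        using measure_distr[OF law(1) E(1)[OF i]] law(2) by simp
      then show "prob (C i) \<le> 6 * exp (- sh (2 ^ i))"
        unfolding eq using prob_compl[OF ev] E(2)[OF i] by simp
    qed
    \<comment> \<open>\<open>level\<close> depends on the index alone, so these hit regions are
      fixed sets and the hits at different indices are independent.\<close>
    define B where "B k = Uj MX c F l P f (level je k) \<times> {-1, 1 :: real}" for k
    have lev: "level je k \<in> {jl..je}" "k \<le> uu (level je k)" if "k \<in> {2..uu je}" for k
      using level[OF True, of k] that by auto
    have Bsets: "B k \<in> sets P" if "k \<in> {2..uu je}" for k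
      unfolding B_def using lev[OF that] by (intro sets_Times_distribution[OF distribution] DIS_measurable(2)) auto
    define A where "A = {w \<in> space \<Omega>. n \<le> card {k \<in> {2..uu je}. ?Z k w \<in> B k}}"
    define q where "q j = measure (marginal MX P) (Uj MX c F l P f j)" for j
    have "(\<Sum>k\<in>{2..uu je}. measure (distr \<Omega> P (?Z k)) (B k)) = (\<Sum>k\<in>{2..uu je}. q (level je k))"
    proof (rule sum.cong)
      fix k assume k: "k \<in> {2..uu je}"
      then have "distr \<Omega> P (?Z k) = P" by (intro data_distr) auto
      then show "measure (distr \<Omega> P (?Z k)) (B k) = q (level je k)"
        unfolding q_def B_def using lev[OF k] by (simp add: measure_marginal[OF distribution DIS_measurable(2)])
    qed simp
    also have "\<dots> = (\<Sum>j\<in>{jl..je}. \<Sum>k\<in>{k \<in> {2..uu je}. level je k = j}. q (level je k))"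
      using lev by (intro sum.group[symmetric]) auto
    also have "\<dots> \<le> (\<Sum>j\<in>{jl..je}. q j * real (uu j))"
    proof (rule sum_mono)
      fix j assume "j \<in> {jl..je}"
      \<comment> \<open>Every point charged to level \<open>j\<close> has index at most
        \<open>uu j\<close>.\<close>
      have "card {k \<in> {2..uu je}. level je k = j} \<le> card {1..uu j}"
        using lev by (intro card_mono) auto
      then have "q j * real (card {k \<in> {2..uu je}. level je k = j}) \<le> q j * real (uu j)"
        by (intro mult_left_mono) (auto simp: q_def)
      then show "(\<Sum>k\<in>{k \<in> {2..uu je}. level je k = j}. q (level je k)) \<le> q j * real (uu j)"
        by (simp add: mult.commute)
    qed
    finally have "s + 2 * exp 1 * (\<Sum>k\<in>{2..uu je}. measure (distr \<Omega> P (?Z k)) (B k)) \<le> real n"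
      using n_ge unfolding q_def
      by (meson add_left_mono exp_ge_zero mult_left_mono mult_nonneg_nonneg order_trans zero_le_numeral)
    note hits = prob_many_hits_le[OF indep_vars_subset[OF data_indep] _ Bsets this, folded A_def]
    have A: "A \<in> events" "prob A \<le> 2 powr (- s)" by (rule hits; force)+
    \<comment> \<open>Outside \<open>A\<close> and all \<open>C i\<close> the deterministic bound
      applies; what remains is a union bound.\<close>
    have "space \<Omega> \<subseteq> ?good \<union> (A \<union> (\<Union>i\<in>{1..L}. C i))"
    proof (rule subsetI, rule ccontr)
      fix w assume w: "w \<in> space \<Omega>" and "w \<notin> ?good \<union> (A \<union> (\<Union>i\<in>{1..L}. C i))"
      then have bad: "\<not> er c P (hhat w) - er c P f \<le> \<epsilon>" "w \<notin> A" "\<And>i. i \<in> {1..L} \<Longrightarrow> (D w, \<Xi> w) \<in> E i"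
        by (auto simp: C_def)
      have data: "D w k \<in> space MX \<times> {-1, 1}" if "1 \<le> k" for k
        using measurable_space[OF Z_rv[OF that] w] that
        by (simp add: D_def space_distribution[OF distribution])
      have "er c P (hhat w) - er c P f \<le> \<epsilon>"
      proof (rule alg_V_er[OF True data constants(1-3) _ _ uuu out[OF w] \<Gamma>])
        fix i V'
        assume i: "1 \<le> i" "2 ^ i \<le> uu je" and V': "V' = alg_V MX c F l sh (2 ^ (i - 1)) n (D w) (\<Xi> w)"
        have iL: "i \<in> {1..L}" using i L(2) by simp
        have "V i (D w, \<Xi> w) = V'" by (simp add: V_def V')
        moreover have "(D w, \<Xi> w) \<in> E i" by (rule bad(3)[OF iL])
        moreover have "DIS MX c (V i (D w, \<Xi> w)) \<in> sets MX"
          using alg_meas[unfolded alg_measurable_def Let_def, THEN spec, of i] i uuu DX_space[OF w]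
          unfolding V_def by (meson order_trans)
        ultimately show "DIS MX c V' \<in> sets MX \<and> (f \<in> V' \<longrightarrow>
          conc_event l lb K1 K2 K3 K (patch_set V' (DIS MX c V') f) f P (sh (2 ^ i)) {2 ^ (i - 1) + 1..2 ^ i} (D w) (\<Xi> w))"
          by (simp add: E_def)
      next
        have "{k \<in> {2..uu je}. fst (D w k) \<in> Uj MX c F l P f (level je k)} \<subseteq> {k \<in> {2..uu je}. ?Z k w \<in> B k}"
          using data by (auto simp: D_def B_def)
        then have "card {k \<in> {2..uu je}. fst (D w k) \<in> Uj MX c F l P f (level je k)}
          \<le> card {k \<in> {2..uu je}. ?Z k w \<in> B k}" by (intro card_mono) auto
        then show "card {k \<in> {2..uu je}. fst (D w k) \<in> Uj MX c F l P f (level je k)} < n"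
          using bad(2) w by (auto simp: A_def)
      qed
      then show False using bad(1) by simp
    qed
    then have "1 \<le> prob (?good \<union> (A \<union> (\<Union>i\<in>{1..L}. C i)))"
      using event_measurable A(1) C(1) prob_space
      by (metis (no_types, lifting) finite_measure_mono sets.Un sets.finite_UN finite_atLeastAtMost)
    also have "\<dots> \<le> prob ?good + prob (A \<union> (\<Union>i\<in>{1..L}. C i))"
      using event_measurable A(1) C(1) by (intro measure_Un_le) auto
    also have "prob (A \<union> (\<Union>i\<in>{1..L}. C i)) \<le> prob A + prob (\<Union>i\<in>{1..L}. C i)"
      using A(1) C(1) by (intro measure_Un_le) auto
    also have "prob (\<Union>i\<in>{1..L}. C i) \<le> (\<Sum>i\<in>{1..L}. prob (C i))"
      using C(1) by (intro measure_UNION_le) auto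
    also have "\<dots> \<le> (\<Sum>i=1..L. 6 * exp (- sh (2 ^ i)))" by (intro sum_mono C(2))
    finally show ?thesis unfolding Llog using A(2) by linarith
  qed
qed

end
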